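(* Let $\mathcal{A}\in\mathbb{R}^{N_1\times N_2\times N_3}$, $\mathcal{B}\in\mathbb{R}^{N_1\times K\times N_3}$ and $\eta\in(0,1]$. Assume that the tensor linear system $\mathcal{A}*\mathcal{X}=\mathcal{B}$ is inconsistent, i.e. $\mathcal{B}\notin R(\mathcal{A})$, and let $\mathcal{B}^\perp:=\mathcal{B}-\mathcal{A}*\mathcal{A}^\dagger*\mathcal{B}\in\mathrm{null}(\mathcal{A}^\top)$ denote the component of $\mathcal{B}$ orthogonal to $R(\mathcal{A})$. Let $\{\mathcal{X}^{(k)}\}_{k\ge 0}$ be the sequence of $\mathcal{X}$-iterates generated by the TGDBEK algorithm (defined in the context) with parameter $\eta$, let $J_k\subseteq\{1,\dots,N_1\}$ be the row blocks it selects at iteration $k$, and let $\mathcal{X}_*=\mathcal{A}^\dagger*\mathcal{B}$. Let $\kappa_{\mathrm{block}}(\mathcal{A})$, $\sigma^+_{\min,\mathrm{block}}(\mathcal{A})$, $\theta_k$ and $\theta$ be the quantities defined in the context, where $\theta_k\in(0,1)$ for all $k\ge 0$ and $\theta=\min_{k\ge 0}\theta_k>0$. Put $$\alpha=1-\theta\cdot\kappa_{\mathrm{block}}(\mathcal{A}),\qquad \gamma=\frac{1}{\left(\sigma^+_{\min,\mathrm{block}}(\mathcal{A})\right)^2},\qquad \beta=1-\eta\,\frac{\left(\sigma_{\min}^+(\mathrm{bcirc}(\mathcal{A}))\right)^2}{\|\mathrm{bcirc}(\mathcal{A})\|_F^2}.$$ Then $\alpha\in(0,1)$ and $\beta\in(0,1)$,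 and $\{\mathcal{X}^{(k)}\}_{k\ge0}$ converges linearly in the Frobenius norm to the unique minimum-norm least-squares solution $\mathcal{X}_*=\mathcal{A}^\dagger*\mathcal{B}$ of $\mathcal{A}*\mathcal{X}=\mathcal{B}$. Specifically, for all $k\ge 0$: if $\alpha\ne\beta$, $$\|\mathcal{X}^{(k+1)}-\mathcal{X}_*\|_F^2\le \alpha^{k+1}\|\mathcal{X}^{(0)}-\mathcal{X}_*\|_F^2+\gamma\left(\frac{\alpha^{k+1}-\beta^{k+1}}{\alpha-\beta}\right)\beta\,\|\mathcal{B}-\mathcal{B}^\perp\|_F^2,$$ and if $\alpha=\beta$, $$\|\mathcal{X}^{(k+1)}-\mathcal{X}_*\|_F^2\le \alpha^{k+1}\|\mathcal{X}^{(0)}-\mathcal{X}_*\|_F^2+\gamma\,(k+1)\,\alpha^{k+1}\|\mathcal{B}-\mathcal{B}^\perp\|_F^2.$$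
   Context: **Tensors and the t-product.** For an integer $m\ge1$, $[m]=\{1,\dots,m\}$. For a real third-order tensor $\mathcal{A}\in\mathbb{R}^{N_1\times N_2\times N_3}$, $\mathcal{A}_{i,:,:}$, $\mathcal{A}_{:,j,:}$, $\mathcal{A}_{:,:,k}$ denote its horizontal, lateral and frontal slices. For $J\subseteq[N_1]$, $\mathcal{A}_{J,:,:}\in\mathbb{R}^{|J|\times N_2\times N_3}$ is the sub-tensor of horizontal slices with index in $J$; for $U\subseteq[N_2]$, $\mathcal{A}_{:,U,:}\in\mathbb{R}^{N_1\times|U|\times N_3}$ is the sub-tensor of lateral slices with index in $U$. $\mathrm{unfold}(\mathcal{A})\in\mathbb{R}^{N_1N_3\times N_2}$ stacks the frontal slices $\mathcal{A}_{:,:,1},\dots,\mathcal{A}_{:,:,N_3}$ vertically and $\mathrm{fold}$ is its inverse. $\mathrm{bcirc}(\mathcal{A})\in\mathbb{R}^{N_1N_3\times N_2N_3}$ is the block circulant matrix whose $(p,q)$ block ($1\le p,q\le N_3$) is $\mathcal{A}_{:,:,r}$ with $r\in[N_3]$, $r\equiv p-q+1 \pmod{N_3}$ (so the first block column is $\mathrm{unfold}(\mathcal{A})$). The t-product of $\mathcal{A}\in\mathbb{R}^{N_1\times N_2\times N_3}$ and $\mathcal{Y}\in\mathbb{R}^{N_2\times K\times N_3}$ is $\mathcal{A}*\mathcal{Y}:=\mathrm{fold}(\mathrm{bcirc}(\mathcal{A})\,\mathrm{unfold}(\mathcal{Y}))\in\mathbb{R}^{N_1\times K\times N_3}$. The transpose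 $\mathcal{A}^\top\in\mathbb{R}^{N_2\times N_1\times N_3}$ is obtained by transposing each frontal slice and then reversing the order of the transposed frontal slices $2$ through $N_3$. The Moore–Penrose pseudoinverse $\mathcal{A}^\dagger$ is the unique $N_2\times N_1\times N_3$ tensor with $\mathrm{bcirc}(\mathcal{A}^\dagger)=\mathrm{bcirc}(\mathcal{A})^\dagger$. $\mathcal{A}$ is viewed as the linear map $\mathcal{X}\mapsto\mathcal{A}*\mathcal{X}$ from $\mathbb{R}^{N_2\times K\times N_3}$ to $\mathbb{R}^{N_1\times K\times N_3}$, with $R(\mathcal{A})=\{\mathcal{A}*\mathcal{Y}:\mathcal{Y}\in\mathbb{R}^{N_2\times K\times N_3}\}$ and $\mathrm{null}(\mathcal{A})=\{\mathcal{X}:\mathcal{A}*\mathcal{X}=\mathcal{O}\}$ (similarly for other tensors, always with lateral dimension $K$ of the argument). $\|\cdot\|_F$ is the Frobenius norm (square root of the sum of squared entries), with the corresponding inner product. For a matrix, $\sigma_{\min}^+(\cdot)$ is the smallest nonzero singular value and $\sigma_{\max}(\cdot)$ the largest singular value. The minimum-norm least-squares solution of $\mathcal{A}*\mathcal{X}=\mathcal{B}$ is the minimizer of $\|\mathcal{A}*\mathcal{X}-\mathcal{B}\|_F$ of smallest Frobenius norm. **TGDBEK algorithm.** All horizontal slices $\mathcal{A}_{i,:,:}$ and lateral slices $\mathcal{A}_{:,j,:}$ of $\mathcal{A}$ are nonzero, so that the quotients below are defined. Given $\eta\in(0,1]$, initialize $\mathcal{X}^{(0)}=\mathcal{O}$,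 $\mathcal{Z}^{(0)}=\mathcal{B}$, and for $k=0,1,2,\dots$ do: 1. $\varepsilon_k^z=\eta\max_{1\le j\le N_2}\dfrac{\|(\mathcal{A}_{:,j,:})^\top*\mathcal{Z}^{(k)}\|_F^2}{\|\mathcal{A}_{:,j,:}\|_F^2}$, and $U_k=\{j\in[N_2]:\|(\mathcal{A}_{:,j,:})^\top*\mathcal{Z}^{(k)}\|_F^2\ge\varepsilon_k^z\|\mathcal{A}_{:,j,:}\|_F^2\}$. 2. $\mathcal{Z}^{(k+1)}=\mathcal{Z}^{(k)}-\mathcal{A}_{:,U_k,:}*(\mathcal{A}_{:,U_k,:})^\dagger*\mathcal{Z}^{(k)}$. 3. $\varepsilon_k^x=\eta\max_{1\le i\le N_1}\dfrac{\|\mathcal{B}_{i,:,:}-\mathcal{Z}^{(k+1)}_{i,:,:}-\mathcal{A}_{i,:,:}*\mathcal{X}^{(k)}\|_F^2}{\|\mathcal{A}_{i,:,:}\|_F^2}$, and $J_k=\{i\in[N_1]:\|\mathcal{B}_{i,:,:}-\mathcal{Z}^{(k+1)}_{i,:,:}-\mathcal{A}_{i,:,:}*\mathcal{X}^{(k)}\|_F^2\ge\varepsilon_k^x\|\mathcal{A}_{i,:,:}\|_F^2\}$. 4. $\mathcal{X}^{(k+1)}=\mathcal{X}^{(k)}+(\mathcal{A}_{J_k,:,:})^\dagger*\big(\mathcal{B}_{J_k,:,:}-\mathcal{Z}^{(k+1)}_{J_k,:,:}-\mathcal{A}_{J_k,:,:}*\mathcal{X}^{(k)}\big)$. **Geometric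 parameters.** Let $\Omega_r=\{J\subseteq[N_1]:J\ne\emptyset\}$. Define $$\kappa_{\mathrm{block}}(\mathcal{A}):=\min_{J\in\Omega_r}\frac{\left(\sigma_{\min}^+(\mathrm{bcirc}(\mathcal{A}_{J,:,:}))\right)^2}{\sigma_{\max}^2(\mathrm{bcirc}(\mathcal{A}_{J,:,:}))}\in(0,1],\qquad \sigma^+_{\min,\mathrm{block}}(\mathcal{A}):=\min_{J\in\Omega_r}\sigma_{\min}^+(\mathrm{bcirc}(\mathcal{A}_{J,:,:}))>0.$$ For $k\ge0$, $$\theta_k:=\frac{\left\|\left(\mathcal{X}^{(k)}-\mathcal{X}_*\right)_{R\left((\mathcal{A}_{J_k,:,:})^\top\right)}\right\|_F^2}{\left\|\mathcal{X}^{(k)}-\mathcal{X}_*\right\|_F^2},\qquad \theta:=\min_{k\ge0}\theta_k,$$ where $(\mathcal{E})_{R((\mathcal{A}_{J,:,:})^\top)}$ denotes the orthogonal projection of $\mathcal{E}$ onto $R((\mathcal{A}_{J,:,:})^\top)$, i.e. $(\mathcal{A}_{J,:,:})^\dagger*\mathcal{A}_{J,:,:}*\mathcal{E}$. It is part of the definition of these parameters that $\mathcal{X}^{(k)}\neq\mathcal{X}_*$ for all $k$ (so that $\theta_k$ is defined), that $\theta_k\in(0,1)$ for all $k\ge0$, and that the minimum $\theta$ exists and is positive. *)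

theory Defs
  imports
    Complex_Main
    "Jordan_Normal_Form.Char_Poly"
    "Jordan_Normal_Form.DL_Submatrix"
begin

section \<open>Matrices\<close>

definition mat_fnorm :: "real mat \<Rightarrow> real" where
  "mat_fnorm M = sqrt (\<Sum>i<dim_row M. \<Sum>j<dim_col M. (M $$ (i, j))\<^sup>2)"

text \<open>The Moore--Penrose pseudoinverse, characterised by the four Penrose equations.\<close>

definition mat_pinv :: "real mat \<Rightarrow> real mat" where
  "mat_pinv M = (THE P. P \<in> carrier_mat (dim_col M) (dim_row M) \<and>
     M * P * M = M \<and> P * M * P = P \<and>
     transpose_mat (M * P) = M * P \<and> transpose_mat (P * M) = P * M)"

text \<open>
  A matrix with more columns than rows gets \<open>0\<close> as an additional member of this set;
  this affects neither the largest nor the smallest nonzero singular value.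
\<close>

definition singular_values :: "real mat \<Rightarrow> real set" where
  "singular_values M = {sqrt l | l. eigenvalue (transpose_mat M * M) l}"

definition sigma_max :: "real mat \<Rightarrow> real" where
  "sigma_max M = Max (singular_values M)"

definition sigma_min_pos :: "real mat \<Rightarrow> real" where
  "sigma_min_pos M = Min {s \<in> singular_values M. s \<noteq> 0}"

section \<open>Third-order tensors\<close>

text \<open>
  A tensor is the list of its frontal slices. All indices start at \<open>0\<close>, so the index set
  \<open>[m]\<close> becomes \<open>{..<m}\<close>. The dimensions are read off the slices and are meaningful for members
  of \<open>tensor_carrier n1 n2 n3\<close> with \<open>n3 > 0\<close>.
\<close>

type_synonym tensor = "real mat list"

definition tensor_carrier :: "nat \<Rightarrow> nat \<Rightarrow> nat \<Rightarrow> tensor set" where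
  "tensor_carrier n1 n2 n3 = {A. length A = n3 \<and> set A \<subseteq> carrier_mat n1 n2}"

definition dim1 :: "tensor \<Rightarrow> nat" where "dim1 A = dim_row (hd A)"
definition dim2 :: "tensor \<Rightarrow> nat" where "dim2 A = dim_col (hd A)"
definition dim3 :: "tensor \<Rightarrow> nat" where "dim3 A = length A"

definition tzero :: "nat \<Rightarrow> nat \<Rightarrow> nat \<Rightarrow> tensor" where
  "tzero n1 n2 n3 = replicate n3 (0\<^sub>m n1 n2)"

definition tadd :: "tensor \<Rightarrow> tensor \<Rightarrow> tensor" (infixl "+\<^sub>t" 65) where
  "A +\<^sub>t B = map2 (+) A B"

definition tminus :: "tensor \<Rightarrow> tensor \<Rightarrow> tensor" (infixl "-\<^sub>t" 65) where
  "A -\<^sub>t B = map2 (-) A B"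

definition tinner :: "tensor \<Rightarrow> tensor \<Rightarrow> real" where
  "tinner A B = (\<Sum>k<dim3 A. \<Sum>i<dim1 A. \<Sum>j<dim2 A. A ! k $$ (i, j) * B ! k $$ (i, j))"

definition tnorm :: "tensor \<Rightarrow> real" where
  "tnorm A = sqrt (\<Sum>k<dim3 A. \<Sum>i<dim1 A. \<Sum>j<dim2 A. (A ! k $$ (i, j))\<^sup>2)"

definition hslices :: "tensor \<Rightarrow> nat set \<Rightarrow> tensor" where
  "hslices A J = map (\<lambda>M. submatrix M J UNIV) A"

definition lslices :: "tensor \<Rightarrow> nat set \<Rightarrow> tensor" where
  "lslices A U = map (\<lambda>M. submatrix M UNIV U) A"

definition unfold :: "tensor \<Rightarrow> real mat" where
  "unfold A = mat (dim1 A * dim3 A) (dim2 A)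
     (\<lambda>(i, j). A ! (i div dim1 A) $$ (i mod dim1 A, j))"

definition fold_tensor :: "nat \<Rightarrow> nat \<Rightarrow> nat \<Rightarrow> real mat \<Rightarrow> tensor" where
  "fold_tensor n1 n2 n3 M = map (\<lambda>k. mat n1 n2 (\<lambda>(i, j). M $$ (k * n1 + i, j))) [0..<n3]"

text \<open>
  Block \<open>(p, q)\<close> is the frontal slice with index \<open>p - q\<close> modulo the third dimension; the summand
  \<open>dim3 A\<close> keeps the subtraction on natural numbers from truncating.
\<close>

definition bcirc :: "tensor \<Rightarrow> real mat" where
  "bcirc A = mat (dim1 A * dim3 A) (dim2 A * dim3 A)
     (\<lambda>(i, j). A ! ((i div dim1 A + dim3 A - j div dim2 A) mod dim3 A)
                 $$ (i mod dim1 A, j mod dim2 A))"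

definition tprod :: "tensor \<Rightarrow> tensor \<Rightarrow> tensor" (infixl "*\<^sub>t" 70) where
  "A *\<^sub>t Y = fold_tensor (dim1 A) (dim2 Y) (dim3 A) (bcirc A * unfold Y)"

definition ttranspose :: "tensor \<Rightarrow> tensor" where
  "ttranspose A = map (\<lambda>k. transpose_mat (A ! ((dim3 A - k) mod dim3 A))) [0..<dim3 A]"

definition tpinv :: "tensor \<Rightarrow> tensor" where
  "tpinv A = (THE T. T \<in> tensor_carrier (dim2 A) (dim1 A) (dim3 A) \<and>
                     bcirc T = mat_pinv (bcirc A))"

text \<open>Here \<open>K\<close> is the lateral dimension of the argument of \<open>X \<mapsto> A *\<^sub>t X\<close>.\<close>

definition trange :: "nat \<Rightarrow> tensor \<Rightarrow> tensor set" where
  "trange K A = {A *\<^sub>t Y | Y. Y \<in> tensor_carrier (dim2 A) K (dim3 A)}"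

definition tnull :: "nat \<Rightarrow> tensor \<Rightarrow> tensor set" where
  "tnull K A = {X \<in> tensor_carrier (dim2 A) K (dim3 A). A *\<^sub>t X = tzero (dim1 A) K (dim3 A)}"

definition orth_proj :: "tensor set \<Rightarrow> tensor \<Rightarrow> tensor" where
  "orth_proj S E = (THE P. P \<in> S \<and> (\<forall>Q\<in>S. tinner (E -\<^sub>t P) Q = 0))"

definition least_squares_solution :: "tensor \<Rightarrow> tensor \<Rightarrow> tensor \<Rightarrow> bool" where
  "least_squares_solution A B X \<longleftrightarrow>
     X \<in> tensor_carrier (dim2 A) (dim2 B) (dim3 A) \<and>
     (\<forall>Y \<in> tensor_carrier (dim2 A) (dim2 B) (dim3 A).
        tnorm (A *\<^sub>t X -\<^sub>t B) \<le> tnorm (A *\<^sub>t Y -\<^sub>t B))"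

definition min_norm_least_squares_solution :: "tensor \<Rightarrow> tensor \<Rightarrow> tensor \<Rightarrow> bool" where
  "min_norm_least_squares_solution A B X \<longleftrightarrow>
     least_squares_solution A B X \<and>
     (\<forall>Y. least_squares_solution A B Y \<longrightarrow> tnorm X \<le> tnorm Y)"

text \<open>Linear (geometric) convergence in the root sense.\<close>

definition converges_linearly :: "(nat \<Rightarrow> tensor) \<Rightarrow> tensor \<Rightarrow> bool" where
  "converges_linearly X L \<longleftrightarrow>
     (\<exists>C \<rho>. 0 \<le> C \<and> 0 < \<rho> \<and> \<rho> < 1 \<and> (\<forall>k. tnorm (X k -\<^sub>t L) \<le> C * \<rho> ^ k))"

section \<open>The TGDBEK algorithm\<close>

definition eps_z :: "real \<Rightarrow> tensor \<Rightarrow> tensor \<Rightarrow> real" where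
  "eps_z \<eta> A Z = \<eta> * Max ((\<lambda>j. (tnorm (ttranspose (lslices A {j}) *\<^sub>t Z))\<^sup>2
                                 / (tnorm (lslices A {j}))\<^sup>2) ` {..<dim2 A})"

definition select_U :: "real \<Rightarrow> tensor \<Rightarrow> tensor \<Rightarrow> nat set" where
  "select_U \<eta> A Z = {j. j < dim2 A \<and>
     (tnorm (ttranspose (lslices A {j}) *\<^sub>t Z))\<^sup>2 \<ge> eps_z \<eta> A Z * (tnorm (lslices A {j}))\<^sup>2}"

text \<open>In the next two definitions, \<open>Z\<close> is the already updated iterate \<open>Z\<^sup>(\<^sup>k\<^sup>+\<^sup>1\<^sup>)\<close>.\<close>

definition eps_x :: "real \<Rightarrow> tensor \<Rightarrow> tensor \<Rightarrow> tensor \<Rightarrow> tensor \<Rightarrow> real" where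
  "eps_x \<eta> A B Z X =
     \<eta> * Max ((\<lambda>i. (tnorm (hslices B {i} -\<^sub>t hslices Z {i} -\<^sub>t hslices A {i} *\<^sub>t X))\<^sup>2
                    / (tnorm (hslices A {i}))\<^sup>2) ` {..<dim1 A})"

definition select_J :: "real \<Rightarrow> tensor \<Rightarrow> tensor \<Rightarrow> tensor \<Rightarrow> tensor \<Rightarrow> nat set" where
  "select_J \<eta> A B Z X = {i. i < dim1 A \<and>
     (tnorm (hslices B {i} -\<^sub>t hslices Z {i} -\<^sub>t hslices A {i} *\<^sub>t X))\<^sup>2
       \<ge> eps_x \<eta> A B Z X * (tnorm (hslices A {i}))\<^sup>2}"

text \<open>The iterates \<open>Z\<close> do not depend on the iterates \<open>X\<close>.\<close>

primrec tgdbek_Z :: "real \<Rightarrow> tensor \<Rightarrow> tensor \<Rightarrow> nat \<Rightarrow> tensor" where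
  "tgdbek_Z \<eta> A B 0 = B"
| "tgdbek_Z \<eta> A B (Suc k) =
     (let Z = tgdbek_Z \<eta> A B k; AU = lslices A (select_U \<eta> A Z)
      in Z -\<^sub>t AU *\<^sub>t tpinv AU *\<^sub>t Z)"

primrec tgdbek_X :: "real \<Rightarrow> tensor \<Rightarrow> tensor \<Rightarrow> nat \<Rightarrow> tensor" where
  "tgdbek_X \<eta> A B 0 = tzero (dim2 A) (dim2 B) (dim3 A)"
| "tgdbek_X \<eta> A B (Suc k) =
     (let X = tgdbek_X \<eta> A B k; Z = tgdbek_Z \<eta> A B (Suc k);
          J = select_J \<eta> A B Z X; AJ = hslices A J
      in X +\<^sub>t tpinv AJ *\<^sub>t (hslices B J -\<^sub>t hslices Z J -\<^sub>t AJ *\<^sub>t X))"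

definition tgdbek_J :: "real \<Rightarrow> tensor \<Rightarrow> tensor \<Rightarrow> nat \<Rightarrow> nat set" where
  "tgdbek_J \<eta> A B k = select_J \<eta> A B (tgdbek_Z \<eta> A B (Suc k)) (tgdbek_X \<eta> A B k)"

section \<open>Geometric parameters\<close>

definition row_blocks :: "tensor \<Rightarrow> nat set set" where
  "row_blocks A = {J. J \<subseteq> {..<dim1 A} \<and> J \<noteq> {}}"

definition kappa_block :: "tensor \<Rightarrow> real" where
  "kappa_block A =
     Min ((\<lambda>J. (sigma_min_pos (bcirc (hslices A J)))\<^sup>2 / (sigma_max (bcirc (hslices A J)))\<^sup>2)
          ` row_blocks A)"

definition sigma_min_block :: "tensor \<Rightarrow> real" where
  "sigma_min_block A = Min ((\<lambda>J. sigma_min_pos (bcirc (hslices A J))) ` row_blocks A)"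

definition theta_seq :: "real \<Rightarrow> tensor \<Rightarrow> tensor \<Rightarrow> nat \<Rightarrow> real" where
  "theta_seq \<eta> A B k =
     (let E = tgdbek_X \<eta> A B k -\<^sub>t tpinv A *\<^sub>t B
      in (tnorm (orth_proj (trange (dim2 B) (ttranspose (hslices A (tgdbek_J \<eta> A B k)))) E))\<^sup>2
           / (tnorm E)\<^sup>2)"

end

theory Submission
  imports
    Defs
    "Jordan_Normal_Form.Gauss_Jordan_Elimination"
    "Jordan_Normal_Form.Spectral_Radius"
    "HOL-Analysis.Function_Topology"
    "HOL-Analysis.Convex"
begin

text \<open>
  Since \<open>bcirc\<close> is multiplicative and compatible with transposes and pseudoinverses, everything is
  a statement about real matrices. The iterate \<open>Z\<close> moves by the projection \<open>P\<close> onto the column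
  space of the selected block, and \<open>D = Z - B\<^sup>\<bottom>\<close> stays in the range of \<open>A\<close>; the greedy rule bounds
  \<open>\<parallel>P D\<parallel>\<^sup>2\<close> below by \<open>1 - \<beta>\<close> times \<open>\<parallel>D\<parallel>\<^sup>2\<close>, so \<open>\<parallel>D\<parallel>\<^sup>2\<close> contracts by \<open>\<beta>\<close>. The new error of \<open>X\<close> is the
  orthogonal sum of the part of the old error outside the selected row space, of squared norm
  \<open>1 - \<theta>\<^sub>k\<close> times the old one, and of the pseudoinverse of the block applied to a part of \<open>D\<close>.
  This gives \<open>e\<^sub>k\<^sub>+\<^sub>1 \<le> \<alpha> e\<^sub>k + \<gamma> \<beta>\<^sup>k\<^sup>+\<^sup>1 \<parallel>B - B\<^sup>\<bottom>\<parallel>\<^sup>2\<close> for the squared errors, and both estimates follow by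
  solving this recursion.
\<close>

text \<open>\<open>mat_pinv\<close>, \<open>tpinv\<close> and \<open>orth_proj\<close> are definite
  descriptions and say nothing until existence and uniqueness are settled: Gauss-Jordan elimination
  provides the pseudoinverse, and its uniqueness forces it to be block circulant again. The lower
  bound by the smallest nonzero singular value comes from minimising over a compact set. The
  selected column block is estimated by its Frobenius norm because that is the total weight of the
  block in the greedy rule; the total weight of all columns is the squared norm of \<open>A\<close>.
  The factor N3 between the squared norms of a tensor and of its \<open>bcirc\<close> then turns the
  latter into the denominator in \<beta>. The constant \<gamma> bounds the squared norms of the
  pseudoinverses of all row blocks, and the factor 1 - \<theta> becomes \<alpha> because
  \<open>kappa_block A \<le> 1\<close>. The delicate claim is \<beta> > 0 for \<eta> = 1: it needs a
  strict inequality between the smallest nonzero singular value and the Frobenius norm, and for this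
  the errors of X must be known to stay in the row space of \<open>A\<close>.\<close>

lemma assoc_mult_mat_dim:
  fixes A :: "'a::semiring_0 mat"
  assumes "dim_col A = dim_row B" "dim_col B = dim_row C"
  shows "A * B * C = A * (B * C)"
  using assms by (intro assoc_mult_mat[of A "dim_row A" "dim_col A" B "dim_col B" C "dim_col C"]) auto

text \<open>As in the neighbouring rules, the premises are equations between dimensions. They
  contain no variable absent from the conclusion, so rewriting can discharge them.\<close>

lemma transpose_mult_dim:
  fixes A :: "'a::comm_semiring_0 mat"
  assumes "dim_col A = dim_row B"
  shows "(A * B)\<^sup>T = B\<^sup>T * A\<^sup>T"
  using assms by (intro transpose_mult[of A "dim_row A" "dim_col A" B "dim_col B"]) auto

lemma index_mult_mat_sum:
  assumes "i < dim_row A" "j < dim_col B" "dim_col A = dim_row B"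
  shows "(A * B) $$ (i, j) = (\<Sum>k<dim_row B. A $$ (i, k) * B $$ (k, j))"
  using assms by (simp add: scalar_prod_def lessThan_atLeast0)

lemma mult_minus_distrib_dim:
  fixes A :: "'a::ring mat"
  assumes "dim_col A = dim_row B" "dim_row C = dim_row B" "dim_col C = dim_col B"
  shows "A * (B - C) = A * B - A * C"
  using assms by (intro mult_minus_distrib_mat[of A "dim_row A" "dim_col A" B "dim_col B" C]) auto

lemma minus_mult_distrib_dim:
  fixes A :: "'a::ring mat"
  assumes "dim_col A = dim_row C" "dim_row A = dim_row B" "dim_col A = dim_col B"
  shows "(A - B) * C = A * C - B * C"
  using assms by (intro minus_mult_distrib_mat[of A "dim_row A" "dim_col A" B C "dim_col C"]) auto

lemma mult_add_distrib_dim: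
  fixes A :: "'a::semiring_0 mat"
  assumes "dim_col A = dim_row B" "dim_row C = dim_row B" "dim_col C = dim_col B"
  shows "A * (B + C) = A * B + A * C"
  using assms by (intro mult_add_distrib_mat[of A "dim_row A" "dim_col A" B "dim_col B" C]) auto

lemma minus_eq_zero_mat_iff:
  fixes A :: "'a::group_add mat"
  assumes "A \<in> carrier_mat m n" "B \<in> carrier_mat m n"
  shows "A - B = 0\<^sub>m m n \<longleftrightarrow> A = B"
  using assms by (auto simp: mat_eq_iff)

section \<open>The Frobenius inner product\<close>

text \<open>The summation ranges are those of the first argument; hence the dimension premises for
  symmetry and for linearity on the right.\<close>

definition mat_inner :: "real mat \<Rightarrow> real mat \<Rightarrow> real" where
  "mat_inner X Y = (\<Sum>i<dim_row X. \<Sum>j<dim_col X. X $$ (i, j) * Y $$ (i, j))"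

lemma mat_fnorm_sq: "(mat_fnorm M)\<^sup>2 = mat_inner M M"
  unfolding mat_fnorm_def mat_inner_def by (simp add: sum_nonneg power2_eq_square)

lemma mat_inner_commute:
  "dim_row X = dim_row Y \<Longrightarrow> dim_col X = dim_col Y \<Longrightarrow> mat_inner X Y = mat_inner Y X"
  by (simp add: mat_inner_def mult.commute)

lemma mat_inner_add_left:
  "dim_row X = dim_row Y \<Longrightarrow> dim_col X = dim_col Y \<Longrightarrow>
    mat_inner (X + Y) Z = mat_inner X Z + mat_inner Y Z"
  by (simp add: mat_inner_def distrib_right sum.distrib)

lemma mat_inner_minus_left:
  "dim_row X = dim_row Y \<Longrightarrow> dim_col X = dim_col Y \<Longrightarrow>
    mat_inner (X - Y) Z = mat_inner X Z - mat_inner Y Z"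
  by (simp add: mat_inner_def left_diff_distrib sum_subtractf)

lemma mat_inner_smult_left: "mat_inner (c \<cdot>\<^sub>m X) Z = c * mat_inner X Z"
  by (simp add: mat_inner_def sum_distrib_left mult.assoc)

lemma mat_inner_add_right:
  "dim_row Z = dim_row X \<Longrightarrow> dim_col Z = dim_col X \<Longrightarrow> dim_row X = dim_row Y \<Longrightarrow> dim_col X = dim_col Y \<Longrightarrow>
    mat_inner Z (X + Y) = mat_inner Z X + mat_inner Z Y"
  by (simp add: mat_inner_def distrib_left sum.distrib)

lemma mat_inner_smult_right:
  "dim_row X = dim_row Z \<Longrightarrow> dim_col X = dim_col Z \<Longrightarrow> mat_inner X (c \<cdot>\<^sub>m Z) = c * mat_inner X Z"
  by (simp add: mat_inner_def sum_distrib_left ac_simps)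

lemma mat_inner_nonneg: "0 \<le> mat_inner X X"
  by (simp add: mat_inner_def sum_nonneg)

lemma mat_inner_eq_0_iff:
  "mat_inner X X = 0 \<longleftrightarrow> X = 0\<^sub>m (dim_row X) (dim_col X)"
  by (auto simp: mat_inner_def sum_nonneg sum_nonneg_eq_0_iff mat_eq_iff)

lemma mat_inner_zero_right: "X \<in> carrier_mat m n \<Longrightarrow> mat_inner X (0\<^sub>m m n) = 0"
  by (simp add: mat_inner_def)

lemma mat_inner_add_self:
  assumes "X \<in> carrier_mat m n" "Y \<in> carrier_mat m n"
  shows "mat_inner (X + Y) (X + Y) = mat_inner X X + 2 * mat_inner X Y + mat_inner Y Y"
  using assms mat_inner_commute[of X Y]
  by (simp add: mat_inner_add_left mat_inner_add_right)

lemma mat_inner_transpose: "mat_inner (X\<^sup>T) (X\<^sup>T) = mat_inner X X"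
  unfolding mat_inner_def by (subst sum.swap) simp

lemma mat_inner_Cauchy_Schwarz:
  assumes "X \<in> carrier_mat m n" "Y \<in> carrier_mat m n"
  shows "(mat_inner X Y)\<^sup>2 \<le> mat_inner X X * mat_inner Y Y"
proof -
  let ?I = "{..<m} \<times> {..<n}"
  have "(\<Sum>p\<in>?I. X $$ p * Y $$ p)\<^sup>2 \<le> (\<Sum>p\<in>?I. (X $$ p)\<^sup>2) * (\<Sum>p\<in>?I. (Y $$ p)\<^sup>2)"
    by (rule Cauchy_Schwarz_ineq_sum)
  then show ?thesis
    using assms by (simp add: mat_inner_def sum.cartesian_product power2_eq_square case_prod_beta)
qed

lemma mat_inner_adjoint:
  assumes "M \<in> carrier_mat a b" "X \<in> carrier_mat b c" "Y \<in> carrier_mat a c"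
  shows "mat_inner (M * X) Y = mat_inner X (M\<^sup>T * Y)"
proof -
  have "mat_inner (M * X) Y = (\<Sum>i<a. \<Sum>j<c. \<Sum>k<b. M $$ (i, k) * X $$ (k, j) * Y $$ (i, j))"
    using assms by (simp add: mat_inner_def index_mult_mat_sum sum_distrib_right del: index_mult_mat(1))
  also have "\<dots> = (\<Sum>i<a. \<Sum>k<b. \<Sum>j<c. M $$ (i, k) * X $$ (k, j) * Y $$ (i, j))"
    by (intro sum.cong refl sum.swap)
  also have "\<dots> = (\<Sum>k<b. \<Sum>i<a. \<Sum>j<c. M $$ (i, k) * X $$ (k, j) * Y $$ (i, j))"
    by (rule sum.swap)
  also have "\<dots> = (\<Sum>k<b. \<Sum>j<c. \<Sum>i<a. M $$ (i, k) * X $$ (k, j) * Y $$ (i, j))"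
    by (intro sum.cong refl sum.swap)
  also have "\<dots> = mat_inner X (M\<^sup>T * Y)"
    using assms by (simp add: mat_inner_def index_mult_mat_sum sum_distrib_left ac_simps del: index_mult_mat(1))
  finally show ?thesis .
qed

text \<open>Cauchy-Schwarz in every entry of the product. The Frobenius norm of the left factor is
  the quantity that matches the weights of the greedy rule.\<close>

lemma mat_inner_mult_le:
  assumes "M \<in> carrier_mat a b" "X \<in> carrier_mat b c"
  shows "mat_inner (M * X) (M * X) \<le> mat_inner M M * mat_inner X X"
proof -
  have "mat_inner (M * X) (M * X) = (\<Sum>i<a. \<Sum>j<c. (\<Sum>k<b. M $$ (i, k) * X $$ (k, j))\<^sup>2)"
    using assms by (simp add: mat_inner_def index_mult_mat_sum power2_eq_square del: index_mult_mat(1))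
  also have "\<dots> \<le> (\<Sum>i<a. \<Sum>j<c. (\<Sum>k<b. (M $$ (i, k))\<^sup>2) * (\<Sum>k<b. (X $$ (k, j))\<^sup>2))"
    by (intro sum_mono Cauchy_Schwarz_ineq_sum)
  also have "\<dots> = (\<Sum>i<a. \<Sum>k<b. (M $$ (i, k))\<^sup>2) * (\<Sum>j<c. \<Sum>k<b. (X $$ (k, j))\<^sup>2)"
    by (simp add: sum_product)
  also have "(\<Sum>j<c. \<Sum>k<b. (X $$ (k, j))\<^sup>2) = (\<Sum>k<b. \<Sum>j<c. (X $$ (k, j))\<^sup>2)"
    by (rule sum.swap)
  finally show ?thesis
    using assms by (simp add: mat_inner_def power2_eq_square)
qed

text \<open>Over the reals \<open>M\<^sup>T * M\<close> has the same kernel as \<open>M\<close>: the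
  squared norm of \<open>M * D\<close> is the inner product of \<open>D\<close> with
  \<open>M\<^sup>T * M * D\<close>.\<close>

lemma gram_mult_cancel:
  fixes M :: "real mat"
  assumes "M \<in> carrier_mat a b" "X \<in> carrier_mat b c" "Y \<in> carrier_mat b c"
    and eq: "M\<^sup>T * M * X = M\<^sup>T * M * Y"
  shows "M * X = M * Y"
proof -
  let ?D = "X - Y"
  have D: "?D \<in> carrier_mat b c" using assms by auto
  have "M\<^sup>T * (M * ?D) = M\<^sup>T * M * X - M\<^sup>T * M * Y"
    using assms by (simp add: assoc_mult_mat_dim mult_minus_distrib_dim)
  also have "\<dots> = 0\<^sub>m b c" unfolding eq using assms by (auto simp: mat_eq_iff)
  finally have "mat_inner (M * ?D) (M * ?D) = 0"
    using assms D by (subst mat_inner_adjoint[of _ a b _ c]) (auto simp: mat_inner_zero_right)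
  then have "M * ?D = 0\<^sub>m a c" using assms by (simp add: mat_inner_eq_0_iff)
  then have "M * X - M * Y = 0\<^sub>m a c" using assms by (simp add: mult_minus_distrib_dim)
  then show ?thesis using assms by (subst (asm) minus_eq_zero_mat_iff) auto
qed

section \<open>The pseudoinverse\<close>

text \<open>Pivot columns are unit vectors, so picking them out with a 0-1 matrix \<open>G\<close>
  makes \<open>C * G\<close> diagonal, with entry 1 exactly at the nonzero rows of
  \<open>C\<close>.\<close>

lemma row_echelon_form_inner_inverse:
  fixes C :: "'a::field mat"
  assumes "row_echelon_form C" "C \<in> carrier_mat m n"
  obtains G where "G \<in> carrier_mat n m" "C * G * C = C"
proof -
  obtain f where f: "pivot_fun C f n"
    using assms by (auto simp: row_echelon_form_def)
  have dr: "dim_row C = m" using assms by auto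
  note p = pivot_funD[OF dr f]
  \<comment> \<open>\<open>f i\<close> is the pivot column of row \<open>i\<close>, and
    \<open>f i = n\<close> marks a zero row; column \<open>i\<close> of \<open>G\<close> is zero in
    that case.\<close>
  define G where "G = mat n m (\<lambda>(j, i). if f i = j then 1 else (0::'a))"
  have G: "G \<in> carrier_mat n m" by (simp add: G_def)
  have CG: "(C * G) $$ (i, k) = (if i = k \<and> f k < n then 1 else 0)" if "i < m" "k < m" for i k
  proof -
    have "(C * G) $$ (i, k) = (\<Sum>j<n. if j = f k then C $$ (i, j) else 0)"
    proof -
      have "(C * G) $$ (i, k) = (\<Sum>j<n. C $$ (i, j) * G $$ (j, k))"
        using that assms G by (subst index_mult_mat_sum) auto
      also have "\<dots> = (\<Sum>j<n. if j = f k then C $$ (i, j) else 0)"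
        using that by (intro sum.cong) (auto simp: G_def)
      finally show ?thesis .
    qed
    also have "\<dots> = (if f k < n then C $$ (i, f k) else 0)" by (subst sum.delta) auto
    also have "\<dots> = (if i = k \<and> f k < n then 1 else 0)"
      using p(4)[OF that(2)] p(5)[OF that(2) _ that(1)] by auto
    finally show ?thesis .
  qed
  have "C * G * C = C"
  proof (rule eq_matI)
    fix i l assume il: "i < dim_row C" "l < dim_col C"
    then have il': "i < m" "l < n" using assms by auto
    have "(C * G * C) $$ (i, l) = (\<Sum>k<m. (C * G) $$ (i, k) * C $$ (k, l))"
      using il assms G by (subst index_mult_mat_sum) auto
    also have "\<dots> = (\<Sum>k<m. if k = i then if f i < n then C $$ (i, l) else 0 else 0)"
      using il' by (intro sum.cong) (auto simp: CG)
    also have "\<dots> = (if f i < n then C $$ (i, l) else 0)" using il' by simp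
    also have "\<dots> = C $$ (i, l)" using p(1,2)[OF il'(1)] il'(2) by auto
    finally show "(C * G * C) $$ (i, l) = C $$ (i, l)" .
  qed (use assms G in auto)
  then show ?thesis using that G by blast
qed

text \<open>Row operations are invertible, so \<open>A = Q * C\<close>, and an inner inverse
  \<open>G\<close> of the echelon form \<open>C\<close> becomes \<open>G * P\<close> for
  \<open>A\<close>.\<close>

lemma inner_inverse_exists:
  fixes A :: "'a::field mat"
  assumes A: "A \<in> carrier_mat m n"
  obtains G where "G \<in> carrier_mat n m" "A * G * A = A"
proof -
  define C where "C = gauss_jordan_single A"
  from gauss_jordan_single[OF A C_def[symmetric]]
  obtain P Q where C: "C \<in> carrier_mat m n" "row_echelon_form C" and
    PQ: "C = P * A" "P \<in> carrier_mat m m" "Q \<in> carrier_mat m m" "Q * P = 1\<^sub>m m" by auto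
  obtain G where G: "G \<in> carrier_mat n m" "C * G * C = C"
    using row_echelon_form_inner_inverse[OF C(2,1)] .
  have QC: "Q * C = A"
    using PQ A assoc_mult_mat[OF PQ(3,2) A] by simp
  have "A * (G * P) * A = (Q * C) * (G * (P * A))"
    using PQ(2) G A by (simp add: QC assoc_mult_mat_dim)
  also have "\<dots> = Q * (C * G * C)"
    unfolding PQ(1)[symmetric] using PQ(3) G C by (simp add: assoc_mult_mat_dim)
  also have "\<dots> = A" by (simp add: G QC)
  finally show ?thesis using that[of "G * P"] G PQ by auto
qed

text \<open>The condition under the description operator in \<open>mat_pinv\<close>, named so that
  existence and uniqueness can be stated for it.\<close>

definition is_mat_pinv :: "real mat \<Rightarrow> real mat \<Rightarrow> bool" where
  "is_mat_pinv M P \<longleftrightarrow> P \<in> carrier_mat (dim_col M) (dim_row M) \<and>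
     M * P * M = M \<and> P * M * P = P \<and>
     transpose_mat (M * P) = M * P \<and> transpose_mat (P * M) = P * M"

text \<open>\<open>M * P\<close> and \<open>M * Q\<close> are symmetric projections onto the same
  column space and therefore equal; likewise \<open>P * M\<close> and \<open>Q * M\<close>. Both
  equalities together turn \<open>P * M * P\<close> into \<open>Q * M * Q\<close>.\<close>

lemma is_mat_pinv_unique:
  assumes P: "is_mat_pinv M P" and Q: "is_mat_pinv M Q"
  shows "P = Q"
proof -
  have dims[simp]: "dim_row P = dim_col M" "dim_col P = dim_row M"
       "dim_row Q = dim_col M" "dim_col Q = dim_row M"
    using assms by (auto simp: is_mat_pinv_def)
  have p: "M * P * M = M" "P * M * P = P" "(M * P)\<^sup>T = M * P" "(P * M)\<^sup>T = P * M"
    and q: "M * Q * M = M" "Q * M * Q = Q" "(M * Q)\<^sup>T = M * Q" "(Q * M)\<^sup>T = Q * M"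
    using assms by (auto simp: is_mat_pinv_def)
  have "M * P = (M * Q * M) * P" by (simp only: q)
  also have "\<dots> = (M * Q) * (M * P)" by (simp add: assoc_mult_mat_dim)
  also have "\<dots> = (M * Q)\<^sup>T * (M * P)\<^sup>T" by (simp only: p q)
  also have "\<dots> = (M * P * M * Q)\<^sup>T" by (subst transpose_mult_dim[symmetric]) (simp_all add: assoc_mult_mat_dim)
  also have "\<dots> = M * Q" by (simp only: p q)
  finally have MP: "M * P = M * Q" .
  have "P * M = P * (M * Q * M)" by (simp only: q)
  also have "\<dots> = (P * M) * (Q * M)" by (simp add: assoc_mult_mat_dim)
  also have "\<dots> = (P * M)\<^sup>T * (Q * M)\<^sup>T" by (simp only: p q)
  also have "\<dots> = (Q * (M * P * M))\<^sup>T" by (subst transpose_mult_dim[symmetric]) (simp_all add: assoc_mult_mat_dim)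
  also have "\<dots> = Q * M" by (simp only: p q)
  finally have PM: "P * M = Q * M" .
  have "P = P * M * P" using p by simp
  also have "\<dots> = Q * (M * P)" by (simp add: PM assoc_mult_mat_dim)
  also have "\<dots> = Q * M * Q" by (simp add: MP assoc_mult_mat_dim)
  finally show ?thesis using q by simp
qed

text \<open>With \<open>W\<close> an inner inverse of \<open>M\<^sup>T M M\<^sup>T\<close>, the matrix \<open>M\<^sup>T W M\<^sup>T\<close> satisfies all Penrose
  equations except possibly the second, which a final sandwich enforces.\<close>

lemma is_mat_pinv_exists: "\<exists>P. is_mat_pinv M P"
proof -
  define a where "a = dim_row M"
  define b where "b = dim_col M"
  have M: "M \<in> carrier_mat a b" by (simp add: a_def b_def)
  define N where "N = M\<^sup>T * M * M\<^sup>T"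
  have N: "N \<in> carrier_mat b a" using M by (simp add: N_def)
  obtain W where W: "W \<in> carrier_mat a b" and NWN: "N * W * N = N"
    using inner_inverse_exists[OF N] .
  define P where "P = M\<^sup>T * W * M\<^sup>T"
  have P: "P \<in> carrier_mat b a" using M W by (simp add: P_def)
  \<comment> \<open>Cancelling \<open>M\<^sup>T\<close> on the left here, and once more after a
    transposition below, reduces \<open>N * W * N = N\<close> to
    \<open>M * P * M = M\<close>.\<close>
  have "M\<^sup>T * M * (M\<^sup>T * W * N) = M\<^sup>T * M * M\<^sup>T"
    using NWN M W N by (simp add: N_def assoc_mult_mat_dim)
  then have "M * (M\<^sup>T * W * N) = M * M\<^sup>T"
    using M W N by (intro gram_mult_cancel[of M a b _ a]) auto
  then have "M * P * (M * M\<^sup>T) = M * M\<^sup>T"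
    using M W by (simp add: N_def P_def assoc_mult_mat_dim)
  then have "(M * P * (M * M\<^sup>T))\<^sup>T = (M * M\<^sup>T)\<^sup>T" by simp
  then have "M\<^sup>T\<^sup>T * M\<^sup>T * (M * P)\<^sup>T = M\<^sup>T\<^sup>T * M\<^sup>T * 1\<^sub>m a"
    using M P by (simp add: transpose_mult_dim[of _ "M * M\<^sup>T"] transpose_mult_dim[of M "M\<^sup>T"])
  then have "M\<^sup>T * (M * P)\<^sup>T = M\<^sup>T * 1\<^sub>m a"
    using M P by (intro gram_mult_cancel[of "M\<^sup>T" b a _ a]) auto
  then have "(M\<^sup>T * (M * P)\<^sup>T)\<^sup>T = (M\<^sup>T)\<^sup>T" using M by simp
  then have MPM: "M * P * M = M" using M P by (simp add: transpose_mult_dim[of "M\<^sup>T"])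
  have MtMP: "M\<^sup>T * (M * P)\<^sup>T = M\<^sup>T"
    using MPM M P by (metis transpose_mult_dim carrier_matD index_mult_mat)
  have PMMt: "(P * M)\<^sup>T * M\<^sup>T = M\<^sup>T"
    using MPM M P by (metis assoc_mult_mat_dim transpose_mult_dim carrier_matD index_mult_mat)
  \<comment> \<open>No symmetry of \<open>W\<close> is available; \<open>M * P\<close> is symmetric
    because it equals its product with its own transpose. \<open>E2\<close> does the same for
    \<open>P * M\<close>.\<close>
  have E1: "M * P = M * P * (M * P)\<^sup>T"
  proof -
    have "M * P * (M * P)\<^sup>T = M * M\<^sup>T * W * (M\<^sup>T * (M * P)\<^sup>T)"
      using M W P by (simp add: P_def assoc_mult_mat_dim)
    then show ?thesis unfolding MtMP using M W by (simp add: P_def assoc_mult_mat_dim)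
  qed
  have E2: "P * M = (P * M)\<^sup>T * (P * M)"
  proof -
    have "(P * M)\<^sup>T * (P * M) = (P * M)\<^sup>T * M\<^sup>T * (W * M\<^sup>T * M)"
      using M W P by (simp add: P_def assoc_mult_mat_dim)
    then show ?thesis unfolding PMMt using M W by (simp add: P_def assoc_mult_mat_dim)
  qed
  have sym: "(X * X\<^sup>T)\<^sup>T = X * X\<^sup>T" for X :: "real mat"
    by (subst transpose_mult_dim) auto
  have S1: "(M * P)\<^sup>T = M * P"
    using sym[of "M * P"] by (simp only: E1[symmetric])
  have S2: "(P * M)\<^sup>T = P * M"
    using sym[of "(P * M)\<^sup>T"] by (simp only: transpose_transpose E2[symmetric])
  define R where "R = P * M * P"
  have MR: "M * R = M * P"
  proof -
    have "M * R = M * P * M * P" using M P by (simp add: R_def assoc_mult_mat_dim)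
    then show ?thesis by (simp add: MPM)
  qed
  have RM: "R * M = P * M"
  proof -
    have "R * M = P * (M * P * M)" using M P by (simp add: R_def assoc_mult_mat_dim)
    then show ?thesis by (simp add: MPM)
  qed
  have "R * M * R = R"
  proof -
    have "R * M * R = P * (M * P * M) * P" unfolding RM using M P by (simp add: R_def assoc_mult_mat_dim)
    then show ?thesis by (simp add: MPM R_def)
  qed
  moreover have "R \<in> carrier_mat (dim_col M) (dim_row M)" using M P by (auto simp: R_def)
  ultimately have "is_mat_pinv M R"
    using S1 S2 MPM unfolding is_mat_pinv_def by (simp only: MR RM simp_thms)
  then show ?thesis ..
qed

lemma is_mat_pinv_mat_pinv: "is_mat_pinv M (mat_pinv M)"
proof -
  have "\<exists>!P. is_mat_pinv M P"
    by (intro ex_ex1I is_mat_pinv_exists is_mat_pinv_unique)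
  then have "is_mat_pinv M (THE P. is_mat_pinv M P)" by (rule theI')
  moreover have "mat_pinv M = (THE P. is_mat_pinv M P)"
    by (simp only: mat_pinv_def is_mat_pinv_def)
  ultimately show ?thesis by simp
qed

lemma mat_pinv_eqI: "is_mat_pinv M P \<Longrightarrow> mat_pinv M = P"
  by (rule is_mat_pinv_unique[OF is_mat_pinv_mat_pinv])

lemma mat_pinv_dim [simp]: "dim_row (mat_pinv M) = dim_col M" "dim_col (mat_pinv M) = dim_row M"
  using is_mat_pinv_mat_pinv[of M] by (auto simp: is_mat_pinv_def)

lemma mat_pinv_carrier: "M \<in> carrier_mat a b \<Longrightarrow> mat_pinv M \<in> carrier_mat b a"
  by (intro carrier_matI) auto

lemma penrose:
  "M * mat_pinv M * M = M" "mat_pinv M * M * mat_pinv M = mat_pinv M"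
  "(M * mat_pinv M)\<^sup>T = M * mat_pinv M" "(mat_pinv M * M)\<^sup>T = mat_pinv M * M"
  using is_mat_pinv_mat_pinv[of M] unfolding is_mat_pinv_def by blast+

section \<open>Singular values\<close>

text \<open>Matrices are parametrised by functions on index pairs, whose product topology supplies
  continuity and compactness for the minimisation below.\<close>

lemma continuous_on_mat_inner_mult:
  assumes "N \<in> carrier_mat a b"
  shows "continuous_on UNIV (\<lambda>f. mat_inner (N * mat b K f) (N * mat b K f))"
proof -
  have "mat_inner (N * mat b K f) (N * mat b K f) =
     (\<Sum>i<a. \<Sum>j<K. (\<Sum>k<b. N $$ (i, k) * f (k, j))\<^sup>2)" for f
    using assms by (simp add: mat_inner_def index_mult_mat_sum power2_eq_square del: index_mult_mat(1))
  then show ?thesis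
    by (auto intro!: continuous_intros continuous_on_product_coordinates)
qed

lemma compact_PiE_UNIV:
  fixes T :: "'i \<Rightarrow> 'b::topological_space set"
  assumes "\<And>i. compact (T i)"
  shows "compact (PiE UNIV T)"
  using assms compactin_PiE[of "\<lambda>_. euclidean" UNIV T]
  by (simp add: euclidean_product_topology)

text \<open>A first-order condition: for small t of sign opposite to p the linear term wins, and t =
  -p/c with c > 0 and c > q is small enough.\<close>

lemma nonneg_quadratic_imp_zero:
  fixes p q :: real
  assumes "\<And>t. 0 \<le> 2 * t * p + t\<^sup>2 * q"
  shows "p = 0"
proof (rule ccontr)
  assume p: "p \<noteq> 0"
  define c where "c = \<bar>q\<bar> + 1"
  have c: "c > 0" "q < c" by (auto simp: c_def)
  have "0 \<le> 2 * (- p / c) * p + (- p / c)\<^sup>2 * q" by (rule assms)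
  also have "\<dots> = (p\<^sup>2 / c) * (q / c - 2)"
    using c by (simp add: field_simps power2_eq_square)
  finally have *: "0 \<le> (p\<^sup>2 / c) * (q / c - 2)" .
  have "0 < p\<^sup>2 / c" using p c by simp
  then have "0 \<le> q / c - 2" using * by (metis zero_le_mult_iff not_less)
  then show False using c by (simp add: field_simps)
qed

text \<open>The minimiser of the Rayleigh quotient on the row space of \<open>M\<close> is an eigenvector of the
  Gram matrix, so its value is the square of a nonzero singular value.\<close>

lemma gram_eigenvalue_lower_bound:
  assumes M: "M \<in> carrier_mat a b" and M0: "M \<noteq> 0\<^sub>m a b" and K: "0 < K"
  obtains l where "0 < l" "eigenvalue (M\<^sup>T * M) l"
    "\<And>X. X \<in> carrier_mat b K \<Longrightarrow> mat_pinv M * M * X = X \<Longrightarrow>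
       l * mat_inner X X \<le> mat_inner (M * X) (M * X)"
proof -
  define Q where "Q = mat_pinv M * M"
  have Q: "Q \<in> carrier_mat b b" using M by (auto simp: Q_def)
  have MQ: "M * Q = M" using M by (simp add: Q_def penrose flip: assoc_mult_mat_dim)
  have QT: "Q\<^sup>T = Q" by (simp add: Q_def penrose)
  have QQ: "Q * Q = Q"
  proof -
    have "Q * Q = mat_pinv M * M * mat_pinv M * M" using M by (simp add: Q_def assoc_mult_mat_dim)
    then show ?thesis by (simp add: penrose Q_def)
  qed
  have QMT: "Q * M\<^sup>T = M\<^sup>T"
    using transpose_mult_dim[of M Q] M Q by (simp add: MQ QT)
  \<comment> \<open>Vanishing of \<open>R * X\<close> expresses membership in the row space as a
    closed condition.\<close>
  define R where "R = Q - 1\<^sub>m b"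
  have R: "R \<in> carrier_mat b b" using Q by (auto simp: R_def)
  have QX: "Q * X = X \<longleftrightarrow> mat_inner (R * X) (R * X) = 0" if X: "X \<in> carrier_mat b K" for X
  proof -
    have "R * X = Q * X - X" using X Q by (simp add: R_def minus_mult_distrib_dim)
    then show ?thesis using X Q by (simp add: mat_inner_eq_0_iff minus_eq_zero_mat_iff)
  qed
  \<comment> \<open>Functions live on all index pairs; pinning the coordinates outside the
    \<open>b\<close> by \<open>K\<close> window to 0 keeps the set compact.\<close>
  define Box :: "(nat \<times> nat \<Rightarrow> real) set"
    where "Box = PiE UNIV (\<lambda>p. if fst p < b \<and> snd p < K then {-1..1} else {0})"
  define S where "S = Box \<inter> {f. mat_inner (1\<^sub>m b * mat b K f) (1\<^sub>m b * mat b K f) = 1} \<inter>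
      {f. mat_inner (R * mat b K f) (R * mat b K f) = 0}"
  have cB: "compact Box" unfolding Box_def by (intro compact_PiE_UNIV) auto
  have cl: "closed {f. mat_inner (N * mat b K f) (N * mat b K f) = c}"
    if "N \<in> carrier_mat b b" for N c
    by (intro closed_Collect_eq continuous_on_mat_inner_mult[OF that] continuous_on_const)
  have cS: "compact S"
    unfolding S_def using cB R by (intro compact_Int_closed cl) auto
  have S_I: "\<exists>f\<in>S. mat b K f = X"
    if X: "X \<in> carrier_mat b K" "Q * X = X" "mat_inner X X = 1" for X
  proof -
    define f where "f = (\<lambda>(i, j). if i < b \<and> j < K then X $$ (i, j) else 0)"
    have fX: "mat b K f = X" using X by (auto simp: f_def mat_eq_iff)
    have "\<bar>X $$ (i, j)\<bar> \<le> 1" if "i < b" "j < K" for i j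
    proof -
      have "(X $$ (i, j))\<^sup>2 \<le> (\<Sum>j<K. (X $$ (i, j))\<^sup>2)"
        using that by (intro member_le_sum[of j "{..<K}" "\<lambda>j. (X $$ (i, j))\<^sup>2"]) auto
      also have "\<dots> \<le> (\<Sum>i<b. \<Sum>j<K. (X $$ (i, j))\<^sup>2)"
        using that by (intro member_le_sum[of i "{..<b}" "\<lambda>i. \<Sum>j<K. (X $$ (i, j))\<^sup>2"])
          (auto intro: sum_nonneg)
      also have "\<dots> = 1" using X by (simp add: mat_inner_def power2_eq_square)
      finally show ?thesis by (simp add: abs_square_le_1)
    qed
    then have "f \<in> Box" by (auto simp: Box_def f_def abs_le_iff minus_le_iff)
    then have "f \<in> S" using X QX[OF X(1)] by (simp add: S_def fX)
    then show ?thesis using fX by blast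
  qed
  have unit: "\<exists>c. c \<noteq> 0 \<and> mat_inner (c \<cdot>\<^sub>m X) (c \<cdot>\<^sub>m X) = 1 \<and> Q * (c \<cdot>\<^sub>m X) = c \<cdot>\<^sub>m X"
    if X: "X \<in> carrier_mat b K" "Q * X = X" "mat_inner X X \<noteq> 0" for X
  proof (intro exI[of _ "1 / sqrt (mat_inner X X)"] conjI)
    have "mat_inner X X > 0" using X(3) mat_inner_nonneg[of X] by linarith
    then show "1 / sqrt (mat_inner X X) \<noteq> 0"
      "mat_inner ((1 / sqrt (mat_inner X X)) \<cdot>\<^sub>m X) ((1 / sqrt (mat_inner X X)) \<cdot>\<^sub>m X) = 1"
      by (simp_all add: mat_inner_smult_left mat_inner_smult_right)
    show "Q * ((1 / sqrt (mat_inner X X)) \<cdot>\<^sub>m X) = (1 / sqrt (mat_inner X X)) \<cdot>\<^sub>m X"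
      using mult_smult_distrib[OF Q X(1)] X(2) by simp
  qed
  have ne: "S \<noteq> {}"
  proof -
    \<comment> \<open>A nonzero column of \<open>Q\<close> lies in the row space of
      \<open>M\<close>. It is placed in column 0 of \<open>X\<close>, which exists because
      \<open>K\<close> is positive.\<close>
    have "Q \<noteq> 0\<^sub>m b b" using MQ M0 M by auto
    then obtain i j where ij: "i < b" "j < b" "Q $$ (i, j) \<noteq> 0"
      using Q by (auto simp: mat_eq_iff)
    define X where "X = Q * mat b K (\<lambda>(k, l). if k = j \<and> l = 0 then 1 else 0)"
    have X: "X \<in> carrier_mat b K" using Q by (simp add: X_def)
    have QX': "Q * X = X" using Q by (simp add: X_def QQ flip: assoc_mult_mat_dim)
    have "X $$ (i, 0) = (\<Sum>k<b. Q $$ (i, k) * (if k = j then 1 else 0))"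
      unfolding X_def using ij K Q by (subst index_mult_mat_sum) auto
    also have "\<dots> = (\<Sum>k<b. if k = j then Q $$ (i, k) else 0)"
      by (intro sum.cong) auto
    finally have "X $$ (i, 0) = (\<Sum>k<b. if k = j then Q $$ (i, k) else 0)" .
    then have "X $$ (i, 0) \<noteq> 0" using ij by simp
    then have "mat_inner X X \<noteq> 0" using X ij K by (auto simp: mat_inner_eq_0_iff mat_eq_iff)
    from unit[OF X QX' this] S_I[of "_ \<cdot>\<^sub>m X"] X show ?thesis by fastforce
  qed
  have "\<exists>f\<in>S. \<forall>g\<in>S. mat_inner (M * mat b K f) (M * mat b K f) \<le> mat_inner (M * mat b K g) (M * mat b K g)"
    by (intro continuous_attains_inf cS ne
        continuous_on_subset[OF continuous_on_mat_inner_mult[OF M]]) auto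
  then obtain f where f: "f \<in> S" and
    fmin: "\<And>g. g \<in> S \<Longrightarrow> mat_inner (M * mat b K f) (M * mat b K f) \<le> mat_inner (M * mat b K g) (M * mat b K g)"
    by blast
  define X0 where "X0 = mat b K f"
  define l where "l = mat_inner (M * X0) (M * X0)"
  have X0: "X0 \<in> carrier_mat b K" by (simp add: X0_def)
  have X01: "mat_inner X0 X0 = 1" using f by (simp add: S_def X0_def)
  have QX0: "Q * X0 = X0" using f QX[OF X0] by (simp add: S_def X0_def)
  have bound: "l * mat_inner X X \<le> mat_inner (M * X) (M * X)"
    if X: "X \<in> carrier_mat b K" "Q * X = X" for X
  proof (cases "mat_inner X X = 0")
    case False
    from unit[OF X False] obtain c where c: "c \<noteq> 0" "mat_inner (c \<cdot>\<^sub>m X) (c \<cdot>\<^sub>m X) = 1"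
      "Q * (c \<cdot>\<^sub>m X) = c \<cdot>\<^sub>m X" by blast
    from S_I[OF _ c(3,2)] X obtain g where "g \<in> S" "mat b K g = c \<cdot>\<^sub>m X" by auto
    with fmin have "l \<le> mat_inner (M * (c \<cdot>\<^sub>m X)) (M * (c \<cdot>\<^sub>m X))"
      unfolding l_def X0_def by metis
    also have "\<dots> = c\<^sup>2 * mat_inner (M * X) (M * X)"
      using M X by (simp add: mult_smult_distrib[OF M X(1)] mat_inner_smult_left
          mat_inner_smult_right power2_eq_square mult.assoc)
    finally have *: "l \<le> c\<^sup>2 * mat_inner (M * X) (M * X)" .
    have cX: "c\<^sup>2 * mat_inner X X = 1"
      using c(2) by (simp add: mat_inner_smult_left mat_inner_smult_right power2_eq_square)
    have "l * mat_inner X X \<le> c\<^sup>2 * mat_inner (M * X) (M * X) * mat_inner X X"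
      using * by (intro mult_right_mono mat_inner_nonneg)
    also have "\<dots> = mat_inner (M * X) (M * X) * (c\<^sup>2 * mat_inner X X)" by simp
    finally show ?thesis by (simp add: cX)
  qed (simp add: mat_inner_nonneg)
  \<comment> \<open>\<open>W\<close> is the defect in the eigenvalue equation. It lies in the row
    space, so it is an admissible direction of variation, and the first variation at
    \<open>X0\<close> along \<open>W\<close> is twice the squared norm of \<open>W\<close>.\<close>
  define W where "W = M\<^sup>T * M * X0 - l \<cdot>\<^sub>m X0"
  have W: "W \<in> carrier_mat b K" using M X0 by (auto simp: W_def)
  have QW: "Q * W = W"
  proof -
    have "Q * W = Q * (M\<^sup>T * M * X0) - l \<cdot>\<^sub>m (Q * X0)"
      unfolding W_def using M X0 Q
      by (simp add: mult_minus_distrib_dim mult_smult_distrib[OF Q X0])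
    moreover have "Q * (M\<^sup>T * M * X0) = Q * M\<^sup>T * M * X0"
      using M X0 Q by (simp add: assoc_mult_mat_dim)
    ultimately show ?thesis by (simp add: QMT QX0 W_def)
  qed
  have WW: "mat_inner W W = mat_inner (M * X0) (M * W) - l * mat_inner X0 W"
  proof -
    have "mat_inner W W = mat_inner (M\<^sup>T * M * X0) W - l * mat_inner X0 W"
      using M X0 by (subst (1) W_def) (simp add: mat_inner_minus_left mat_inner_smult_left)
    moreover have "mat_inner (M\<^sup>T * M * X0) W = mat_inner (M * X0) (M * W)"
      using M X0 W mat_inner_adjoint[of "M\<^sup>T" b a "M * X0" K W] by (simp add: assoc_mult_mat_dim)
    ultimately show ?thesis by simp
  qed
  have "mat_inner W W = 0"
  proof (rule nonneg_quadratic_imp_zero)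
    fix t :: real
    let ?X = "X0 + t \<cdot>\<^sub>m W"
    have "?X \<in> carrier_mat b K" using X0 W by auto
    moreover have "Q * ?X = ?X"
      using X0 W Q QX0 QW by (simp add: mult_add_distrib_dim mult_smult_distrib[OF Q W])
    ultimately have "l * mat_inner ?X ?X \<le> mat_inner (M * ?X) (M * ?X)" by (rule bound)
    moreover have "mat_inner ?X ?X = 1 + 2 * t * mat_inner X0 W + t\<^sup>2 * mat_inner W W"
      using X0 W X01 by (subst mat_inner_add_self[of _ b K])
        (auto simp: mat_inner_smult_left mat_inner_smult_right power2_eq_square)
    moreover have "mat_inner (M * ?X) (M * ?X) =
       l + 2 * t * mat_inner (M * X0) (M * W) + t\<^sup>2 * mat_inner (M * W) (M * W)"
    proof -
      have "M * ?X = M * X0 + t \<cdot>\<^sub>m (M * W)"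
        using X0 W M by (simp add: mult_add_distrib_dim mult_smult_distrib[OF M W])
      then show ?thesis
        using M X0 W by (simp, subst mat_inner_add_self[of _ a K])
          (auto simp: mat_inner_smult_left mat_inner_smult_right power2_eq_square l_def)
    qed
    ultimately show "0 \<le> 2 * t * mat_inner W W + t\<^sup>2 * (mat_inner (M * W) (M * W) - l * mat_inner W W)"
      unfolding WW by (simp add: algebra_simps)
  qed
  then have eq: "M\<^sup>T * M * X0 = l \<cdot>\<^sub>m X0"
    using M X0 W unfolding mat_inner_eq_0_iff W_def
    by (subst (asm) minus_eq_zero_mat_iff[of _ b K, symmetric]) (auto simp: minus_eq_zero_mat_iff)
  \<comment> \<open>The constraint \<open>Q * X0 = X0\<close> excludes the kernel of
    \<open>M\<close>: from \<open>M * X0 = 0\<close> it would follow that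
    \<open>X0 = Q * X0 = 0\<close>.\<close>
  have "l \<noteq> 0"
  proof
    assume "l = 0"
    then have "M * X0 = 0\<^sub>m a K" using M X0 by (simp add: l_def mat_inner_eq_0_iff)
    then have "Q * X0 = 0\<^sub>m b K" using M X0 by (simp add: Q_def assoc_mult_mat_dim)
    then show False using QX0 X01 by (simp add: mat_inner_def)
  qed
  then have l: "0 < l" using mat_inner_nonneg[of "M * X0"] by (simp add: l_def)
  have "X0 \<noteq> 0\<^sub>m b K" using X01 by (auto simp: mat_inner_def)
  then obtain i j where ij: "i < b" "j < K" "X0 $$ (i, j) \<noteq> 0"
    using X0 by (auto simp: mat_eq_iff)
  have "eigenvector (M\<^sup>T * M) (col X0 j) l"
    unfolding eigenvector_def
  proof (intro conjI)
    show "col X0 j \<noteq> 0\<^sub>v (dim_row (M\<^sup>T * M))"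
      using ij X0 M by (auto simp: vec_eq_iff)
    show "M\<^sup>T * M *\<^sub>v col X0 j = l \<cdot>\<^sub>v col X0 j"
      using ij X0 M eq by (subst col_mult2[symmetric, of _ b b _ K]) auto
  qed (use X0 M in auto)
  then have "eigenvalue (M\<^sup>T * M) l" by (auto simp: eigenvalue_def)
  then show ?thesis using that l bound by (simp add: Q_def)
qed

text \<open>With the eigenvector written as a one-column matrix \<open>V\<close>, \<open>l\<close>
  times the squared norm of \<open>V\<close> is the squared norm of \<open>M * V\<close>.\<close>

lemma gram_eigenvalue_nonneg:
  assumes "eigenvalue (M\<^sup>T * M) (l::real)"
  shows "0 \<le> l"
proof -
  define b where "b = dim_col M"
  define a where "a = dim_row M"
  have M: "M \<in> carrier_mat a b" by (simp add: a_def b_def)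
  obtain v where v: "v \<in> carrier_vec b" "v \<noteq> 0\<^sub>v b" "M\<^sup>T * M *\<^sub>v v = l \<cdot>\<^sub>v v"
    using assms M by (auto simp: eigenvalue_def eigenvector_def)
  define V where "V = mat_of_cols b [v]"
  have V: "V \<in> carrier_mat b 1" by (intro carrier_matI) (simp_all add: V_def)
  have colV: "col V 0 = v" using v by (simp add: V_def)
  have "M\<^sup>T * M * V = l \<cdot>\<^sub>m V"
  proof (rule mat_col_eqI)
    fix i assume "i < dim_col (l \<cdot>\<^sub>m V)"
    then have "i = 0" using V by simp
    then show "col (M\<^sup>T * M * V) i = col (l \<cdot>\<^sub>m V) i"
      using M V v colV by (subst col_mult2[of _ b b _ 1]) auto
  qed (use M V in auto)
  then have "l * mat_inner V V = mat_inner (M\<^sup>T * M * V) V"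
    by (simp only: mat_inner_smult_left)
  also have "M\<^sup>T * M * V = M\<^sup>T * (M * V)" using M V by (simp add: assoc_mult_mat_dim)
  also have "mat_inner (M\<^sup>T * (M * V)) V = mat_inner (M * V) (M * V)"
    using M V mat_inner_adjoint[of "M\<^sup>T" b a "M * V" 1 V] by simp
  finally have "0 \<le> l * mat_inner V V" by (simp add: mat_inner_nonneg)
  moreover have "mat_inner V V \<noteq> 0"
  proof
    assume "mat_inner V V = 0"
    then have "V = 0\<^sub>m b 1" using V by (simp add: mat_inner_eq_0_iff)
    then have "col V 0 = 0\<^sub>v b" by (simp add: col_zero)
    then show False using colV v by simp
  qed
  ultimately show ?thesis
    using mat_inner_nonneg[of V] by (simp add: zero_le_mult_iff)
qed

lemma finite_singular_values: "finite (singular_values M)"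
proof -
  have "singular_values M = sqrt ` spectrum (M\<^sup>T * M)"
    by (auto simp: singular_values_def spectrum_def)
  moreover have "finite (spectrum (M\<^sup>T * M))"
    by (rule card_finite_spectrum(1)[of _ "dim_col M"]) (intro carrier_matI, simp_all)
  ultimately show ?thesis by simp
qed

lemma singular_values_nonneg: "s \<in> singular_values M \<Longrightarrow> 0 \<le> s"
  unfolding singular_values_def using gram_eigenvalue_nonneg[of M] by (elim CollectE exE conjE) simp

lemma nonzero_singular_value_exists:
  assumes "M \<in> carrier_mat a b" "M \<noteq> 0\<^sub>m a b"
  shows "{s \<in> singular_values M. s \<noteq> 0} \<noteq> {}"
proof -
  obtain l where "0 < l" "eigenvalue (M\<^sup>T * M) l"
    using gram_eigenvalue_lower_bound[OF assms, of 1] by auto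
  then have "sqrt l \<in> {s \<in> singular_values M. s \<noteq> 0}"
    by (auto simp: singular_values_def)
  then show ?thesis by blast
qed

lemma
  assumes "M \<in> carrier_mat a b" "M \<noteq> 0\<^sub>m a b"
  shows sigma_min_pos_gt_0: "0 < sigma_min_pos M"
    and sigma_min_pos_le_sigma_max: "sigma_min_pos M \<le> sigma_max M"
proof -
  have "sigma_min_pos M \<in> {s \<in> singular_values M. s \<noteq> 0}"
    unfolding sigma_min_pos_def
    using nonzero_singular_value_exists[OF assms] finite_singular_values
    by (intro Min_in) auto
  then show "0 < sigma_min_pos M" "sigma_min_pos M \<le> sigma_max M"
    using singular_values_nonneg[of "sigma_min_pos M" M] finite_singular_values[of M]
    by (auto simp: sigma_max_def)
qed

text \<open>The premise with \<open>mat_pinv\<close> puts \<open>X\<close> into the row space, away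
  from the kernel, where no positive bound can hold. There the eigenvalue \<open>l\<close> of the
  minimisation is a bound, and \<open>sqrt l\<close> is one of the nonzero singular values.\<close>

lemma sigma_min_pos_le:
  assumes M: "M \<in> carrier_mat a b" "M \<noteq> 0\<^sub>m a b"
    and X: "X \<in> carrier_mat b K" "0 < K" "mat_pinv M * M * X = X"
  shows "(sigma_min_pos M)\<^sup>2 * mat_inner X X \<le> mat_inner (M * X) (M * X)"
proof -
  obtain l where l: "0 < l" "eigenvalue (M\<^sup>T * M) l"
     "l * mat_inner X X \<le> mat_inner (M * X) (M * X)"
    using gram_eigenvalue_lower_bound[OF M X(2)] X by metis
  have "sigma_min_pos M \<le> sqrt l"
    unfolding sigma_min_pos_def using l finite_singular_values[of M]
    by (intro Min_le) (auto simp: singular_values_def)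
  then have "(sigma_min_pos M)\<^sup>2 \<le> (sqrt l)\<^sup>2"
    using sigma_min_pos_gt_0[OF M] by (intro power_mono) auto
  then have "(sigma_min_pos M)\<^sup>2 \<le> l" using l by simp
  then have "(sigma_min_pos M)\<^sup>2 * mat_inner X X \<le> l * mat_inner X X"
    by (intro mult_right_mono mat_inner_nonneg)
  then show ?thesis using l(3) by simp
qed

section \<open>Tensors and block circulant matrices\<close>

lemma tensor_carrier_dims:
  assumes "A \<in> tensor_carrier a b n" "0 < n"
  shows "dim1 A = a" "dim2 A = b" "dim3 A = n"
proof -
  have "hd A \<in> set A" using assms by (intro hd_in_set) (auto simp: tensor_carrier_def)
  then show "dim1 A = a" "dim2 A = b" "dim3 A = n"
    using assms by (auto simp: tensor_carrier_def dim1_def dim2_def dim3_def)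
qed

lemma tensor_carrier_nth:
  "A \<in> tensor_carrier a b n \<Longrightarrow> k < n \<Longrightarrow> A ! k \<in> carrier_mat a b"
  by (auto simp: tensor_carrier_def)

lemma tensor_carrier_length: "A \<in> tensor_carrier a b n \<Longrightarrow> length A = n"
  by (simp add: tensor_carrier_def)

lemma tensor_carrierI:
  "length A = n \<Longrightarrow> (\<And>k. k < n \<Longrightarrow> A ! k \<in> carrier_mat a b) \<Longrightarrow> A \<in> tensor_carrier a b n"
  by (auto simp: tensor_carrier_def in_set_conv_nth)

lemma tensor_eqI:
  assumes "A \<in> tensor_carrier a b n" "B \<in> tensor_carrier a b n"
    and "\<And>k i j. k < n \<Longrightarrow> i < a \<Longrightarrow> j < b \<Longrightarrow> A ! k $$ (i, j) = B ! k $$ (i, j)"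
  shows "A = B"
proof (rule nth_equalityI)
  fix k assume "k < length A"
  then have k: "k < n" using assms by (simp add: tensor_carrier_length)
  then show "A ! k = B ! k"
    using assms(3)[OF k] tensor_carrier_nth[OF assms(1) k] tensor_carrier_nth[OF assms(2) k]
    by (auto simp: mat_eq_iff)
qed (use assms in \<open>simp add: tensor_carrier_length\<close>)

lemma tzero_carrier: "tzero a b n \<in> tensor_carrier a b n"
  by (auto simp: tzero_def tensor_carrier_def)

lemma tzero_index: "k < n \<Longrightarrow> i < a \<Longrightarrow> j < b \<Longrightarrow> tzero a b n ! k $$ (i, j) = 0"
  by (simp add: tzero_def)

lemma tadd_carrier:
  "A \<in> tensor_carrier a b n \<Longrightarrow> B \<in> tensor_carrier a b n \<Longrightarrow> A +\<^sub>t B \<in> tensor_carrier a b n"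
  by (intro tensor_carrierI) (auto simp: tadd_def tensor_carrier_length intro!: add_carrier_mat tensor_carrier_nth)

lemma tminus_carrier:
  "A \<in> tensor_carrier a b n \<Longrightarrow> B \<in> tensor_carrier a b n \<Longrightarrow> A -\<^sub>t B \<in> tensor_carrier a b n"
  by (intro tensor_carrierI) (auto simp: tminus_def tensor_carrier_length intro!: minus_carrier_mat tensor_carrier_nth)

lemma tadd_index:
  assumes "A \<in> tensor_carrier a b n" "B \<in> tensor_carrier a b n" "k < n" "i < a" "j < b"
  shows "(A +\<^sub>t B) ! k $$ (i, j) = A ! k $$ (i, j) + B ! k $$ (i, j)"
  using assms tensor_carrier_nth[OF assms(2,3)] by (simp add: tadd_def tensor_carrier_length)

lemma tminus_index:
  assumes "A \<in> tensor_carrier a b n" "B \<in> tensor_carrier a b n" "k < n" "i < a" "j < b"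
  shows "(A -\<^sub>t B) ! k $$ (i, j) = A ! k $$ (i, j) - B ! k $$ (i, j)"
  using assms tensor_carrier_nth[OF assms(2,3)] by (simp add: tminus_def tensor_carrier_length)

lemma fold_tensor_carrier: "fold_tensor a b n M \<in> tensor_carrier a b n"
  by (intro tensor_carrierI) (auto simp: fold_tensor_def)

lemma fold_tensor_index:
  "k < n \<Longrightarrow> i < a \<Longrightarrow> j < b \<Longrightarrow> fold_tensor a b n M ! k $$ (i, j) = M $$ (k * a + i, j)"
  by (simp add: fold_tensor_def)

lemma block_index_less: "k < n \<Longrightarrow> i < a \<Longrightarrow> k * a + i < a * (n::nat)"
proof -
  assume "k < n" "i < a"
  then have "k * a + i < (k + 1) * a" by simp
  also have "\<dots> \<le> n * a" using \<open>k < n\<close> by (intro mult_le_mono1) simp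
  finally show ?thesis by (simp add: mult.commute)
qed

lemma div_block_less: "(r::nat) < a * n \<Longrightarrow> r div a < n"
  by (simp add: less_mult_imp_div_less mult.commute)

lemma mod_block_less: "(r::nat) < a * n \<Longrightarrow> r mod a < a"
  by (intro mod_less_divisor) (auto intro: ccontr)

lemma sum_block: "(\<Sum>r<a * n. f r) = (\<Sum>k<n. \<Sum>i<a. f (k * a + i :: nat))"
proof -
  have "(\<Sum>r<a * n. f r) = (\<Sum>k<n. sum f {k * a..<k * a + a})"
    by (simp add: sum.nat_group mult.commute)
  also have "\<dots> = (\<Sum>k<n. \<Sum>i<a. f (k * a + i))"
  proof (rule sum.cong)
    fix k
    show "sum f {k * a..<k * a + a} = (\<Sum>i<a. f (k * a + i))"
      using sum.shift_bounds_nat_ivl[of f 0 "k * a" a]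
      by (simp add: lessThan_atLeast0 add.commute)
  qed simp
  finally show ?thesis .
qed

section \<open>Unfolding as a linear isometry\<close>

lemma unfold_carrier:
  "A \<in> tensor_carrier a b n \<Longrightarrow> 0 < n \<Longrightarrow> unfold A \<in> carrier_mat (a * n) b"
  by (simp add: unfold_def tensor_carrier_dims)

lemma unfold_index:
  assumes "A \<in> tensor_carrier a b n" "k < n" "i < a" "j < b"
  shows "unfold A $$ (k * a + i, j) = A ! k $$ (i, j)"
  using assms block_index_less[of k n i a] by (simp add: unfold_def tensor_carrier_dims)

lemma mat_block_eqI:
  assumes "M \<in> carrier_mat (a * n) b" "N \<in> carrier_mat (a * n) b"
    and "\<And>k i j. k < n \<Longrightarrow> i < a \<Longrightarrow> j < b \<Longrightarrow> M $$ (k * a + i, j) = N $$ (k * a + i, j)"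
  shows "M = N"
proof (rule eq_matI)
  fix r j assume "r < dim_row N" "j < dim_col N"
  then have r: "r < a * n" "j < b" using assms by auto
  show "M $$ (r, j) = N $$ (r, j)"
    using assms(3)[OF div_block_less[OF r(1)] mod_block_less[OF r(1)] r(2)] by simp
qed (use assms in auto)

lemma unfold_fold_tensor:
  assumes "M \<in> carrier_mat (a * n) b" "0 < n"
  shows "unfold (fold_tensor a b n M) = M"
  using assms by (intro mat_block_eqI[of _ a n b] unfold_carrier fold_tensor_carrier)
    (simp_all add: unfold_index[OF fold_tensor_carrier] fold_tensor_index)

lemma unfold_inj:
  assumes "A \<in> tensor_carrier a b n" "B \<in> tensor_carrier a b n" "unfold A = unfold B"
  shows "A = B"
  using assms by (intro tensor_eqI[OF assms(1,2)]) (metis unfold_index)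

lemma unfold_tadd:
  assumes "A \<in> tensor_carrier a b n" "B \<in> tensor_carrier a b n" "0 < n"
  shows "unfold (A +\<^sub>t B) = unfold A + unfold B"
  using assms unfold_carrier[OF assms(1)] unfold_carrier[OF assms(2)]
  by (intro mat_block_eqI[of _ a n b] unfold_carrier tadd_carrier add_carrier_mat)
    (simp_all add: unfold_index[OF tadd_carrier] unfold_index tadd_index block_index_less)

lemma unfold_tminus:
  assumes "A \<in> tensor_carrier a b n" "B \<in> tensor_carrier a b n" "0 < n"
  shows "unfold (A -\<^sub>t B) = unfold A - unfold B"
  using assms unfold_carrier[OF assms(1)] unfold_carrier[OF assms(2)]
  by (intro mat_block_eqI[of _ a n b] unfold_carrier tminus_carrier minus_carrier_mat)
    (simp_all add: unfold_index[OF tminus_carrier] unfold_index tminus_index block_index_less)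

lemma unfold_tzero:
  assumes "0 < n"
  shows "unfold (tzero a b n) = 0\<^sub>m (a * n) b"
  using assms
  by (intro mat_block_eqI[of _ a n b] unfold_carrier tzero_carrier)
    (simp_all add: unfold_index[OF tzero_carrier] block_index_less tzero_index)

lemma tinner_unfold:
  assumes "A \<in> tensor_carrier a b n" "B \<in> tensor_carrier a b n" "0 < n"
  shows "tinner A B = mat_inner (unfold A) (unfold B)"
  using assms unfold_carrier[OF assms(1)]
  by (simp add: tinner_def tensor_carrier_dims mat_inner_def sum_block unfold_index)

lemma tnorm_sq_tinner: "(tnorm A)\<^sup>2 = tinner A A"
  by (simp add: tnorm_def tinner_def sum_nonneg power2_eq_square)

lemma tnorm_sq_unfold:
  assumes "A \<in> tensor_carrier a b n" "0 < n"
  shows "(tnorm A)\<^sup>2 = mat_inner (unfold A) (unfold A)"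
  using tinner_unfold[OF assms(1,1,2)] by (simp add: tnorm_sq_tinner)

lemma tnorm_nonneg: "0 \<le> tnorm A"
  by (simp add: tnorm_def sum_nonneg)

lemma tnorm_eq_0_iff:
  assumes "A \<in> tensor_carrier a b n" "0 < n"
  shows "(tnorm A)\<^sup>2 = 0 \<longleftrightarrow> A = tzero a b n"
proof -
  have "(tnorm A)\<^sup>2 = 0 \<longleftrightarrow> unfold A = unfold (tzero a b n)"
    unfolding tnorm_sq_unfold[OF assms] mat_inner_eq_0_iff
    using assms unfold_carrier[OF assms] by (simp add: unfold_tzero)
  then show ?thesis using unfold_inj[OF assms(1) tzero_carrier] by auto
qed

lemma bcirc_carrier:
  "A \<in> tensor_carrier a b n \<Longrightarrow> 0 < n \<Longrightarrow> bcirc A \<in> carrier_mat (a * n) (b * n)"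
  by (simp add: bcirc_def tensor_carrier_dims)

lemma bcirc_index:
  assumes "A \<in> tensor_carrier a b n" "p < n" "i < a" "q < n" "j < b"
  shows "bcirc A $$ (p * a + i, q * b + j) = A ! ((p + n - q) mod n) $$ (i, j)"
  using assms block_index_less[of p n i a] block_index_less[of q n j b]
  by (simp add: bcirc_def tensor_carrier_dims)

lemma mat_block2_eqI:
  assumes "M \<in> carrier_mat (a * n) (b * n)" "N \<in> carrier_mat (a * n) (b * n)"
    and "\<And>p i q j. p < n \<Longrightarrow> i < a \<Longrightarrow> q < n \<Longrightarrow> j < b \<Longrightarrow>
      M $$ (p * a + i, q * b + j) = N $$ (p * a + i, q * b + j)"
  shows "M = N"
proof (rule mat_block_eqI[OF assms(1,2)])
  fix k i r assume kir: "k < n" "i < a" "r < b * n"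
  show "M $$ (k * a + i, r) = N $$ (k * a + i, r)"
    using assms(3)[OF kir(1,2) div_block_less[OF kir(3)] mod_block_less[OF kir(3)]] by simp
qed

section \<open>Block circulant matrices as shift-invariant matrices\<close>

definition block_shift :: "nat \<Rightarrow> nat \<Rightarrow> nat \<Rightarrow> nat" where
  "block_shift a n r = Suc (r div a) mod n * a + r mod a"

lemma block_shift_block: "i < a \<Longrightarrow> block_shift a n (p * a + i) = Suc p mod n * a + i"
  by (simp add: block_shift_def)

lemma block_shift_less: "r < a * n \<Longrightarrow> block_shift a n r < a * n"
  unfolding block_shift_def
  by (intro block_index_less mod_block_less mod_less_divisor) (auto intro: ccontr)

lemma bij_betw_block_shift: "bij_betw (block_shift a n) {..<a * n} {..<a * n}"
proof -
  have "inj_on (block_shift a n) {..<a * n}"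
  proof (rule inj_onI)
    fix r s assume "r \<in> {..<a * n}" "s \<in> {..<a * n}" and eq: "block_shift a n r = block_shift a n s"
    then have rs: "r < a * n" "s < a * n" by auto
    have a: "0 < a" using rs by (auto intro: ccontr)
    have m: "r mod a = s mod a"
      using arg_cong[OF eq, of "\<lambda>x. x mod a"] by (simp add: block_shift_def)
    have "Suc (r div a) mod n = Suc (s div a) mod n"
      using arg_cong[OF eq, of "\<lambda>x. x div a"] a by (simp add: block_shift_def)
    then have "r div a = s div a"
      using div_block_less[OF rs(1)] div_block_less[OF rs(2)]
      by (auto simp: mod_Suc split: if_splits)
    then show "r = s" using m by (metis div_mult_mod_eq)
  qed
  moreover have "block_shift a n ` {..<a * n} \<subseteq> {..<a * n}"
    by (auto intro: block_shift_less)
  ultimately show ?thesis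
    by (simp add: bij_betw_def endo_inj_surj)
qed

text \<open>Multiplication from both sides by the permutation matrices of the cyclic block shift,
  written as a reindexing.\<close>

definition shift_blocks :: "nat \<Rightarrow> nat \<Rightarrow> nat \<Rightarrow> 'a mat \<Rightarrow> 'a mat" where
  "shift_blocks a b n M = mat (a * n) (b * n) (\<lambda>(i, j). M $$ (block_shift a n i, block_shift b n j))"

lemma shift_blocks_carrier: "shift_blocks a b n M \<in> carrier_mat (a * n) (b * n)"
  by (simp add: shift_blocks_def)

lemma shift_blocks_mult:
  fixes M N :: "'a::semiring_0 mat"
  assumes "M \<in> carrier_mat (a * n) (b * n)" "N \<in> carrier_mat (b * n) (c * n)"
  shows "shift_blocks a c n (M * N) = shift_blocks a b n M * shift_blocks b c n N"
proof (rule eq_matI)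
  fix i j assume "i < dim_row (shift_blocks a b n M * shift_blocks b c n N)"
    "j < dim_col (shift_blocks a b n M * shift_blocks b c n N)"
  then have ij: "i < a * n" "j < c * n" by (auto simp: shift_blocks_def)
  have "shift_blocks a c n (M * N) $$ (i, j) =
      (\<Sum>k<b * n. M $$ (block_shift a n i, k) * N $$ (k, block_shift c n j))"
    using ij assms block_shift_less[OF ij(1)] block_shift_less[OF ij(2)]
    by (simp add: shift_blocks_def index_mult_mat_sum del: index_mult_mat(1))
  also have "\<dots> = (\<Sum>k<b * n. M $$ (block_shift a n i, block_shift b n k) * N $$ (block_shift b n k, block_shift c n j))"
    by (rule sum.reindex_bij_betw[OF bij_betw_block_shift, symmetric])
  also have "\<dots> = (shift_blocks a b n M * shift_blocks b c n N) $$ (i, j)"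
    using ij by (subst index_mult_mat_sum) (auto simp: shift_blocks_def)
  finally show "shift_blocks a c n (M * N) $$ (i, j) = (shift_blocks a b n M * shift_blocks b c n N) $$ (i, j)" .
qed (auto simp: shift_blocks_def)

lemma shift_blocks_transpose:
  assumes "M \<in> carrier_mat (a * n) (b * n)"
  shows "shift_blocks b a n (M\<^sup>T) = (shift_blocks a b n M)\<^sup>T"
  using assms by (intro eq_matI) (auto simp: shift_blocks_def block_shift_less)

text \<open>Invariance under the simultaneous shift of block rows and block columns means that a
  block depends only on p - q modulo n. In this form the property passes easily to products and
  pseudoinverses.\<close>

definition block_circulant :: "nat \<Rightarrow> nat \<Rightarrow> nat \<Rightarrow> 'a mat \<Rightarrow> bool" where
  "block_circulant a b n M \<longleftrightarrow> M \<in> carrier_mat (a * n) (b * n) \<and> shift_blocks a b n M = M"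

lemma block_circulant_one: "block_circulant a a n (1\<^sub>m (a * n))"
proof -
  have "block_shift a n i = block_shift a n j \<longleftrightarrow> i = j" if "i < a * n" "j < a * n" for i j
    using bij_betw_block_shift[of a n] that by (auto simp: bij_betw_def inj_on_def)
  then show ?thesis
    by (auto simp: block_circulant_def shift_blocks_def block_shift_less intro!: eq_matI)
qed

lemma block_circulant_mult:
  fixes M N :: "'a::semiring_0 mat"
  shows "block_circulant a b n M \<Longrightarrow> block_circulant b c n N \<Longrightarrow> block_circulant a c n (M * N)"
  by (auto simp: block_circulant_def shift_blocks_mult)

text \<open>Shifting the blocks cyclically preserves the Penrose equations, which have only one solution.\<close>

lemma block_circulant_mat_pinv:
  assumes "block_circulant a b n M"
  shows "block_circulant b a n (mat_pinv M)"
proof -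
  define P where "P = mat_pinv M"
  define S where "S = shift_blocks b a n P"
  have M: "M \<in> carrier_mat (a * n) (b * n)" and sM: "shift_blocks a b n M = M"
    using assms by (auto simp: block_circulant_def)
  have P: "P \<in> carrier_mat (b * n) (a * n)" using mat_pinv_carrier[OF M] by (simp add: P_def)
  have MP: "M * P \<in> carrier_mat (a * n) (a * n)" and PM: "P * M \<in> carrier_mat (b * n) (b * n)"
    using M P by auto
  have MS: "M * S = shift_blocks a a n (M * P)"
    using shift_blocks_mult[OF M P] by (simp add: S_def sM)
  have SM: "S * M = shift_blocks b b n (P * M)"
    using shift_blocks_mult[OF P M] by (simp add: S_def sM)
  have "M * S * M = M"
    using shift_blocks_mult[OF MP M] by (simp add: MS sM P_def penrose)
  moreover have "S * M * S = S"
    using shift_blocks_mult[OF PM P] by (simp add: SM S_def[symmetric]) (simp add: P_def penrose S_def)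
  moreover have "(M * S)\<^sup>T = M * S"
    using shift_blocks_transpose[OF MP] by (simp add: MS P_def penrose)
  moreover have "(S * M)\<^sup>T = S * M"
    using shift_blocks_transpose[OF PM] by (simp add: SM P_def penrose)
  moreover have "S \<in> carrier_mat (dim_col M) (dim_row M)"
    using M by (simp add: S_def shift_blocks_carrier)
  ultimately have "is_mat_pinv M S" unfolding is_mat_pinv_def by blast
  then have "P = S" unfolding P_def by (rule mat_pinv_eqI)
  then show ?thesis using P by (simp add: block_circulant_def S_def P_def)
qed

text \<open>Moving back along the block diagonal, one shift per induction step, ends in block column
  0.\<close>

lemma block_circulant_index:
  assumes M: "block_circulant a b n M" and "p < n" "i < a" "q < n" "j < b"
  shows "M $$ (p * a + i, q * b + j) = M $$ ((p + n - q) mod n * a + i, j)"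
  using assms(2,4)
proof (induction q arbitrary: p)
  case (Suc q)
  \<comment> \<open>The predecessor of \<open>p\<close> modulo \<open>n\<close>.\<close>
  define p' where "p' = (if p = 0 then n - 1 else p - 1)"
  have p': "p' < n" "Suc p' mod n = p" using Suc.prems by (auto simp: p'_def)
  have q: "Suc q mod n = Suc q" "q < n" using Suc.prems by auto
  have "M $$ (p' * a + i, q * b + j) = M $$ (p * a + i, Suc q * b + j)"
  proof -
    have "M $$ (p' * a + i, q * b + j) = shift_blocks a b n M $$ (p' * a + i, q * b + j)"
      using M by (simp add: block_circulant_def)
    also have "\<dots> = M $$ (p * a + i, Suc q * b + j)"
      unfolding shift_blocks_def using assms p' q
      by (simp add: block_index_less block_shift_block del: mult_Suc)
    finally show ?thesis .
  qed
  moreover have "(p' + n - q) mod n = (p + n - Suc q) mod n"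
    using Suc.prems by (auto simp: p'_def mod_if)
  ultimately show ?case using Suc.IH[OF p'(1) q(2)] by simp
qed simp

text \<open>\<open>fold_tensor\<close> reads only the first block column of \<open>M\<close>, and
  this column determines a block circulant matrix.\<close>

lemma bcirc_fold_tensor:
  assumes M: "block_circulant a b n M" and "0 < n"
  shows "bcirc (fold_tensor a b n M) = M"
proof (rule mat_block2_eqI[of _ a n b])
  fix p i q j assume *: "p < n" "i < a" "q < n" "j < b"
  then show "bcirc (fold_tensor a b n M) $$ (p * a + i, q * b + j) = M $$ (p * a + i, q * b + j)"
    unfolding bcirc_index[OF fold_tensor_carrier *] block_circulant_index[OF M *]
    by (intro fold_tensor_index) auto
qed (use assms in \<open>auto simp: block_circulant_def intro!: bcirc_carrier fold_tensor_carrier\<close>)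

lemma fold_tensor_bcirc:
  assumes A: "A \<in> tensor_carrier a b n"
  shows "fold_tensor a b n (bcirc A) = A"
proof (rule tensor_eqI[OF fold_tensor_carrier A])
  fix k i j assume *: "k < n" "i < a" "j < b"
  then show "fold_tensor a b n (bcirc A) ! k $$ (i, j) = A ! k $$ (i, j)"
    using bcirc_index[OF A, of k i 0 j] by (simp add: fold_tensor_index)
qed

lemma bcirc_inj:
  "A \<in> tensor_carrier a b n \<Longrightarrow> B \<in> tensor_carrier a b n \<Longrightarrow> bcirc A = bcirc B \<Longrightarrow> A = B"
  by (metis fold_tensor_bcirc)

lemma block_circulant_bcirc:
  assumes A: "A \<in> tensor_carrier a b n" "0 < n"
  shows "block_circulant a b n (bcirc A)"
  unfolding block_circulant_def
proof (intro conjI mat_block2_eqI[of _ a n b] shift_blocks_carrier bcirc_carrier assms)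
  fix p i q j assume *: "p < n" "i < a" "q < n" "j < b"
  have "(Suc p mod n + n - Suc q mod n) mod n = (p + n - q) mod n"
    using * by (auto simp: mod_Suc mod_if)
  then show "shift_blocks a b n (bcirc A) $$ (p * a + i, q * b + j) = bcirc A $$ (p * a + i, q * b + j)"
    unfolding bcirc_index[OF A(1) *] using * assms
    by (simp add: shift_blocks_def block_index_less block_shift_block bcirc_index[OF A(1)])
qed

section \<open>t-product, transpose and pseudoinverse through \<open>bcirc\<close>\<close>

lemma tprod_carrier:
  "A \<in> tensor_carrier a b n \<Longrightarrow> B \<in> tensor_carrier b c n \<Longrightarrow> 0 < n \<Longrightarrow>
    A *\<^sub>t B \<in> tensor_carrier a c n"
  by (simp add: tprod_def tensor_carrier_dims fold_tensor_carrier)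

lemma unfold_tprod:
  assumes "A \<in> tensor_carrier a b n" "B \<in> tensor_carrier b c n" "0 < n"
  shows "unfold (A *\<^sub>t B) = bcirc A * unfold B"
  using assms bcirc_carrier[OF assms(1,3)] unfold_carrier[OF assms(2,3)]
  by (simp add: tprod_def tensor_carrier_dims unfold_fold_tensor)

lemma tprod_eqI:
  assumes "A \<in> tensor_carrier a b n" "B \<in> tensor_carrier b c n" "0 < n"
    and "C \<in> tensor_carrier a c n" "unfold C = bcirc A * unfold B"
  shows "A *\<^sub>t B = C"
  using assms by (intro unfold_inj[OF tprod_carrier]) (auto simp: unfold_tprod)

lemma unfold_eq_bcirc:
  assumes "B \<in> tensor_carrier b c n" "r < b * n" "j < c"
  shows "unfold B $$ (r, j) = bcirc B $$ (r, j)"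
proof -
  have r: "r div b < n" "r mod b < b" using assms by (auto intro: div_block_less mod_block_less)
  then show ?thesis
    using bcirc_index[OF assms(1) r, of 0 j] unfold_index[OF assms(1) r assms(3)] assms(3) by simp
qed

text \<open>Both sides are block circulant, so the first block columns decide; there
  \<open>bcirc B\<close> coincides with \<open>unfold B\<close>.\<close>

lemma bcirc_tprod:
  assumes A: "A \<in> tensor_carrier a b n" and B: "B \<in> tensor_carrier b c n" and n: "0 < n"
  shows "bcirc (A *\<^sub>t B) = bcirc A * bcirc B"
proof -
  have "A *\<^sub>t B = fold_tensor a c n (bcirc A * bcirc B)"
  proof (rule tensor_eqI[OF tprod_carrier[OF A B n] fold_tensor_carrier])
    fix k i j assume *: "k < n" "i < a" "j < c"
    then have c: "j < c * n" "k * a + i < a * n" using n by (auto simp: block_index_less less_le_trans)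
    have "(A *\<^sub>t B) ! k $$ (i, j) = (bcirc A * unfold B) $$ (k * a + i, j)"
      using * by (simp add: tprod_def tensor_carrier_dims[OF A n] tensor_carrier_dims[OF B n] fold_tensor_index)
    also have "\<dots> = (bcirc A * bcirc B) $$ (k * a + i, j)"
      using * c bcirc_carrier[OF A n] unfold_carrier[OF B n] bcirc_carrier[OF B n]
      by (simp add: index_mult_mat_sum unfold_eq_bcirc[OF B] del: index_mult_mat(1))
    also have "\<dots> = fold_tensor a c n (bcirc A * bcirc B) ! k $$ (i, j)"
      using * by (simp add: fold_tensor_index)
    finally show "(A *\<^sub>t B) ! k $$ (i, j) = fold_tensor a c n (bcirc A * bcirc B) ! k $$ (i, j)" .
  qed
  then show ?thesis
    using bcirc_fold_tensor[OF block_circulant_mult[OF block_circulant_bcirc[OF A n] block_circulant_bcirc[OF B n]] n]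
    by simp
qed

lemma tprod_index:
  assumes A: "A \<in> tensor_carrier a b n" and B: "B \<in> tensor_carrier b c n"
    and *: "k < n" "i < a" "j < c"
  shows "(A *\<^sub>t B) ! k $$ (i, j) =
    (\<Sum>q<n. \<Sum>l<b. A ! ((k + n - q) mod n) $$ (i, l) * B ! q $$ (l, j))"
proof -
  have n: "0 < n" using * by simp
  have "(A *\<^sub>t B) ! k $$ (i, j) = (bcirc A * unfold B) $$ (k * a + i, j)"
    using * by (simp add: tprod_def tensor_carrier_dims[OF A n] tensor_carrier_dims[OF B n] fold_tensor_index)
  also have "\<dots> = (\<Sum>r<b * n. bcirc A $$ (k * a + i, r) * unfold B $$ (r, j))"
    using * bcirc_carrier[OF A n] unfold_carrier[OF B n]
    by (simp add: index_mult_mat_sum block_index_less del: index_mult_mat(1))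
  also have "\<dots> = (\<Sum>q<n. \<Sum>l<b. A ! ((k + n - q) mod n) $$ (i, l) * B ! q $$ (l, j))"
    using * by (simp add: sum_block bcirc_index[OF A] unfold_index[OF B])
  finally show ?thesis .
qed

lemma tprod_assoc:
  assumes "A \<in> tensor_carrier a b n" "B \<in> tensor_carrier b c n" "C \<in> tensor_carrier c d n" "0 < n"
  shows "A *\<^sub>t B *\<^sub>t C = A *\<^sub>t (B *\<^sub>t C)"
  using assms bcirc_carrier[OF assms(1,4)] bcirc_carrier[OF assms(2,4)] unfold_carrier[OF assms(3,4)]
  by (intro tprod_eqI[of _ a c n _ d] tprod_carrier[of _ a b] tprod_carrier[of _ b c])
    (simp_all add: unfold_tprod[of _ a b n _ d] unfold_tprod[of _ b c n _ d] bcirc_tprod[of _ a b n _ c] tprod_carrier[of _ b c n _ d] assoc_mult_mat_dim)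

lemma tprod_minus_right:
  assumes "A \<in> tensor_carrier a b n" "B \<in> tensor_carrier b c n" "C \<in> tensor_carrier b c n" "0 < n"
  shows "A *\<^sub>t (B -\<^sub>t C) = A *\<^sub>t B -\<^sub>t A *\<^sub>t C"
  using assms bcirc_carrier[OF assms(1,4)] unfold_carrier[OF assms(2,4)] unfold_carrier[OF assms(3,4)]
    tprod_carrier[OF assms(1,2,4)] tprod_carrier[OF assms(1,3,4)]
  by (intro tprod_eqI[of _ a b n _ c] tminus_carrier)
    (simp_all add: unfold_tminus[of _ a c n] unfold_tminus[of _ b c n] unfold_tprod[of _ a b n _ c]
       mult_minus_distrib_dim)

lemma ttranspose_carrier:
  "A \<in> tensor_carrier a b n \<Longrightarrow> ttranspose A \<in> tensor_carrier b a n"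
  by (intro tensor_carrierI) (auto simp: ttranspose_def dim3_def tensor_carrier_length intro!: tensor_carrier_nth)

lemma ttranspose_index:
  assumes "A \<in> tensor_carrier a b n" "k < n" "i < b" "j < a"
  shows "ttranspose A ! k $$ (i, j) = A ! ((n - k) mod n) $$ (j, i)"
  using assms tensor_carrier_nth[OF assms(1), of "(n - k) mod n"]
  by (simp add: ttranspose_def dim3_def tensor_carrier_length)

lemma bcirc_ttranspose:
  assumes A: "A \<in> tensor_carrier a b n" and n: "0 < n"
  shows "bcirc (ttranspose A) = (bcirc A)\<^sup>T"
proof (rule mat_block2_eqI[of _ b n a])
  fix p i q j assume *: "p < n" "i < b" "q < n" "j < a"
  have "(n - (p + n - q) mod n) mod n = (q + n - p) mod n"
    using * by (cases "p \<ge> q") (auto simp: mod_if)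
  then show "bcirc (ttranspose A) $$ (p * b + i, q * a + j) = (bcirc A)\<^sup>T $$ (p * b + i, q * a + j)"
    using * bcirc_index[OF ttranspose_carrier[OF A] *] bcirc_index[OF A *(3,4,1,2)]
      bcirc_carrier[OF A n]
    by (simp add: ttranspose_index[OF A] block_index_less)
qed (use bcirc_carrier[OF A n] bcirc_carrier[OF ttranspose_carrier[OF A] n] in auto)

text \<open>The pseudoinverse of a block circulant matrix is block circulant, hence the
  \<open>bcirc\<close> of its own folding; injectivity of \<open>bcirc\<close> makes that tensor the
  described one.\<close>

lemma
  assumes A: "A \<in> tensor_carrier a b n" and n: "0 < n"
  shows tpinv_carrier: "tpinv A \<in> tensor_carrier b a n"
    and bcirc_tpinv: "bcirc (tpinv A) = mat_pinv (bcirc A)"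
proof -
  let ?T = "fold_tensor b a n (mat_pinv (bcirc A))"
  have T: "?T \<in> tensor_carrier b a n" "bcirc ?T = mat_pinv (bcirc A)"
    using block_circulant_mat_pinv[OF block_circulant_bcirc[OF A n]] n
    by (auto simp: bcirc_fold_tensor fold_tensor_carrier)
  have "tpinv A = ?T"
    unfolding tpinv_def tensor_carrier_dims[OF A n]
    using T by (intro the_equality) (auto intro: bcirc_inj)
  then show "tpinv A \<in> tensor_carrier b a n" "bcirc (tpinv A) = mat_pinv (bcirc A)"
    using T by auto
qed

section \<open>Slices\<close>

lemma dim_block_pick:
  "J \<subseteq> {..<a} \<Longrightarrow> {i. i < a \<and> i \<in> J} = (J :: nat set)"
  by auto

lemma hslices_carrier:
  assumes "A \<in> tensor_carrier a b n" "J \<subseteq> {..<a}"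
  shows "hslices A J \<in> tensor_carrier (card J) b n"
proof (rule tensor_carrierI)
  fix k assume k: "k < n"
  show "hslices A J ! k \<in> carrier_mat (card J) b"
    using k carrier_matD[OF tensor_carrier_nth[OF assms(1) k]] tensor_carrier_length[OF assms(1)]
    by (intro carrier_matI) (simp_all add: hslices_def dim_submatrix dim_block_pick[OF assms(2)])
qed (use tensor_carrier_length[OF assms(1)] in \<open>simp add: hslices_def\<close>)

lemma hslices_index:
  assumes "A \<in> tensor_carrier a b n" "J \<subseteq> {..<a}" "k < n" "i < card J" "j < b"
  shows "hslices A J ! k $$ (i, j) = A ! k $$ (pick J i, j)"
  using assms(3-) carrier_matD[OF tensor_carrier_nth[OF assms(1,3)]] tensor_carrier_length[OF assms(1)]
  by (simp add: hslices_def submatrix_index dim_block_pick[OF assms(2)] pick_UNIV)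

lemma lslices_carrier:
  assumes "A \<in> tensor_carrier a b n" "U \<subseteq> {..<b}"
  shows "lslices A U \<in> tensor_carrier a (card U) n"
proof (rule tensor_carrierI)
  fix k assume k: "k < n"
  show "lslices A U ! k \<in> carrier_mat a (card U)"
    using k carrier_matD[OF tensor_carrier_nth[OF assms(1) k]] tensor_carrier_length[OF assms(1)]
    by (intro carrier_matI) (simp_all add: lslices_def dim_submatrix dim_block_pick[OF assms(2)])
qed (use tensor_carrier_length[OF assms(1)] in \<open>simp add: lslices_def\<close>)

lemma lslices_index:
  assumes "A \<in> tensor_carrier a b n" "U \<subseteq> {..<b}" "k < n" "i < a" "j < card U"
  shows "lslices A U ! k $$ (i, j) = A ! k $$ (i, pick U j)"
  using assms(3-) carrier_matD[OF tensor_carrier_nth[OF assms(1,3)]] tensor_carrier_length[OF assms(1)]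
  by (simp add: lslices_def submatrix_index dim_block_pick[OF assms(2)] pick_UNIV)

lemma pick_less:
  assumes "J \<subseteq> {..<a}" "i < card J"
  shows "pick J i < a"
  using assms pick_in_set[of i J] by auto

lemma bij_betw_pick:
  assumes "finite J"
  shows "bij_betw (pick J) {..<card J} J"
proof (rule bij_betw_imageI)
  show "inj_on (pick J) {..<card J}"
    using pick_mono_le[of _ J] by (metis (mono_tags, lifting) inj_onI lessThan_iff linorder_neqE_nat less_irrefl)
  then have "card (pick J ` {..<card J}) = card J" by (simp add: card_image)
  moreover have "pick J ` {..<card J} \<subseteq> J" using pick_in_set by auto
  ultimately show "pick J ` {..<card J} = J" using assms by (simp add: card_subset_eq)
qed

lemma hslices_tprod:
  assumes A: "A \<in> tensor_carrier a b n" and B: "B \<in> tensor_carrier b c n" and J: "J \<subseteq> {..<a}" and n: "0 < n"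
  shows "hslices (A *\<^sub>t B) J = hslices A J *\<^sub>t B"
proof (rule tensor_eqI)
  note C = tprod_carrier[OF A B n]
  show "hslices (A *\<^sub>t B) J \<in> tensor_carrier (card J) c n"
    "hslices A J *\<^sub>t B \<in> tensor_carrier (card J) c n"
    using hslices_carrier[OF C J] tprod_carrier[OF hslices_carrier[OF A J] B n] by auto
  fix k i j assume *: "k < n" "i < card J" "j < c"
  show "hslices (A *\<^sub>t B) J ! k $$ (i, j) = (hslices A J *\<^sub>t B) ! k $$ (i, j)"
    using * pick_less[OF J *(2)]
    by (simp add: hslices_index[OF C J] tprod_index[OF A B] tprod_index[OF hslices_carrier[OF A J] B]
        hslices_index[OF A J])
qed

lemma lslices_tprod:
  assumes A: "A \<in> tensor_carrier a b n" and B: "B \<in> tensor_carrier b c n" and U: "U \<subseteq> {..<c}" and n: "0 < n"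
  shows "lslices (A *\<^sub>t B) U = A *\<^sub>t lslices B U"
proof (rule tensor_eqI)
  note C = tprod_carrier[OF A B n]
  show "lslices (A *\<^sub>t B) U \<in> tensor_carrier a (card U) n"
    "A *\<^sub>t lslices B U \<in> tensor_carrier a (card U) n"
    using lslices_carrier[OF C U] tprod_carrier[OF A lslices_carrier[OF B U] n] by auto
  fix k i j assume *: "k < n" "i < a" "j < card U"
  show "lslices (A *\<^sub>t B) U ! k $$ (i, j) = (A *\<^sub>t lslices B U) ! k $$ (i, j)"
    using * pick_less[OF U *(3)]
    by (simp add: lslices_index[OF C U] tprod_index[OF A B] tprod_index[OF A lslices_carrier[OF B U]]
        lslices_index[OF B U])
qed

lemma ttranspose_lslices:
  assumes A: "A \<in> tensor_carrier a b n" and U: "U \<subseteq> {..<b}"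
  shows "ttranspose (lslices A U) = hslices (ttranspose A) U"
proof (rule tensor_eqI)
  show "ttranspose (lslices A U) \<in> tensor_carrier (card U) a n"
    "hslices (ttranspose A) U \<in> tensor_carrier (card U) a n"
    using ttranspose_carrier[OF lslices_carrier[OF A U]] hslices_carrier[OF ttranspose_carrier[OF A] U] by auto
  fix k i j assume *: "k < n" "i < card U" "j < a"
  then show "ttranspose (lslices A U) ! k $$ (i, j) = hslices (ttranspose A) U ! k $$ (i, j)"
    using pick_less[OF U *(2)]
    by (simp add: ttranspose_index[OF lslices_carrier[OF A U]] hslices_index[OF ttranspose_carrier[OF A] U]
        ttranspose_index[OF A] lslices_index[OF A U])
qed

lemma hslices_tminus:
  assumes A: "A \<in> tensor_carrier a b n" and B: "B \<in> tensor_carrier a b n" and J: "J \<subseteq> {..<a}"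
  shows "hslices (A -\<^sub>t B) J = hslices A J -\<^sub>t hslices B J"
proof (rule tensor_eqI)
  note C = tminus_carrier[OF A B]
  show "hslices (A -\<^sub>t B) J \<in> tensor_carrier (card J) b n"
    "hslices A J -\<^sub>t hslices B J \<in> tensor_carrier (card J) b n"
    using hslices_carrier[OF C J] tminus_carrier[OF hslices_carrier[OF A J] hslices_carrier[OF B J]] by auto
  fix k i j assume *: "k < n" "i < card J" "j < b"
  then show "hslices (A -\<^sub>t B) J ! k $$ (i, j) = (hslices A J -\<^sub>t hslices B J) ! k $$ (i, j)"
    using pick_less[OF J *(2)]
    by (simp add: hslices_index[OF C J] tminus_index[OF A B] hslices_index[OF A J] hslices_index[OF B J]
        tminus_index[OF hslices_carrier[OF A J] hslices_carrier[OF B J]])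
qed

text \<open>The unit of the t-product. Its slices are selection tensors: slicing \<open>A\<close>
  amounts to multiplying it by a slice of \<open>tone\<close>.\<close>

definition tone :: "nat \<Rightarrow> nat \<Rightarrow> tensor" where
  "tone a n = fold_tensor a a n (1\<^sub>m (a * n))"

lemma tone_carrier: "tone a n \<in> tensor_carrier a a n"
  by (simp add: tone_def fold_tensor_carrier)

lemma bcirc_tone: "0 < n \<Longrightarrow> bcirc (tone a n) = 1\<^sub>m (a * n)"
  by (simp add: tone_def bcirc_fold_tensor block_circulant_one)

lemma tone_left: 
  assumes "A \<in> tensor_carrier a b n" "0 < n"
  shows "tone a n *\<^sub>t A = A"
  using assms unfold_carrier[OF assms] by (intro tprod_eqI[OF tone_carrier]) (simp_all add: bcirc_tone)

lemma tone_right: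
  assumes A: "A \<in> tensor_carrier a b n" and n: "0 < n"
  shows "A *\<^sub>t tone b n = A"
  using bcirc_carrier[OF A n]
  by (intro bcirc_inj[OF tprod_carrier[OF A tone_carrier n] A])
    (simp add: bcirc_tprod[OF A tone_carrier n] bcirc_tone[OF n])

section \<open>Norms of slices and of block circulant matrices\<close>

definition row_sq :: "tensor \<Rightarrow> nat \<Rightarrow> real" where
  "row_sq A i = (\<Sum>k<dim3 A. \<Sum>j<dim2 A. (A ! k $$ (i, j))\<^sup>2)"

lemma row_sq_nonneg: "0 \<le> row_sq A i"
  by (simp add: row_sq_def sum_nonneg)

lemma tnorm_sq_row_sq:
  assumes "A \<in> tensor_carrier a b n" "0 < n"
  shows "(tnorm A)\<^sup>2 = (\<Sum>i<a. row_sq A i)"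
  unfolding tnorm_def row_sq_def tensor_carrier_dims[OF assms]
  by (subst sum.swap) (simp add: sum_nonneg)

lemma tnorm_sq_hslices:
  assumes A: "A \<in> tensor_carrier a b n" and n: "0 < n" and J: "J \<subseteq> {..<a}"
  shows "(tnorm (hslices A J))\<^sup>2 = (\<Sum>i\<in>J. row_sq A i)"
proof -
  have "(tnorm (hslices A J))\<^sup>2 = (\<Sum>i<card J. row_sq (hslices A J) i)"
    by (rule tnorm_sq_row_sq[OF hslices_carrier[OF A J] n])
  also have "\<dots> = (\<Sum>i<card J. row_sq A (pick J i))"
    by (intro sum.cong refl)
      (simp add: row_sq_def tensor_carrier_dims[OF A n] tensor_carrier_dims[OF hslices_carrier[OF A J] n]
        hslices_index[OF A J])
  also have "\<dots> = (\<Sum>i\<in>J. row_sq A i)"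
    using J by (intro sum.reindex_bij_betw bij_betw_pick) (rule finite_subset, auto)
  finally show ?thesis .
qed

lemma tnorm_sq_hslices_sum:
  assumes "A \<in> tensor_carrier a b n" "0 < n" "J \<subseteq> {..<a}"
  shows "(tnorm (hslices A J))\<^sup>2 = (\<Sum>i\<in>J. (tnorm (hslices A {i}))\<^sup>2)"
  unfolding tnorm_sq_hslices[OF assms]
  using assms(3) by (intro sum.cong refl) (subst tnorm_sq_hslices[OF assms(1,2)], auto)

lemma tnorm_sq_sum_hslices:
  assumes "A \<in> tensor_carrier a b n" "0 < n"
  shows "(tnorm A)\<^sup>2 = (\<Sum>i<a. (tnorm (hslices A {i}))\<^sup>2)"
  using tnorm_sq_hslices_sum[OF assms order.refl] tnorm_sq_hslices[OF assms order.refl]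
    tnorm_sq_row_sq[OF assms] by simp

lemma tnorm_hslices_le:
  assumes "A \<in> tensor_carrier a b n" "0 < n" "J \<subseteq> {..<a}"
  shows "(tnorm (hslices A J))\<^sup>2 \<le> (tnorm A)\<^sup>2"
  unfolding tnorm_sq_hslices[OF assms] tnorm_sq_row_sq[OF assms(1,2)]
  using assms(3) by (intro sum_mono2) (auto simp: row_sq_nonneg)

lemma bij_betw_mod_diff:
  assumes "q < n"
  shows "bij_betw (\<lambda>p. (p + n - q) mod n) {..<n} {..<n::nat}"
proof -
  have "inj_on (\<lambda>p. (p + n - q) mod n) {..<n}"
    using assms by (auto simp: inj_on_def mod_if split: if_splits)
  moreover have "(\<lambda>p. (p + n - q) mod n) ` {..<n} \<subseteq> {..<n}"
    using assms by auto
  ultimately show ?thesis by (simp add: bij_betw_def endo_inj_surj)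
qed

text \<open>Every frontal slice occurs exactly once in each of the \<open>n\<close> block
  columns.\<close>

lemma mat_inner_bcirc:
  assumes A: "A \<in> tensor_carrier a b n" and n: "0 < n"
  shows "mat_inner (bcirc A) (bcirc A) = n * (tnorm A)\<^sup>2"
proof -
  let ?f = "\<lambda>r. \<Sum>i<a. \<Sum>j<b. (A ! r $$ (i, j))\<^sup>2"
  have "mat_inner (bcirc A) (bcirc A) =
      (\<Sum>p<n. \<Sum>i<a. \<Sum>q<n. \<Sum>j<b. (A ! ((p + n - q) mod n) $$ (i, j))\<^sup>2)"
    using bcirc_carrier[OF A n]
    by (simp add: mat_inner_def sum_block bcirc_index[OF A] power2_eq_square)
  also have "\<dots> = (\<Sum>p<n. \<Sum>q<n. ?f ((p + n - q) mod n))"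
    by (intro sum.cong refl sum.swap)
  also have "\<dots> = (\<Sum>q<n. \<Sum>p<n. ?f ((p + n - q) mod n))"
    by (rule sum.swap)
  also have "\<dots> = (\<Sum>q<n. \<Sum>r<n. ?f r)"
    by (intro sum.cong refl sum.reindex_bij_betw bij_betw_mod_diff) auto
  also have "\<dots> = n * (tnorm A)\<^sup>2"
    by (simp add: tnorm_def tensor_carrier_dims[OF A n] sum_nonneg)
  finally show ?thesis .
qed

lemma tnorm_sq_ttranspose:
  assumes A: "A \<in> tensor_carrier a b n" and n: "0 < n"
  shows "(tnorm (ttranspose A))\<^sup>2 = (tnorm A)\<^sup>2"
proof -
  have "n * (tnorm (ttranspose A))\<^sup>2 = n * (tnorm A)\<^sup>2"
    unfolding mat_inner_bcirc[OF A n, symmetric] mat_inner_bcirc[OF ttranspose_carrier[OF A] n, symmetric]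
      bcirc_ttranspose[OF A n]
    by (rule mat_inner_transpose)
  then show ?thesis using n by simp
qed

section \<open>Orthogonal projections and least squares\<close>

text \<open>\<open>Y\<close> is kept independent of \<open>X\<close> for the X-update, which
  exchanges the row-space component of the error for a new one and leaves the rest alone.\<close>

lemma projection_pythagoras:
  assumes Q: "Q \<in> carrier_mat b b" "Q\<^sup>T = Q" "Q * Q = Q"
    and X: "X \<in> carrier_mat b c" and Y: "Y \<in> carrier_mat b c"
  shows "mat_inner (X - Q * X + Q * Y) (X - Q * X + Q * Y) =
    mat_inner (X - Q * X) (X - Q * X) + mat_inner (Q * Y) (Q * Y)"
proof -
  have QX: "Q * X \<in> carrier_mat b c" "X - Q * X \<in> carrier_mat b c" "Q * Y \<in> carrier_mat b c"
    using Q X Y by auto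
  have "Q * (X - Q * X) = Q * X - Q * Q * X"
    using Q(1) X by (simp add: mult_minus_distrib_dim assoc_mult_mat_dim)
  also have "\<dots> = 0\<^sub>m b c" using QX by (simp add: Q)
  finally have "mat_inner (Q * Y) (X - Q * X) = 0"
    using mat_inner_adjoint[OF Q(1) Y QX(2)] Y by (simp add: Q mat_inner_zero_right)
  then have "mat_inner (X - Q * X) (Q * Y) = 0"
    using QX X Y mat_inner_commute[of "X - Q * X" "Q * Y"] by simp
  then show ?thesis using mat_inner_add_self[OF QX(2,3)] by simp
qed

lemma projection_norm:
  assumes Q: "Q \<in> carrier_mat b b" "Q\<^sup>T = Q" "Q * Q = Q" and X: "X \<in> carrier_mat b c"
  shows "mat_inner X X = mat_inner (X - Q * X) (X - Q * X) + mat_inner (Q * X) (Q * X)"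
proof -
  have "X - Q * X + Q * X = X" using Q(1) X by (intro eq_matI) auto
  then show ?thesis using projection_pythagoras[OF Q X X] by simp
qed

lemma row_projection:
  assumes M: "M \<in> carrier_mat a b"
  shows "mat_pinv M * M \<in> carrier_mat b b" "(mat_pinv M * M)\<^sup>T = mat_pinv M * M"
    "mat_pinv M * M * (mat_pinv M * M) = mat_pinv M * M" "mat_pinv M * M * M\<^sup>T = M\<^sup>T"
proof -
  show "mat_pinv M * M \<in> carrier_mat b b" using M by auto
  show "(mat_pinv M * M)\<^sup>T = mat_pinv M * M" by (rule penrose)
  have "mat_pinv M * M * (mat_pinv M * M) = mat_pinv M * M * mat_pinv M * M"
    by (simp add: assoc_mult_mat_dim)
  then show "mat_pinv M * M * (mat_pinv M * M) = mat_pinv M * M" by (simp only: penrose)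
  have "mat_pinv M * M * M\<^sup>T = (mat_pinv M * M)\<^sup>T * M\<^sup>T" by (simp only: penrose)
  also have "\<dots> = (M * mat_pinv M * M)\<^sup>T"
    by (simp add: transpose_mult_dim[of M "mat_pinv M * M"] assoc_mult_mat_dim)
  finally show "mat_pinv M * M * M\<^sup>T = M\<^sup>T" by (simp only: penrose)
qed

lemma column_projection:
  assumes M: "M \<in> carrier_mat a b"
  shows "M * mat_pinv M \<in> carrier_mat a a" "(M * mat_pinv M)\<^sup>T = M * mat_pinv M"
    "M * mat_pinv M * (M * mat_pinv M) = M * mat_pinv M" "M\<^sup>T * (M * mat_pinv M) = M\<^sup>T"
proof -
  show "M * mat_pinv M \<in> carrier_mat a a" using M by auto
  show "(M * mat_pinv M)\<^sup>T = M * mat_pinv M" by (rule penrose)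
  have "M * mat_pinv M * (M * mat_pinv M) = M * mat_pinv M * M * mat_pinv M"
    by (simp add: assoc_mult_mat_dim)
  then show "M * mat_pinv M * (M * mat_pinv M) = M * mat_pinv M" by (simp only: penrose)
  have "M\<^sup>T * (M * mat_pinv M) = M\<^sup>T * (M * mat_pinv M)\<^sup>T" by (simp only: penrose)
  also have "\<dots> = (M * mat_pinv M * M)\<^sup>T"
    by (subst transpose_mult_dim[symmetric]) simp_all
  finally show "M\<^sup>T * (M * mat_pinv M) = M\<^sup>T" by (simp only: penrose)
qed

text \<open>\<open>mat_pinv M * W\<close> lies in the row space, where \<open>M\<close> stretches by
  at least \<open>sigma_min_pos M\<close>, and the projection \<open>M * mat_pinv M\<close> does not
  increase norms. This is the origin of \<gamma>.\<close>

lemma pinv_mult_norm_le: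
  assumes M: "M \<in> carrier_mat a b" "M \<noteq> 0\<^sub>m a b" and W: "W \<in> carrier_mat a K" and K: "0 < K"
  shows "mat_inner (mat_pinv M * W) (mat_pinv M * W) \<le> mat_inner W W / (sigma_min_pos M)\<^sup>2"
proof -
  have P: "mat_pinv M \<in> carrier_mat b a" by (rule mat_pinv_carrier[OF M(1)])
  have "mat_pinv M * M * (mat_pinv M * W) = mat_pinv M * M * mat_pinv M * W"
    using M W by (simp add: assoc_mult_mat_dim)
  then have "(sigma_min_pos M)\<^sup>2 * mat_inner (mat_pinv M * W) (mat_pinv M * W)
      \<le> mat_inner (M * (mat_pinv M * W)) (M * (mat_pinv M * W))"
    using P W K by (intro sigma_min_pos_le[OF M]) (auto simp only: penrose mult_carrier_mat)
  also have "M * (mat_pinv M * W) = M * mat_pinv M * W"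
    using M W by (simp add: assoc_mult_mat_dim)
  also have "mat_inner (M * mat_pinv M * W) (M * mat_pinv M * W) \<le> mat_inner W W"
    using projection_norm[OF column_projection(1,2,3)[OF M(1)] W] mat_inner_nonneg[of "W - M * mat_pinv M * W"]
    by simp
  finally show ?thesis using sigma_min_pos_gt_0[OF M] by (simp add: field_simps)
qed

text \<open>Writing \<open>D = M x\<close> with \<open>x\<close> in the row space transfers the lower bound from \<open>M\<close> to its transpose.\<close>

lemma sigma_min_pos_le_transpose:
  assumes M: "M \<in> carrier_mat a b" "M \<noteq> 0\<^sub>m a b" and K: "0 < K"
    and D: "D \<in> carrier_mat a K" "M * mat_pinv M * D = D"
  shows "(sigma_min_pos M)\<^sup>2 * mat_inner D D \<le> mat_inner (M\<^sup>T * D) (M\<^sup>T * D)"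
proof (cases "mat_inner D D = 0")
  case False
  then have pos: "0 < mat_inner D D" using mat_inner_nonneg[of D] by linarith
  define x where "x = mat_pinv M * D"
  have x: "x \<in> carrier_mat b K" using mat_pinv_carrier[OF M(1)] D by (auto simp: x_def)
  have Mx: "M * x = D" using D M by (simp add: x_def assoc_mult_mat_dim)
  have "mat_inner D D = mat_inner x (M\<^sup>T * D)"
    using mat_inner_adjoint[OF M(1) x D(1)] by (simp add: Mx)
  then have "(mat_inner D D)\<^sup>2 \<le> mat_inner x x * mat_inner (M\<^sup>T * D) (M\<^sup>T * D)"
    using mat_inner_Cauchy_Schwarz[of x b K "M\<^sup>T * D"] x M D by simp
  also have "\<dots> \<le> mat_inner D D / (sigma_min_pos M)\<^sup>2 * mat_inner (M\<^sup>T * D) (M\<^sup>T * D)"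
    using pinv_mult_norm_le[OF M D(1) K]
    by (intro mult_right_mono mat_inner_nonneg) (simp add: x_def)
  finally have "mat_inner D D * ((sigma_min_pos M)\<^sup>2 * mat_inner D D) \<le> mat_inner D D * mat_inner (M\<^sup>T * D) (M\<^sup>T * D)"
    using sigma_min_pos_gt_0[OF M] by (simp add: field_simps power2_eq_square)
  then show ?thesis using pos by simp
qed (simp add: mat_inner_nonneg)

lemma bcirc_neq_zero:
  assumes A: "A \<in> tensor_carrier a b n" and n: "0 < n" and ne: "A \<noteq> tzero a b n"
  shows "bcirc A \<noteq> 0\<^sub>m (a * n) (b * n)"
proof
  assume "bcirc A = 0\<^sub>m (a * n) (b * n)"
  then have "n * (tnorm A)\<^sup>2 = 0" using mat_inner_bcirc[OF A n] by (simp add: mat_inner_def)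
  then show False using tnorm_eq_0_iff[OF A n] n ne by simp
qed

lemma unfold_tpinv_proj:
  assumes A: "A \<in> tensor_carrier a b n" and n: "0 < n" and E: "E \<in> tensor_carrier b K n"
  shows "unfold (tpinv A *\<^sub>t A *\<^sub>t E) = mat_pinv (bcirc A) * bcirc A * unfold E"
  using unfold_tprod[OF tprod_carrier[OF tpinv_carrier[OF A n] A n] E n]
  by (simp add: bcirc_tprod[OF tpinv_carrier[OF A n] A n] bcirc_tpinv[OF A n])

lemma unfold_proj_tpinv:
  assumes A: "A \<in> tensor_carrier a b n" and n: "0 < n" and E: "E \<in> tensor_carrier a K n"
  shows "unfold (A *\<^sub>t tpinv A *\<^sub>t E) = bcirc A * mat_pinv (bcirc A) * unfold E"
  using unfold_tprod[OF tprod_carrier[OF A tpinv_carrier[OF A n] n] E n]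
  by (simp add: bcirc_tprod[OF A tpinv_carrier[OF A n] n] bcirc_tpinv[OF A n])

text \<open>Since the pseudoinverse times \<open>A\<close> is symmetric, it equals the transpose of
  \<open>A\<close> times the transposed pseudoinverse, which places the candidate in the range.
  Uniqueness: the difference of two candidates lies in the range and is orthogonal to it.\<close>

lemma orth_proj_trange_ttranspose:
  assumes A: "A \<in> tensor_carrier a b n" and n: "0 < n" and E: "E \<in> tensor_carrier b K n"
  shows "orth_proj (trange K (ttranspose A)) E = tpinv A *\<^sub>t A *\<^sub>t E"
proof -
  note T = ttranspose_carrier[OF A]
  note Ap = tpinv_carrier[OF A n]
  let ?M = "bcirc A"
  let ?Q = "mat_pinv ?M * ?M"
  let ?P = "tpinv A *\<^sub>t A *\<^sub>t E"
  have M: "?M \<in> carrier_mat (a * n) (b * n)" by (rule bcirc_carrier[OF A n])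
  have e: "unfold E \<in> carrier_mat (b * n) K" by (rule unfold_carrier[OF E n])
  have PT: "?P \<in> tensor_carrier b K n"
    by (rule tprod_carrier[OF tprod_carrier[OF Ap A n] E n])
  have range: "Q \<in> trange K (ttranspose A) \<longleftrightarrow> (\<exists>Y \<in> tensor_carrier a K n. Q = ttranspose A *\<^sub>t Y)" for Q
    by (auto simp: trange_def tensor_carrier_dims[OF T n])
  have uT: "unfold (ttranspose A *\<^sub>t Y) = ?M\<^sup>T * unfold Y" if "Y \<in> tensor_carrier a K n" for Y
    using unfold_tprod[OF T that n] by (simp add: bcirc_ttranspose[OF A n])
  have mem: "?P \<in> trange K (ttranspose A)"
    unfolding range
  proof (intro bexI)
    show Y: "ttranspose (tpinv A) *\<^sub>t E \<in> tensor_carrier a K n"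
      by (rule tprod_carrier[OF ttranspose_carrier[OF Ap] E n])
    show "?P = ttranspose A *\<^sub>t (ttranspose (tpinv A) *\<^sub>t E)"
    proof (rule unfold_inj[OF PT tprod_carrier[OF T Y n]])
      have "?M\<^sup>T * ((mat_pinv ?M)\<^sup>T * unfold E) = (mat_pinv ?M * ?M)\<^sup>T * unfold E"
        using M e by (simp add: transpose_mult_dim assoc_mult_mat_dim)
      then show "unfold ?P = unfold (ttranspose A *\<^sub>t (ttranspose (tpinv A) *\<^sub>t E))"
        unfolding uT[OF Y] unfold_tpinv_proj[OF A n E] unfold_tprod[OF ttranspose_carrier[OF Ap] E n]
          bcirc_ttranspose[OF Ap n] bcirc_tpinv[OF A n] penrose(4) by simp
    qed
  qed
  have orth: "mat_inner (unfold E - unfold ?P) (?M\<^sup>T * y) = 0" if y: "y \<in> carrier_mat (a * n) K" for y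
  proof -
    have my: "?M\<^sup>T * y \<in> carrier_mat (b * n) K" using M y by auto
    have r: "unfold E - ?Q * unfold E \<in> carrier_mat (b * n) K" using M e by auto
    have "?Q * (?M\<^sup>T * y) = ?Q * ?M\<^sup>T * y" using M y by (simp add: assoc_mult_mat_dim)
    then have Qy: "?Q * (?M\<^sup>T * y) = ?M\<^sup>T * y" by (simp only: row_projection[OF M])
    have "?Q * (unfold E - ?Q * unfold E) = ?Q * unfold E - ?Q * ?Q * unfold E"
      using M e by (simp add: mult_minus_distrib_dim assoc_mult_mat_dim)
    also have "\<dots> = 0\<^sub>m (b * n) K"
      using M e by (simp only: row_projection[OF M]) auto
    finally have "mat_inner (?Q * (?M\<^sup>T * y)) (unfold E - ?Q * unfold E) = 0"
      using mat_inner_adjoint[OF row_projection(1)[OF M] my r] my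
      by (simp only: row_projection(2)[OF M] mat_inner_zero_right)
    then show ?thesis
      unfolding Qy unfold_tpinv_proj[OF A n E] using mat_inner_commute[of "?M\<^sup>T * y" "unfold E - ?Q * unfold E"] my r y e
      by simp
  qed
  show ?thesis
    unfolding orth_proj_def
  proof (rule the_equality)
    show "?P \<in> trange K (ttranspose A) \<and> (\<forall>Q\<in>trange K (ttranspose A). tinner (E -\<^sub>t ?P) Q = 0)"
    proof (intro conjI mem ballI)
      fix Q assume "Q \<in> trange K (ttranspose A)"
      then obtain Y where Y: "Y \<in> tensor_carrier a K n" "Q = ttranspose A *\<^sub>t Y" by (auto simp: range)
      show "tinner (E -\<^sub>t ?P) Q = 0"
        using tinner_unfold[OF tminus_carrier[OF E PT] tprod_carrier[OF T Y(1) n] n]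
          orth[OF unfold_carrier[OF Y(1) n]]
        by (simp add: Y(2) unfold_tminus[OF E PT n] uT[OF Y(1)])
    qed
  next
    fix P' assume P': "P' \<in> trange K (ttranspose A) \<and> (\<forall>Q\<in>trange K (ttranspose A). tinner (E -\<^sub>t P') Q = 0)"
    then obtain Y' where Y': "Y' \<in> tensor_carrier a K n" "P' = ttranspose A *\<^sub>t Y'" by (auto simp: range)
    obtain Y where Y: "Y \<in> tensor_carrier a K n" "?P = ttranspose A *\<^sub>t Y" using mem by (auto simp: range)
    have P'T: "P' \<in> tensor_carrier b K n" using tprod_carrier[OF T Y'(1) n] by (simp add: Y')
    note c = unfold_carrier[OF P'T n] unfold_carrier[OF PT n]
    define V where "V = Y' -\<^sub>t Y"
    have V: "V \<in> tensor_carrier a K n" using tminus_carrier[OF Y'(1) Y(1)] by (simp add: V_def)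
    have D: "unfold P' - unfold ?P = ?M\<^sup>T * unfold V"
      unfolding Y(2) Y'(2) V_def uT[OF Y(1)] uT[OF Y'(1)] unfold_tminus[OF Y'(1) Y(1) n]
      using M unfold_carrier[OF Y'(1) n] unfold_carrier[OF Y(1) n] by (simp add: mult_minus_distrib_dim)
    have "ttranspose A *\<^sub>t V \<in> trange K (ttranspose A)" using V by (auto simp: range)
    then have "tinner (E -\<^sub>t P') (ttranspose A *\<^sub>t V) = 0" using P' by blast
    then have o1: "mat_inner (unfold E - unfold P') (?M\<^sup>T * unfold V) = 0"
      using tinner_unfold[OF tminus_carrier[OF E P'T] tprod_carrier[OF T V n] n]
      by (simp add: unfold_tminus[OF E P'T n] uT[OF V])
    have o2: "mat_inner (unfold E - unfold ?P) (?M\<^sup>T * unfold V) = 0"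
      by (rule orth[OF unfold_carrier[OF V n]])
    have "mat_inner (unfold P' - unfold ?P) (?M\<^sup>T * unfold V) = 0"
      using o1 o2 c e by (simp add: mat_inner_minus_left)
    then have "mat_inner (unfold P' - unfold ?P) (unfold P' - unfold ?P) = 0" by (simp only: D)
    then have "unfold P' - unfold ?P = 0\<^sub>m (b * n) K"
      using c by (simp only: mat_inner_eq_0_iff) simp
    then have "unfold P' = unfold ?P" using c by (simp only: minus_eq_zero_mat_iff[OF c])
    then show "P' = ?P" by (rule unfold_inj[OF P'T PT])
  qed
qed

lemma ttranspose_residual:
  assumes A: "A \<in> tensor_carrier a b n" and n: "0 < n" and B: "B \<in> tensor_carrier a K n"
  shows "ttranspose A *\<^sub>t (B -\<^sub>t A *\<^sub>t tpinv A *\<^sub>t B) = tzero b K n"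
proof (rule tprod_eqI[OF ttranspose_carrier[OF A] _ n tzero_carrier])
  note AAB = tprod_carrier[OF tprod_carrier[OF A tpinv_carrier[OF A n] n] B n]
  show "B -\<^sub>t A *\<^sub>t tpinv A *\<^sub>t B \<in> tensor_carrier a K n" by (rule tminus_carrier[OF B AAB])
  have M: "bcirc A \<in> carrier_mat (a * n) (b * n)" by (rule bcirc_carrier[OF A n])
  have b: "unfold B \<in> carrier_mat (a * n) K" by (rule unfold_carrier[OF B n])
  have "(bcirc A)\<^sup>T * (unfold B - bcirc A * mat_pinv (bcirc A) * unfold B) =
     (bcirc A)\<^sup>T * unfold B - (bcirc A)\<^sup>T * (bcirc A * mat_pinv (bcirc A)) * unfold B"
    using M b by (simp add: mult_minus_distrib_dim assoc_mult_mat_dim)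
  also have "\<dots> = 0\<^sub>m (b * n) K"
    using M b by (simp only: column_projection[OF M]) auto
  finally show "unfold (tzero b K n) = bcirc (ttranspose A) * unfold (B -\<^sub>t A *\<^sub>t tpinv A *\<^sub>t B)"
    by (simp add: bcirc_ttranspose[OF A n] unfold_tminus[OF B AAB n] unfold_proj_tpinv[OF A n B] unfold_tzero[OF n])
qed

lemma tnorm_le_iff: "tnorm X \<le> tnorm Y \<longleftrightarrow> (tnorm X)\<^sup>2 \<le> (tnorm Y)\<^sup>2"
  by (simp add: tnorm_nonneg)

section \<open>Least-squares solutions\<close>

lemma least_squares_pythagoras:
  assumes A: "A \<in> tensor_carrier a b n" and n: "0 < n"
    and B: "B \<in> tensor_carrier a K n" and Y: "Y \<in> tensor_carrier b K n"
  shows "(tnorm (A *\<^sub>t Y -\<^sub>t B))\<^sup>2 =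
    (tnorm (A *\<^sub>t Y -\<^sub>t A *\<^sub>t (tpinv A *\<^sub>t B)))\<^sup>2 + (tnorm (A *\<^sub>t (tpinv A *\<^sub>t B) -\<^sub>t B))\<^sup>2"
proof -
  note X = tprod_carrier[OF tpinv_carrier[OF A n] B n]
  note AX = tprod_carrier[OF A X n] and AY = tprod_carrier[OF A Y n]
  define M where "M = bcirc A"
  define v where "v = unfold B"
  define y where "y = unfold Y"
  have M: "M \<in> carrier_mat (a * n) (b * n)" and v: "v \<in> carrier_mat (a * n) K"
    and y: "y \<in> carrier_mat (b * n) K"
    using bcirc_carrier[OF A n] unfold_carrier[OF B n] unfold_carrier[OF Y n]
    by (auto simp: M_def v_def y_def)
  let ?Q = "M * mat_pinv M"
  have Q: "?Q \<in> carrier_mat (a * n) (a * n)" by (rule column_projection(1)[OF M])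
  have uX: "unfold (A *\<^sub>t (tpinv A *\<^sub>t B)) = ?Q * v"
    using M v unfold_tprod[OF A X n] unfold_tprod[OF tpinv_carrier[OF A n] B n]
    by (simp add: bcirc_tpinv[OF A n] assoc_mult_mat_dim flip: M_def v_def)
  have uY: "unfold (A *\<^sub>t Y) = M * y" using unfold_tprod[OF A Y n] by (simp add: M_def y_def)
  have QMy: "?Q * (M * y) = M * y"
  proof -
    have "?Q * (M * y) = M * mat_pinv M * M * y" using M y by (simp add: assoc_mult_mat_dim)
    then show ?thesis by (simp only: penrose)
  qed
  let ?r = "M * y - v"
  have r: "?r \<in> carrier_mat (a * n) K" using M y v by auto
  have Qr: "?Q * ?r = M * y - ?Q * v"
    using mult_minus_distrib_dim[of ?Q "M * y" v] M y v by (simp only: QMy) simp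
  have rQr: "?r - ?Q * ?r = ?Q * v - v"
    unfolding Qr using M y v Q by (intro eq_matI) auto
  show ?thesis
    unfolding tnorm_sq_unfold[OF tminus_carrier[OF AY B] n] tnorm_sq_unfold[OF tminus_carrier[OF AY AX] n]
      tnorm_sq_unfold[OF tminus_carrier[OF AX B] n] unfold_tminus[OF AY B n] unfold_tminus[OF AY AX n]
      unfold_tminus[OF AX B n] uX uY v_def[symmetric]
    using projection_norm[OF column_projection(1,2,3)[OF M] r]
    unfolding rQr unfolding Qr by simp
qed

lemma least_squares_solution_iff:
  assumes A: "A \<in> tensor_carrier a b n" and n: "0 < n" and B: "B \<in> tensor_carrier a K n"
  shows "least_squares_solution A B Y \<longleftrightarrow>
    Y \<in> tensor_carrier b K n \<and> A *\<^sub>t Y = A *\<^sub>t (tpinv A *\<^sub>t B)"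
proof -
  note X = tprod_carrier[OF tpinv_carrier[OF A n] B n]
  note AX = tprod_carrier[OF A X n]
  note P = least_squares_pythagoras[OF A n B]
  have "A *\<^sub>t Y = A *\<^sub>t (tpinv A *\<^sub>t B)"
    if Y: "Y \<in> tensor_carrier b K n" and
      le: "tnorm (A *\<^sub>t Y -\<^sub>t B) \<le> tnorm (A *\<^sub>t (tpinv A *\<^sub>t B) -\<^sub>t B)"
  proof -
    note AY = tprod_carrier[OF A Y n]
    have "(tnorm (A *\<^sub>t Y -\<^sub>t A *\<^sub>t (tpinv A *\<^sub>t B)))\<^sup>2 \<le> 0"
      using le P[OF Y] by (simp add: tnorm_le_iff)
    then have "A *\<^sub>t Y -\<^sub>t A *\<^sub>t (tpinv A *\<^sub>t B) = tzero a K n"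
      using tnorm_eq_0_iff[OF tminus_carrier[OF AY AX] n] by simp
    then have "unfold (A *\<^sub>t Y) - unfold (A *\<^sub>t (tpinv A *\<^sub>t B)) = 0\<^sub>m (a * n) K"
      using unfold_tminus[OF AY AX n] unfold_tzero[OF n] by metis
    then show ?thesis
      unfolding minus_eq_zero_mat_iff[OF unfold_carrier[OF AY n] unfold_carrier[OF AX n]]
      by (rule unfold_inj[OF AY AX])
  qed
  moreover have "tnorm (A *\<^sub>t (tpinv A *\<^sub>t B) -\<^sub>t B) \<le> tnorm (A *\<^sub>t Y -\<^sub>t B)"
    if "Y \<in> tensor_carrier b K n" for Y
    using P[OF that] by (simp add: tnorm_le_iff)
  ultimately show ?thesis
    unfolding least_squares_solution_def tensor_carrier_dims[OF A n] tensor_carrier_dims[OF B n]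
    using X by (metis)
qed

text \<open>All least-squares solutions have the same image under \<open>A\<close>, hence the same
  row-space component \<open>tpinv A *\<^sub>t B\<close>. By Pythagoras the smallest norm belongs to
  the solution without any other component.\<close>

lemma min_norm_least_squares_solution_iff:
  assumes A: "A \<in> tensor_carrier a b n" and n: "0 < n" and B: "B \<in> tensor_carrier a K n"
  shows "min_norm_least_squares_solution A B Y \<longleftrightarrow> Y = tpinv A *\<^sub>t B"
proof -
  let ?X = "tpinv A *\<^sub>t B"
  note X = tprod_carrier[OF tpinv_carrier[OF A n] B n]
  note LS = least_squares_solution_iff[OF A n B]
  have M: "bcirc A \<in> carrier_mat (a * n) (b * n)" by (rule bcirc_carrier[OF A n])
  let ?Q = "mat_pinv (bcirc A) * bcirc A"
  have pyth: "(tnorm Y)\<^sup>2 = (tnorm (Y -\<^sub>t ?X))\<^sup>2 + (tnorm ?X)\<^sup>2"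
    if Y: "least_squares_solution A B Y" for Y
  proof -
    have YT: "Y \<in> tensor_carrier b K n" and eq: "A *\<^sub>t Y = A *\<^sub>t ?X" using Y by (auto simp: LS)
    have y: "unfold Y \<in> carrier_mat (b * n) K" and bb: "unfold B \<in> carrier_mat (a * n) K"
      by (rule unfold_carrier[OF YT n] unfold_carrier[OF B n])+
    have "bcirc A * unfold Y = bcirc A * unfold ?X"
      using arg_cong[OF eq, of unfold] by (simp add: unfold_tprod[OF A YT n] unfold_tprod[OF A X n])
    then have "?Q * unfold Y = ?Q * unfold ?X"
      using M y unfold_carrier[OF X n] by (simp add: assoc_mult_mat_dim)
    also have "\<dots> = mat_pinv (bcirc A) * bcirc A * mat_pinv (bcirc A) * unfold B"
      using M bb unfold_tprod[OF tpinv_carrier[OF A n] B n]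
      by (simp add: bcirc_tpinv[OF A n] assoc_mult_mat_dim)
    also have "\<dots> = unfold ?X"
      using unfold_tprod[OF tpinv_carrier[OF A n] B n] by (simp only: penrose bcirc_tpinv[OF A n])
    finally show ?thesis
      using projection_norm[OF row_projection(1,2,3)[OF M] y]
      by (simp add: tnorm_sq_unfold[OF YT n] tnorm_sq_unfold[OF X n]
          tnorm_sq_unfold[OF tminus_carrier[OF YT X] n] unfold_tminus[OF YT X n])
  qed
  have LSX: "least_squares_solution A B ?X" using X by (simp add: LS)
  show ?thesis
  proof
    assume min: "min_norm_least_squares_solution A B Y"
    then have Y: "least_squares_solution A B Y" and le: "tnorm Y \<le> tnorm ?X"
      using LSX by (auto simp: min_norm_least_squares_solution_def)
    have YT: "Y \<in> tensor_carrier b K n" using Y by (simp add: LS)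
    have "(tnorm (Y -\<^sub>t ?X))\<^sup>2 \<le> 0" using pyth[OF Y] le by (simp add: tnorm_le_iff)
    then have "Y -\<^sub>t ?X = tzero b K n" using tnorm_eq_0_iff[OF tminus_carrier[OF YT X] n] by simp
    then have "unfold Y - unfold ?X = 0\<^sub>m (b * n) K"
      using unfold_tminus[OF YT X n] unfold_tzero[OF n] by metis
    then show "Y = ?X"
      unfolding minus_eq_zero_mat_iff[OF unfold_carrier[OF YT n] unfold_carrier[OF X n]]
      by (rule unfold_inj[OF YT X])
  next
    assume Y: "Y = ?X"
    have "tnorm ?X \<le> tnorm V" if "least_squares_solution A B V" for V
      unfolding tnorm_le_iff pyth[OF that] by simp
    then show "min_norm_least_squares_solution A B Y"
      using LSX unfolding min_norm_least_squares_solution_def Y by blast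
  qed
qed

section \<open>One iteration\<close>

text \<open>The common core of both selection rules, with numerators \<open>g\<close> and weights
  \<open>h\<close>. Summing the selection inequalities over \<open>U\<close> bounds the captured
  part from below; as every quotient is at most the maximum, the total of \<open>g\<close> is at
  most the maximum times the total weight. Because \<open>\<eta> \<le> 1\<close>, an index attaining
  the maximum is selected.\<close>

lemma greedy_selection:
  fixes g h :: "nat \<Rightarrow> real"
  assumes b: "0 < b" and \<eta>: "0 < \<eta>" "\<eta> \<le> 1"
    and g: "\<And>j. j < b \<Longrightarrow> 0 \<le> g j" and h: "\<And>j. j < b \<Longrightarrow> 0 < h j"
    and eps: "eps = \<eta> * Max ((\<lambda>j. g j / h j) ` {..<b})"
    and U: "U = {j. j < b \<and> g j \<ge> eps * h j}"
  shows "U \<noteq> {}" "U \<subseteq> {..<b}" "eps * (\<Sum>j\<in>U. h j) \<le> (\<Sum>j\<in>U. g j)"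
    "\<eta> * (\<Sum>j<b. g j) \<le> eps * (\<Sum>j<b. h j)"
proof -
  let ?m = "Max ((\<lambda>j. g j / h j) ` {..<b})"
  have "?m \<in> (\<lambda>j. g j / h j) ` {..<b}" using b by (intro Max_in) auto
  then obtain j0 where j0: "j0 < b" "?m = g j0 / h j0" by auto
  have m0: "0 \<le> ?m" unfolding j0(2) using g[OF j0(1)] h[OF j0(1)] by simp
  have "\<eta> * ?m \<le> ?m" using mult_right_mono[OF \<eta>(2) m0] by simp
  then have "eps * h j0 \<le> ?m * h j0"
    unfolding eps using h[OF j0(1)] by (intro mult_right_mono) auto
  also have "\<dots> = g j0" unfolding j0(2) using h[OF j0(1)] by simp
  finally have "j0 \<in> U" using j0(1) by (simp add: U)
  then show "U \<noteq> {}" by blast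
  show "U \<subseteq> {..<b}" by (auto simp: U)
  show "eps * (\<Sum>j\<in>U. h j) \<le> (\<Sum>j\<in>U. g j)"
    unfolding sum_distrib_left by (intro sum_mono) (auto simp: U)
  have "g j \<le> ?m * h j" if "j < b" for j
  proof -
    have "g j / h j \<le> ?m" using that by (intro Max_ge) auto
    then show ?thesis using h[OF that] by (simp add: field_simps)
  qed
  then have "(\<Sum>j<b. g j) \<le> ?m * (\<Sum>j<b. h j)"
    unfolding sum_distrib_left by (intro sum_mono) auto
  then show "\<eta> * (\<Sum>j<b. g j) \<le> eps * (\<Sum>j<b. h j)"
    unfolding eps using \<eta>(1) by (simp add: mult.assoc)
qed

lemma tnorm_sq_pos:
  assumes "A \<in> tensor_carrier a b n" "0 < n" "A \<noteq> tzero a b n"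
  shows "0 < (tnorm A)\<^sup>2"
  using tnorm_eq_0_iff[OF assms(1,2)] assms(3) by simp

lemma hslices_neq_tzero:
  assumes A: "A \<in> tensor_carrier a b n" and n: "0 < n"
    and nz: "\<And>i. i < a \<Longrightarrow> hslices A {i} \<noteq> tzero 1 b n"
    and J: "J \<subseteq> {..<a}" "J \<noteq> {}"
  shows "hslices A J \<noteq> tzero (card J) b n"
proof -
  have pos: "0 < (tnorm (hslices A {i}))\<^sup>2" if "i \<in> J" for i
    using J(1) that nz[of i] hslices_carrier[OF A, of "{i}"] by (intro tnorm_sq_pos[of _ 1 b n] n) auto
  have "0 < (\<Sum>i\<in>J. (tnorm (hslices A {i}))\<^sup>2)"
    using J pos by (intro sum_pos) (auto intro: finite_subset)
  then have "(tnorm (hslices A J))\<^sup>2 \<noteq> 0"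
    unfolding tnorm_sq_hslices_sum[OF A n J(1)] by linarith
  then show ?thesis using tnorm_eq_0_iff[OF hslices_carrier[OF A J(1)] n] by simp
qed

text \<open>With \<open>d\<close> the unfolded \<open>Z - Bp\<close> and \<open>?Q\<close> the
  projection onto the block, the contraction is the chain \<eta> sigma^2 |d|^2 \<le> \<eta> |A^T
  d|^2 \<le> eps |A|^2 \<le> n |Qd|^2 |A|^2. The witness \<open>Y\<close> keeps \<open>d\<close> in
  the range of \<open>A\<close>, as the first link requires.\<close>

lemma z_step:
  assumes A: "A \<in> tensor_carrier a b n" and n: "0 < n" and b: "0 < b" and K: "0 < K"
    and Z: "Z \<in> tensor_carrier a K n" and Bp: "Bp \<in> tensor_carrier a K n"
    and Bp0: "ttranspose A *\<^sub>t Bp = tzero b K n"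
    and Y: "Y \<in> tensor_carrier b K n" "Z -\<^sub>t Bp = A *\<^sub>t Y"
    and nz: "\<And>j. j < b \<Longrightarrow> lslices A {j} \<noteq> tzero a 1 n"
    and \<eta>: "0 < \<eta>" "\<eta> \<le> 1"
    and AU: "AU = lslices A (select_U \<eta> A Z)"
    and Z': "Z' = Z -\<^sub>t AU *\<^sub>t tpinv AU *\<^sub>t Z"
  shows "Z' \<in> tensor_carrier a K n"
    "\<exists>Y'\<in>tensor_carrier b K n. Z' -\<^sub>t Bp = A *\<^sub>t Y'"
    "(tnorm (Z' -\<^sub>t Bp))\<^sup>2 \<le>
       (1 - \<eta> * ((sigma_min_pos (bcirc A))\<^sup>2 / (mat_fnorm (bcirc A))\<^sup>2)) * (tnorm (Z -\<^sub>t Bp))\<^sup>2"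
proof -
  define U where "U = select_U \<eta> A Z"
  define g where "g j = (tnorm (ttranspose (lslices A {j}) *\<^sub>t Z))\<^sup>2" for j
  define h where "h j = (tnorm (lslices A {j}))\<^sup>2" for j
  have h: "0 < h j" if "j < b" for j
    unfolding h_def using that nz lslices_carrier[OF A, of "{j}"] by (intro tnorm_sq_pos[of _ a 1 n] n) auto
  have U_eq: "U = {j. j < b \<and> g j \<ge> eps_z \<eta> A Z * h j}"
    by (simp add: U_def select_U_def tensor_carrier_dims[OF A n] g_def h_def)
  have eps_eq: "eps_z \<eta> A Z = \<eta> * Max ((\<lambda>j. g j / h j) ` {..<b})"
    by (simp add: eps_z_def tensor_carrier_dims[OF A n] g_def h_def)
  have g: "0 \<le> g j" for j by (simp add: g_def)
  note greedy = greedy_selection[OF b \<eta> g h eps_eq U_eq]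
  define eps where "eps = eps_z \<eta> A Z"
  have Uss: "U \<subseteq> {..<b}" by (rule greedy(2))
  note AT = ttranspose_carrier[OF A]
  have AUc: "AU \<in> tensor_carrier a (card U) n"
    unfolding AU U_def[symmetric] by (rule lslices_carrier[OF A Uss])
  have AUT: "ttranspose AU = hslices (ttranspose A) U"
    unfolding AU U_def[symmetric] by (rule ttranspose_lslices[OF A Uss])
  have AUTW: "ttranspose AU *\<^sub>t W = hslices (ttranspose A *\<^sub>t W) U" if "W \<in> tensor_carrier a K n" for W
    unfolding AUT by (rule hslices_tprod[OF AT that Uss n, symmetric])
  have ATZ: "ttranspose A *\<^sub>t Z \<in> tensor_carrier b K n" by (rule tprod_carrier[OF AT Z n])
  have g_eq: "g j = (tnorm (hslices (ttranspose A *\<^sub>t Z) {j}))\<^sup>2" if "j < b" for j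
    using that unfolding g_def by (subst ttranspose_lslices[OF A]) (auto simp: hslices_tprod[OF AT Z _ n])
  have h_eq: "h j = (tnorm (hslices (ttranspose A) {j}))\<^sup>2" if "j < b" for j
    using that unfolding h_def
    by (subst tnorm_sq_ttranspose[OF lslices_carrier[OF A] n, symmetric]) (auto simp: ttranspose_lslices[OF A])
  have sum_gU: "(\<Sum>j\<in>U. g j) = (tnorm (ttranspose AU *\<^sub>t Z))\<^sup>2"
    unfolding AUTW[OF Z] tnorm_sq_hslices_sum[OF ATZ n Uss]
    using Uss by (intro sum.cong) (auto simp: g_eq)
  have sum_g: "(\<Sum>j<b. g j) = (tnorm (ttranspose A *\<^sub>t Z))\<^sup>2"
    unfolding tnorm_sq_sum_hslices[OF ATZ n] by (intro sum.cong) (auto simp: g_eq)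
  have sum_hU: "(\<Sum>j\<in>U. h j) = (tnorm AU)\<^sup>2"
    unfolding tnorm_sq_ttranspose[OF AUc n, symmetric] AUT tnorm_sq_hslices_sum[OF AT n Uss]
    using Uss by (intro sum.cong) (auto simp: h_eq)
  have sum_h: "(\<Sum>j<b. h j) = (tnorm A)\<^sup>2"
    unfolding tnorm_sq_ttranspose[OF A n, symmetric] tnorm_sq_sum_hslices[OF AT n]
    by (intro sum.cong) (auto simp: h_eq)
  have AU_pos: "0 < (tnorm AU)\<^sup>2"
    unfolding sum_hU[symmetric] using greedy(1) Uss h by (intro sum_pos) (auto intro: finite_subset)
  have A_pos: "0 < (tnorm A)\<^sup>2"
    unfolding sum_h[symmetric] using b h by (intro sum_pos) auto
  have A0: "A \<noteq> tzero a b n" using A_pos tnorm_eq_0_iff[OF A n] by auto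
  define M where "M = bcirc A"
  define N where "N = bcirc AU"
  define z where "z = unfold Z"
  define p where "p = unfold Bp"
  define d where "d = z - p"
  have M: "M \<in> carrier_mat (a * n) (b * n)" unfolding M_def by (rule bcirc_carrier[OF A n])
  have N: "N \<in> carrier_mat (a * n) (card U * n)" unfolding N_def by (rule bcirc_carrier[OF AUc n])
  have z: "z \<in> carrier_mat (a * n) K" unfolding z_def by (rule unfold_carrier[OF Z n])
  have p: "p \<in> carrier_mat (a * n) K" unfolding p_def by (rule unfold_carrier[OF Bp n])
  have d: "d \<in> carrier_mat (a * n) K" using z p by (auto simp: d_def)
  have d_eq: "d = unfold (Z -\<^sub>t Bp)" by (simp add: d_def z_def p_def unfold_tminus[OF Z Bp n])
  have M0: "M \<noteq> 0\<^sub>m (a * n) (b * n)" unfolding M_def by (rule bcirc_neq_zero[OF A n A0])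
  have Mp: "M\<^sup>T * p = 0\<^sub>m (b * n) K"
    using arg_cong[OF Bp0, of unfold] unfold_tprod[OF AT Bp n]
    by (simp add: bcirc_ttranspose[OF A n] M_def p_def unfold_tzero[OF n])
  have "ttranspose AU *\<^sub>t Bp = tzero (card U) K n"
  proof (rule tensor_eqI[OF tprod_carrier[OF ttranspose_carrier[OF AUc] Bp n] tzero_carrier])
    fix k i j assume *: "k < n" "i < card U" "j < K"
    then show "(ttranspose AU *\<^sub>t Bp) ! k $$ (i, j) = tzero (card U) K n ! k $$ (i, j)"
      unfolding AUTW[OF Bp] Bp0 using pick_less[OF Uss *(2)]
      by (simp add: hslices_index[OF tzero_carrier Uss] tzero_index)
  qed
  then have Np: "N\<^sup>T * p = 0\<^sub>m (card U * n) K"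
    using arg_cong[of _ _ unfold] unfold_tprod[OF ttranspose_carrier[OF AUc] Bp n]
    by (metis bcirc_ttranspose[OF AUc n] N_def p_def unfold_tzero[OF n])
  let ?Q = "N * mat_pinv N"
  have Q: "?Q \<in> carrier_mat (a * n) (a * n)" by (rule column_projection(1)[OF N])
  have Qp: "?Q * p = 0\<^sub>m (a * n) K"
  proof -
    have "?Q * p = (N * mat_pinv N)\<^sup>T * p" by (simp only: penrose)
    also have "\<dots> = (mat_pinv N)\<^sup>T * (N\<^sup>T * p)"
      using N p by (simp add: transpose_mult_dim assoc_mult_mat_dim)
    also have "\<dots> = 0\<^sub>m (a * n) K"
      unfolding Np using mat_pinv_carrier[OF N] by (intro right_mult_zero_mat[of _ _ "card U * n"]) simp
    finally show ?thesis .
  qed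
  \<comment> \<open>The algorithm sees \<open>Z\<close>, the estimate concerns \<open>d\<close>;
    they are interchangeable under every matrix that annihilates \<open>p\<close>, the unfolded
    \<open>Bp\<close>.\<close>
  have annihilate: "G * z = G * d" if G: "G \<in> carrier_mat c (a * n)" and Gp: "G * p = 0\<^sub>m c K" for G c
  proof -
    have "G * d = G * z - 0\<^sub>m c K"
      using mult_minus_distrib_dim[of G z p] G z p unfolding Gp d_def by simp
    also have "\<dots> = G * z" using G z by (intro eq_matI) auto
    finally show ?thesis ..
  qed
  have MTz: "M\<^sup>T * z = M\<^sup>T * d" using M by (intro annihilate[OF _ Mp]) simp
  have NTz: "N\<^sup>T * z = N\<^sup>T * d" using N by (intro annihilate[OF _ Np]) simp
  have Qz: "?Q * z = ?Q * d" by (rule annihilate[OF Q Qp])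
  note AAZ = tprod_carrier[OF tprod_carrier[OF AUc tpinv_carrier[OF AUc n] n] Z n]
  show Z'T: "Z' \<in> tensor_carrier a K n" unfolding Z' by (rule tminus_carrier[OF Z AAZ])
  have uZ': "unfold (Z' -\<^sub>t Bp) = d - ?Q * d"
    unfolding unfold_tminus[OF Z'T Bp n] unfolding Z' unfold_tminus[OF Z AAZ n] unfold_proj_tpinv[OF AUc n Z]
      N_def[symmetric] z_def[symmetric] p_def[symmetric] Qz
    unfolding d_def using Q z p by (intro eq_matI) auto
  show "\<exists>Y'\<in>tensor_carrier b K n. Z' -\<^sub>t Bp = A *\<^sub>t Y'"
  proof -
    \<comment> \<open>The lateral slices of the unit tensor exhibit \<open>AU\<close> as
      \<open>A *\<^sub>t S\<close>, so the correction of \<open>Z\<close> stays in the range of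
      \<open>A\<close>.\<close>
    define S where "S = lslices (tone b n) U"
    have S: "S \<in> tensor_carrier b (card U) n" unfolding S_def by (rule lslices_carrier[OF tone_carrier Uss])
    have AU_S: "AU = A *\<^sub>t S"
      using lslices_tprod[OF A tone_carrier Uss n] unfolding tone_right[OF A n] S_def
      by (simp add: AU U_def)
    define V where "V = S *\<^sub>t (tpinv AU *\<^sub>t Z)"
    note PZ = tprod_carrier[OF tpinv_carrier[OF AUc n] Z n]
    have V: "V \<in> tensor_carrier b K n" unfolding V_def by (rule tprod_carrier[OF S PZ n])
    have "AU *\<^sub>t tpinv AU *\<^sub>t Z = AU *\<^sub>t (tpinv AU *\<^sub>t Z)"
      by (rule tprod_assoc[OF AUc tpinv_carrier[OF AUc n] Z n])
    also have "\<dots> = A *\<^sub>t V" 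
      unfolding V_def tprod_assoc[OF A S PZ n, symmetric] AU_S[symmetric] ..
    finally have "unfold (AU *\<^sub>t tpinv AU *\<^sub>t Z) = unfold (A *\<^sub>t V)" by simp
    then have "?Q * d = M * unfold V"
      by (simp add: unfold_proj_tpinv[OF AUc n Z] unfold_tprod[OF A V n] Qz flip: N_def z_def M_def)
    moreover have "d = M * unfold Y" unfolding d_eq Y(2) unfold_tprod[OF A Y(1) n] M_def ..
    ultimately have "unfold (Z' -\<^sub>t Bp) = M * unfold Y - M * unfold V" using uZ' by simp
    also have "\<dots> = M * unfold (Y -\<^sub>t V)"
      using M unfold_carrier[OF Y(1) n] unfold_carrier[OF V n]
      by (simp add: unfold_tminus[OF Y(1) V n] mult_minus_distrib_dim)
    finally have "A *\<^sub>t (Y -\<^sub>t V) = Z' -\<^sub>t Bp"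
      by (intro tprod_eqI[OF A tminus_carrier[OF Y(1) V] n tminus_carrier[OF Z'T Bp]]) (simp add: M_def)
    then show ?thesis using tminus_carrier[OF Y(1) V] by (intro bexI[of _ "Y -\<^sub>t V"]) auto
  qed
  have Md: "M * mat_pinv M * d = d"
  proof -
    have d': "d = M * unfold Y" unfolding d_eq Y(2) unfold_tprod[OF A Y(1) n] M_def ..
    have "M * mat_pinv M * d = M * mat_pinv M * M * unfold Y"
      unfolding d' using M unfold_carrier[OF Y(1) n] by (simp add: assoc_mult_mat_dim)
    then show ?thesis by (simp only: penrose d')
  qed
  have "eps * (tnorm AU)\<^sup>2 \<le> mat_inner (N\<^sup>T * d) (N\<^sup>T * d)"
    using greedy(3) unfolding sum_hU sum_gU eps_def
    using tnorm_sq_unfold[OF tprod_carrier[OF ttranspose_carrier[OF AUc] Z n] n]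
      unfold_tprod[OF ttranspose_carrier[OF AUc] Z n] NTz
    by (simp add: bcirc_ttranspose[OF AUc n] flip: N_def z_def)
  \<comment> \<open>\<open>N\<^sup>T\<close> sees only the projected part of \<open>d\<close>. The
    Frobenius bound for \<open>N\<^sup>T\<close> then produces \<open>(tnorm AU)\<^sup>2\<close>,
    which cancels against the weight of the selected block.\<close>
  also have "N\<^sup>T * d = N\<^sup>T * (?Q * d)"
  proof -
    have "N\<^sup>T * (?Q * d) = N\<^sup>T * ?Q * d" using N d by (simp add: assoc_mult_mat_dim)
    then show ?thesis by (simp only: column_projection(4)[OF N])
  qed
  also have "mat_inner (N\<^sup>T * (?Q * d)) (N\<^sup>T * (?Q * d)) \<le> mat_inner (N\<^sup>T) (N\<^sup>T) * mat_inner (?Q * d) (?Q * d)"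
    using N Q d by (intro mat_inner_mult_le[of _ "card U * n" "a * n" _ K]) auto
  also have "mat_inner (N\<^sup>T) (N\<^sup>T) = n * (tnorm AU)\<^sup>2"
    using mat_inner_bcirc[OF AUc n] by (simp add: mat_inner_transpose N_def)
  finally have "(tnorm AU)\<^sup>2 * eps \<le> (tnorm AU)\<^sup>2 * (n * mat_inner (?Q * d) (?Q * d))"
    by (simp add: algebra_simps)
  then have eps_le: "eps \<le> n * mat_inner (?Q * d) (?Q * d)" using AU_pos by simp
  have "\<eta> * ((sigma_min_pos M)\<^sup>2 * mat_inner d d) \<le> \<eta> * mat_inner (M\<^sup>T * d) (M\<^sup>T * d)"
    using \<eta> sigma_min_pos_le_transpose[OF M M0 K d Md] by (intro mult_left_mono) auto
  also have "\<dots> \<le> eps * (tnorm A)\<^sup>2"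
    using greedy(4) unfolding sum_h sum_g eps_def
    using tnorm_sq_unfold[OF ATZ n] unfold_tprod[OF AT Z n] MTz
    by (simp add: bcirc_ttranspose[OF A n] flip: M_def z_def)
  also have "\<dots> \<le> n * mat_inner (?Q * d) (?Q * d) * (tnorm A)\<^sup>2"
    using eps_le by (intro mult_right_mono) auto
  also have "\<dots> = mat_inner (?Q * d) (?Q * d) * (mat_fnorm M)\<^sup>2"
    using mat_inner_bcirc[OF A n] by (simp add: mat_fnorm_sq M_def)
  finally have *: "\<eta> * ((sigma_min_pos M)\<^sup>2 * mat_inner d d) \<le> mat_inner (?Q * d) (?Q * d) * (mat_fnorm M)\<^sup>2" .
  have F_pos: "0 < (mat_fnorm M)\<^sup>2"
    using mat_inner_bcirc[OF A n] A_pos n by (simp add: mat_fnorm_sq M_def)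
  have "\<eta> * ((sigma_min_pos M)\<^sup>2 / (mat_fnorm M)\<^sup>2) * mat_inner d d \<le> mat_inner (?Q * d) (?Q * d)"
    using * F_pos by (simp add: field_simps)
  then show "(tnorm (Z' -\<^sub>t Bp))\<^sup>2 \<le>
       (1 - \<eta> * ((sigma_min_pos (bcirc A))\<^sup>2 / (mat_fnorm (bcirc A))\<^sup>2)) * (tnorm (Z -\<^sub>t Bp))\<^sup>2"
    unfolding tnorm_sq_unfold[OF tminus_carrier[OF Z'T Bp] n] tnorm_sq_unfold[OF tminus_carrier[OF Z Bp] n]
      uZ' d_eq[symmetric] M_def[symmetric]
    using projection_norm[OF column_projection(1,2,3)[OF N] d]
    by (simp add: left_diff_distrib)
qed

lemma tnorm_sq_minus_commute:
  assumes A: "A \<in> tensor_carrier a b n" and B: "B \<in> tensor_carrier a b n" and n: "0 < n"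
  shows "(tnorm (A -\<^sub>t B))\<^sup>2 = (tnorm (B -\<^sub>t A))\<^sup>2"
proof -
  have "mat_inner (x - y) (x - y) = mat_inner (y - x) (y - x)"
    if "x \<in> carrier_mat (a * n) b" "y \<in> carrier_mat (a * n) b" for x y
    using that by (simp add: mat_inner_def algebra_simps)
  then show ?thesis
    unfolding tnorm_sq_unfold[OF tminus_carrier[OF A B] n] tnorm_sq_unfold[OF tminus_carrier[OF B A] n]
      unfold_tminus[OF A B n] unfold_tminus[OF B A n]
    using unfold_carrier[OF A n] unfold_carrier[OF B n] by blast
qed

text \<open>The update removes the row-space component \<open>P * M * e\<close> of the error and
  inserts \<open>P * w\<close>. By \<open>QPw\<close> the latter lies in the same row space, so no
  cross term with the surviving component arises.\<close>

lemma x_step: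
  assumes C: "C \<in> tensor_carrier c b n" and n: "0 < n" and K: "0 < K" and C0: "C \<noteq> tzero c b n"
    and X: "X \<in> tensor_carrier b K n" and Xs: "Xs \<in> tensor_carrier b K n"
    and W: "W \<in> tensor_carrier c K n" and R: "R = W -\<^sub>t C *\<^sub>t (X -\<^sub>t Xs)"
  shows "(tnorm (X +\<^sub>t tpinv C *\<^sub>t R -\<^sub>t Xs))\<^sup>2 \<le>
    (tnorm (X -\<^sub>t Xs))\<^sup>2 - (tnorm (tpinv C *\<^sub>t C *\<^sub>t (X -\<^sub>t Xs)))\<^sup>2
      + (tnorm W)\<^sup>2 / (sigma_min_pos (bcirc C))\<^sup>2"
proof -
  note E = tminus_carrier[OF X Xs]
  note CE = tprod_carrier[OF C E n]
  have RT: "R \<in> tensor_carrier c K n" unfolding R by (rule tminus_carrier[OF W CE])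
  note PR = tprod_carrier[OF tpinv_carrier[OF C n] RT n]
  note XPR = tadd_carrier[OF X PR]
  define M where "M = bcirc C"
  define P where "P = mat_pinv M"
  define e where "e = unfold (X -\<^sub>t Xs)"
  define w where "w = unfold W"
  have M: "M \<in> carrier_mat (c * n) (b * n)" unfolding M_def by (rule bcirc_carrier[OF C n])
  have M0: "M \<noteq> 0\<^sub>m (c * n) (b * n)" unfolding M_def by (rule bcirc_neq_zero[OF C n C0])
  have P: "P \<in> carrier_mat (b * n) (c * n)" unfolding P_def by (rule mat_pinv_carrier[OF M])
  have e: "e \<in> carrier_mat (b * n) K" unfolding e_def by (rule unfold_carrier[OF E n])
  have w: "w \<in> carrier_mat (c * n) K" unfolding w_def by (rule unfold_carrier[OF W n])
  have uX: "unfold X \<in> carrier_mat (b * n) K" "unfold Xs \<in> carrier_mat (b * n) K"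
    by (rule unfold_carrier[OF X n] unfold_carrier[OF Xs n])+
  have e_eq: "e = unfold X - unfold Xs" by (simp add: e_def unfold_tminus[OF X Xs n])
  have QPw: "P * M * (P * w) = P * w"
  proof -
    have "P * M * (P * w) = P * M * P * w" using M P w by (simp add: assoc_mult_mat_dim)
    then show ?thesis by (simp only: P_def penrose)
  qed
  have "unfold (X +\<^sub>t tpinv C *\<^sub>t R -\<^sub>t Xs) = unfold X + P * (w - M * e) - unfold Xs"
    unfolding unfold_tminus[OF XPR Xs n] unfold_tadd[OF X PR n] unfold_tprod[OF tpinv_carrier[OF C n] RT n]
    unfolding R unfold_tminus[OF W CE n] unfold_tprod[OF C E n] bcirc_tpinv[OF C n]
    by (simp add: M_def P_def e_def w_def)
  also have "P * (w - M * e) = P * w - P * M * e"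
    using M P w e by (simp add: mult_minus_distrib_dim assoc_mult_mat_dim)
  also have "unfold X + (P * w - P * M * e) - unfold Xs = e - P * M * e + P * w"
  proof -
    have "x + (p - q) - s = x - s - q + p"
      if "x \<in> carrier_mat r K" "s \<in> carrier_mat r K" "p \<in> carrier_mat r K" "q \<in> carrier_mat r K"
      for x s p q :: "real mat" and r
      using that by (intro eq_matI) auto
    from this[OF uX, of "P * w" "P * M * e"] show ?thesis
      using M P w e by (simp flip: e_eq)
  qed
  finally have u: "unfold (X +\<^sub>t tpinv C *\<^sub>t R -\<^sub>t Xs) = e - P * M * e + P * M * (P * w)"
    by (simp only: QPw)
  have Pw: "P * w \<in> carrier_mat (b * n) K" using P w by auto
  note rp = row_projection(1,2,3)[OF M, folded P_def]
  have "(tnorm (X +\<^sub>t tpinv C *\<^sub>t R -\<^sub>t Xs))\<^sup>2 =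
      mat_inner (e - P * M * e) (e - P * M * e) + mat_inner (P * w) (P * w)"
    unfolding tnorm_sq_unfold[OF tminus_carrier[OF XPR Xs] n] u projection_pythagoras[OF rp e Pw]
    by (simp only: QPw)
  also have "mat_inner (e - P * M * e) (e - P * M * e) =
      (tnorm (X -\<^sub>t Xs))\<^sup>2 - (tnorm (tpinv C *\<^sub>t C *\<^sub>t (X -\<^sub>t Xs)))\<^sup>2"
    using projection_norm[OF rp e]
    unfolding tnorm_sq_unfold[OF E n]
      tnorm_sq_unfold[OF tprod_carrier[OF tprod_carrier[OF tpinv_carrier[OF C n] C n] E n] n]
      unfold_tpinv_proj[OF C n E]
    by (simp add: M_def P_def e_def)
  also have "mat_inner (P * w) (P * w) \<le> (tnorm W)\<^sup>2 / (sigma_min_pos (bcirc C))\<^sup>2"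
    using pinv_mult_norm_le[OF M M0 w K] unfolding tnorm_sq_unfold[OF W n]
    by (simp add: M_def P_def w_def)
  finally show ?thesis by simp
qed

lemma hslices_as_tprod:
  assumes A: "A \<in> tensor_carrier a b n" and n: "0 < n" and J: "J \<subseteq> {..<a}"
  shows "hslices A J = hslices (tone a n) J *\<^sub>t A"
  using hslices_tprod[OF tone_carrier A J n] by (simp add: tone_left[OF A n])

text \<open>A row block is \<open>S * M\<close>, so its pseudoinverse factors through
  \<open>M\<^sup>T\<close> on the left; every X-update therefore stays in the row space of
  \<open>A\<close>.\<close>

lemma row_space_pinv_hslices:
  assumes A: "A \<in> tensor_carrier a b n" and n: "0 < n" and J: "J \<subseteq> {..<a}"
  shows "mat_pinv (bcirc A) * bcirc A * mat_pinv (bcirc (hslices A J)) = mat_pinv (bcirc (hslices A J))"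
proof -
  define M where "M = bcirc A"
  define S where "S = bcirc (hslices (tone a n) J)"
  define N where "N = bcirc (hslices A J)"
  note I = hslices_carrier[OF tone_carrier J]
  have M: "M \<in> carrier_mat (a * n) (b * n)" unfolding M_def by (rule bcirc_carrier[OF A n])
  have S: "S \<in> carrier_mat (card J * n) (a * n)" unfolding S_def by (rule bcirc_carrier[OF I n])
  have N_eq: "N = S * M"
    unfolding N_def S_def M_def hslices_as_tprod[OF A n J] by (rule bcirc_tprod[OF I A n])
  have N: "N \<in> carrier_mat (card J * n) (b * n)" unfolding N_eq using S M by auto
  let ?Q = "mat_pinv M * M"
  let ?P = "mat_pinv N"
  have "?P = (?P * N)\<^sup>T * ?P" by (simp only: penrose)
  also have "\<dots> = M\<^sup>T * (S\<^sup>T * (?P\<^sup>T * ?P))"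
  proof -
    have "(?P * N)\<^sup>T = N\<^sup>T * ?P\<^sup>T" by (rule transpose_mult_dim) simp
    also have "N\<^sup>T = M\<^sup>T * S\<^sup>T" unfolding N_eq using S M by (intro transpose_mult_dim) simp
    finally show ?thesis using S M N mat_pinv_carrier[OF N] by (simp add: assoc_mult_mat_dim)
  qed
  finally have P_eq: "?P = M\<^sup>T * (S\<^sup>T * (?P\<^sup>T * ?P))" .
  have "?Q * (M\<^sup>T * V) = M\<^sup>T * V" if "dim_row V = a * n" for V
  proof -
    have "?Q * (M\<^sup>T * V) = ?Q * M\<^sup>T * V" using M that by (simp add: assoc_mult_mat_dim)
    then show ?thesis by (simp only: row_projection(4)[OF M])
  qed
  from this[of "S\<^sup>T * (?P\<^sup>T * ?P)"] have "?Q * ?P = ?P"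
    using S unfolding P_eq[symmetric] by simp
  then show ?thesis by (simp only: M_def N_def)
qed

text \<open>This is where \<open>\<beta> > 0\<close> comes from: a tensor in the row space of \<open>A\<close> that is annihilated by some
  nonzero row block, as \<open>\<theta>\<^sub>k < 1\<close> provides, excludes the rank one case, in which \<open>\<eta> = 1\<close> would
  give \<open>\<beta> = 0\<close>.\<close>

lemma sigma_min_pos_less_fnorm:
  assumes A: "A \<in> tensor_carrier a b n" and n: "0 < n" and K: "0 < K"
    and J: "J \<subseteq> {..<a}" and AJ: "hslices A J \<noteq> tzero (card J) b n"
    and E: "E \<in> tensor_carrier b K n" and E0: "E \<noteq> tzero b K n"
    and row: "mat_pinv (bcirc A) * bcirc A * unfold E = unfold E"
    and ker: "hslices A J *\<^sub>t E = tzero (card J) K n"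
  shows "(sigma_min_pos (bcirc A))\<^sup>2 < (mat_fnorm (bcirc A))\<^sup>2"
proof -
  have fJ: "finite J" using J by (rule finite_subset) simp
  note AE = tprod_carrier[OF A E n]
  have sl: "hslices (A *\<^sub>t E) {i} = hslices A {i} *\<^sub>t E" if "i < a" for i
    using that by (intro hslices_tprod[OF A E _ n]) auto
  have E_pos: "0 < (tnorm E)\<^sup>2" by (rule tnorm_sq_pos[OF E n E0])
  have AJ_pos: "0 < (\<Sum>i\<in>J. (tnorm (hslices A {i}))\<^sup>2)"
    using tnorm_sq_pos[OF hslices_carrier[OF A J] n AJ] tnorm_sq_hslices_sum[OF A n J] by simp
  then have A0: "A \<noteq> tzero a b n"
    using tnorm_hslices_le[OF A n J] tnorm_sq_hslices_sum[OF A n J] tnorm_eq_0_iff[OF A n] by auto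
  have "hslices (A *\<^sub>t E) J = tzero (card J) K n" using hslices_tprod[OF A E J n] ker by simp
  then have "(\<Sum>i\<in>J. (tnorm (hslices (A *\<^sub>t E) {i}))\<^sup>2) = 0"
    using tnorm_sq_hslices_sum[OF AE n J] tnorm_eq_0_iff[OF hslices_carrier[OF AE J] n] by simp
  then have J0: "(tnorm (hslices (A *\<^sub>t E) {i}))\<^sup>2 = 0" if "i \<in> J" for i
    using that fJ by (subst (asm) sum_nonneg_eq_0_iff) auto
  have le: "(tnorm (hslices (A *\<^sub>t E) {i}))\<^sup>2 \<le> n * (tnorm (hslices A {i}))\<^sup>2 * (tnorm E)\<^sup>2" if i: "i < a" for i
  proof -
    have Ai: "hslices A {i} \<in> tensor_carrier (card {i}) b n" using i by (intro hslices_carrier[OF A]) auto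
    show ?thesis
      unfolding sl[OF i] tnorm_sq_unfold[OF tprod_carrier[OF Ai E n] n] unfold_tprod[OF Ai E n]
        mat_inner_bcirc[OF Ai n, symmetric] tnorm_sq_unfold[OF E n]
      by (rule mat_inner_mult_le[OF bcirc_carrier[OF Ai n] unfold_carrier[OF E n]])
  qed
  have "(sigma_min_pos (bcirc A))\<^sup>2 * (tnorm E)\<^sup>2 \<le> (tnorm (A *\<^sub>t E))\<^sup>2"
    using sigma_min_pos_le[OF bcirc_carrier[OF A n] bcirc_neq_zero[OF A n A0] unfold_carrier[OF E n] K row]
    by (simp add: tnorm_sq_unfold[OF E n] tnorm_sq_unfold[OF AE n] unfold_tprod[OF A E n])
  also have "\<dots> = (\<Sum>i<a. (tnorm (hslices (A *\<^sub>t E) {i}))\<^sup>2)" by (rule tnorm_sq_sum_hslices[OF AE n])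
  also have "\<dots> = (\<Sum>i\<in>{..<a} - J. (tnorm (hslices (A *\<^sub>t E) {i}))\<^sup>2)"
    using J0 by (intro sum.mono_neutral_right) auto
  also have "\<dots> \<le> (\<Sum>i\<in>{..<a} - J. n * (tnorm (hslices A {i}))\<^sup>2 * (tnorm E)\<^sup>2)"
    by (intro sum_mono le) auto
  \<comment> \<open>Strictness: the rows in \<open>J\<close> contribute nothing to the norm of
    \<open>A *\<^sub>t E\<close> but a positive amount to its upper bound.\<close>
  also have "\<dots> < (\<Sum>i<a. n * (tnorm (hslices A {i}))\<^sup>2 * (tnorm E)\<^sup>2)"
  proof -
    have "(\<Sum>i<a. n * (tnorm (hslices A {i}))\<^sup>2 * (tnorm E)\<^sup>2) =
      (\<Sum>i\<in>{..<a} - J. n * (tnorm (hslices A {i}))\<^sup>2 * (tnorm E)\<^sup>2) +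
      n * (tnorm E)\<^sup>2 * (\<Sum>i\<in>J. (tnorm (hslices A {i}))\<^sup>2)"
      using sum.subset_diff[OF J, of "\<lambda>i. n * (tnorm (hslices A {i}))\<^sup>2 * (tnorm E)\<^sup>2"]
      by (simp add: sum_distrib_left ac_simps)
    then show ?thesis using AJ_pos E_pos n by simp
  qed
  also have "\<dots> = n * (tnorm A)\<^sup>2 * (tnorm E)\<^sup>2"
    by (simp add: tnorm_sq_sum_hslices[OF A n] sum_distrib_left sum_distrib_right)
  finally have "(sigma_min_pos (bcirc A))\<^sup>2 * (tnorm E)\<^sup>2 < n * (tnorm A)\<^sup>2 * (tnorm E)\<^sup>2" .
  then have "(sigma_min_pos (bcirc A))\<^sup>2 < n * (tnorm A)\<^sup>2" using E_pos by simp
  then show ?thesis by (simp add: mat_fnorm_sq mat_inner_bcirc[OF A n])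
qed

section \<open>Perturbed linear recursions\<close>

text \<open>\<open>T\<close> is the response of the recursion to the bare perturbation from start
  value 0. Leaving it abstract serves the distinct and the equal case, where its closed forms
  differ.\<close>

lemma perturbed_recursion_le:
  fixes e T :: "nat \<Rightarrow> real"
  assumes "0 \<le> \<alpha>" and e: "\<And>k. e (Suc k) \<le> \<alpha> * e k + c * \<beta> ^ Suc k"
    and T: "T 0 = 0" "\<And>k. T (Suc k) = \<alpha> * T k + \<beta> ^ Suc k"
  shows "e k \<le> \<alpha> ^ k * e 0 + c * T k"
proof (induction k)
  case (Suc k)
  have "e (Suc k) \<le> \<alpha> * e k + c * \<beta> ^ Suc k" by (rule e)
  also have "\<dots> \<le> \<alpha> * (\<alpha> ^ k * e 0 + c * T k) + c * \<beta> ^ Suc k"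
    using mult_left_mono[OF Suc.IH assms(1)] by simp
  also have "\<dots> = \<alpha> ^ Suc k * e 0 + c * T (Suc k)"
    by (simp add: T algebra_simps)
  finally show ?case .
qed (simp add: T)

lemma perturbed_recursion_geometric:
  fixes e :: "nat \<Rightarrow> real"
  assumes \<alpha>: "0 < \<alpha>" "\<alpha> < 1" and \<beta>: "0 < \<beta>" "\<beta> < 1" and c: "0 \<le> c" and e0: "0 \<le> e 0"
    and e: "\<And>k. e (Suc k) \<le> \<alpha> * e k + c * \<beta> ^ Suc k"
  obtains C \<rho> where "0 \<le> C" "0 < \<rho>" "\<rho> < 1" "\<And>k. e k \<le> C * \<rho> ^ k"
proof -
  \<comment> \<open>A rate strictly above both \<alpha> and \<beta>, so that
    \<open>\<rho> - \<alpha>\<close> may stand in a denominator even if \<alpha> = \<beta>.\<close>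
  define \<rho> where "\<rho> = (max \<alpha> \<beta> + 1) / 2"
  have \<rho>: "\<alpha> < \<rho>" "\<beta> \<le> \<rho>" "0 < \<rho>" "\<rho> < 1" using \<alpha> \<beta> by (auto simp: \<rho>_def)
  \<comment> \<open>Chosen to cover the start value and to satisfy
    \<open>\<alpha> * C + c * \<rho> \<le> \<rho> * C\<close>, the inequality that closes the
    induction.\<close>
  define C where "C = e 0 + c * \<rho> / (\<rho> - \<alpha>)"
  have C0: "0 \<le> C" using e0 c \<rho> by (simp add: C_def)
  have "c * \<rho> / (\<rho> - \<alpha>) \<le> C" using e0 by (simp add: C_def)
  then have C: "c * \<rho> \<le> C * (\<rho> - \<alpha>)" using \<rho> by (simp add: field_simps)
  have "e k \<le> C * \<rho> ^ k" for k
  proof (induction k)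
    case 0
    then show ?case using c \<rho> by (simp add: C_def)
  next
    case (Suc k)
    have "e (Suc k) \<le> \<alpha> * e k + c * \<beta> ^ Suc k" by (rule e)
    also have "\<dots> \<le> \<alpha> * (C * \<rho> ^ k) + c * \<rho> ^ Suc k"
      using Suc.IH \<alpha> \<beta> \<rho> c by (intro add_mono mult_left_mono power_mono) auto
    also have "\<dots> = (\<alpha> * C + c * \<rho>) * \<rho> ^ k" by (simp add: algebra_simps)
    also have "\<dots> \<le> (\<rho> * C) * \<rho> ^ k"
      using C \<rho> by (intro mult_right_mono) (auto simp: algebra_simps)
    finally show ?case by (simp add: algebra_simps)
  qed
  then show ?thesis using that C0 \<rho> by blast
qed

theorem theorem3p2:
  fixes N1 N2 N3 K :: nat
    and A B Bperp Xstar :: tensor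
    and X :: "nat \<Rightarrow> tensor"
    and \<eta> \<theta> \<alpha> \<beta> \<gamma> :: real
  assumes dims: "1 \<le> N1" "1 \<le> N2" "1 \<le> N3" "1 \<le> K"
    and A: "A \<in> tensor_carrier N1 N2 N3"
    and B: "B \<in> tensor_carrier N1 K N3"
    and eta: "0 < \<eta>" "\<eta> \<le> 1"
    and horizontal_nonzero: "\<And>i. i < N1 \<Longrightarrow> hslices A {i} \<noteq> tzero 1 N2 N3"
    and lateral_nonzero: "\<And>j. j < N2 \<Longrightarrow> lslices A {j} \<noteq> tzero N1 1 N3"
    and inconsistent: "B \<notin> trange K A"
    and Bperp: "Bperp = B -\<^sub>t A *\<^sub>t tpinv A *\<^sub>t B"
    and X: "X = tgdbek_X \<eta> A B"
    and Xstar: "Xstar = tpinv A *\<^sub>t B"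
    and X_ne_Xstar: "\<And>k. X k \<noteq> Xstar"
    and theta_k: "\<And>k. 0 < theta_seq \<eta> A B k" "\<And>k. theta_seq \<eta> A B k < 1"
    and theta_min: "\<theta> \<in> range (theta_seq \<eta> A B)" "\<And>k. \<theta> \<le> theta_seq \<eta> A B k"
    and theta_pos: "0 < \<theta>"
    and alpha: "\<alpha> = 1 - \<theta> * kappa_block A"
    and gamma: "\<gamma> = 1 / (sigma_min_block A)\<^sup>2"
    and beta: "\<beta> = 1 - \<eta> * ((sigma_min_pos (bcirc A))\<^sup>2 / (mat_fnorm (bcirc A))\<^sup>2)"
  shows "Bperp \<in> tnull K (ttranspose A) \<and>
    0 < \<alpha> \<and> \<alpha> < 1 \<and> 0 < \<beta> \<and> \<beta> < 1 \<and>
    (\<forall>Y. min_norm_least_squares_solution A B Y \<longleftrightarrow> Y = Xstar) \<and>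
    converges_linearly X Xstar \<and>
    (\<alpha> \<noteq> \<beta> \<longrightarrow> (\<forall>k. (tnorm (X (k + 1) -\<^sub>t Xstar))\<^sup>2
       \<le> \<alpha> ^ (k + 1) * (tnorm (X 0 -\<^sub>t Xstar))\<^sup>2
         + \<gamma> * ((\<alpha> ^ (k + 1) - \<beta> ^ (k + 1)) / (\<alpha> - \<beta>)) * \<beta> * (tnorm (B -\<^sub>t Bperp))\<^sup>2)) \<and>
    (\<alpha> = \<beta> \<longrightarrow> (\<forall>k. (tnorm (X (k + 1) -\<^sub>t Xstar))\<^sup>2
       \<le> \<alpha> ^ (k + 1) * (tnorm (X 0 -\<^sub>t Xstar))\<^sup>2
         + \<gamma> * real (k + 1) * \<alpha> ^ (k + 1) * (tnorm (B -\<^sub>t Bperp))\<^sup>2))"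
proof -

  \<comment> \<open>The residual of B and the limit\<close>
  have n: "0 < N3" and K: "0 < K" and N2: "0 < N2" and N1: "0 < N1" using dims by auto
  note dA = tensor_carrier_dims[OF A n] and dB = tensor_carrier_dims[OF B n]
  have Xs: "Xstar \<in> tensor_carrier N2 K N3"
    unfolding Xstar by (rule tprod_carrier[OF tpinv_carrier[OF A n] B n])
  note AAB = tprod_carrier[OF tprod_carrier[OF A tpinv_carrier[OF A n] n] B n]
  have Bp: "Bperp \<in> tensor_carrier N1 K N3" unfolding Bperp by (rule tminus_carrier[OF B AAB])
  have ABp: "ttranspose A *\<^sub>t Bperp = tzero N2 K N3"
    unfolding Bperp by (rule ttranspose_residual[OF A n B])
  have null: "Bperp \<in> tnull K (ttranspose A)"
    using Bp ABp by (simp add: tnull_def tensor_carrier_dims[OF ttranspose_carrier[OF A] n])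
  have AXs: "A *\<^sub>t Xstar = A *\<^sub>t tpinv A *\<^sub>t B"
    unfolding Xstar by (rule tprod_assoc[OF A tpinv_carrier[OF A n] B n, symmetric])
  \<comment> \<open>The Z-iteration starts at \<open>B\<close>, so its initial error relative to
    \<open>Bperp\<close> lies in the range of \<open>A\<close>.\<close>
  have BBp: "B -\<^sub>t Bperp = A *\<^sub>t Xstar"
  proof (rule tensor_eqI[OF tminus_carrier[OF B Bp] tprod_carrier[OF A Xs n]])
    fix k i j assume *: "k < N3" "i < N1" "j < K"
    have "Bperp ! k $$ (i, j) = B ! k $$ (i, j) - (A *\<^sub>t tpinv A *\<^sub>t B) ! k $$ (i, j)"
      unfolding Bperp by (rule tminus_index[OF B AAB *])
    then show "(B -\<^sub>t Bperp) ! k $$ (i, j) = (A *\<^sub>t Xstar) ! k $$ (i, j)"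
      unfolding AXs tminus_index[OF B Bp *] by simp
  qed

  \<comment> \<open>Positivity of the constants in \<beta>\<close>
  have A0: "A \<noteq> tzero N1 N2 N3"
  proof
    assume "A = tzero N1 N2 N3"
    then have "(tnorm (hslices A {0}))\<^sup>2 \<le> 0"
      using tnorm_hslices_le[OF A n, of "{0}"] tnorm_eq_0_iff[OF A n] N1 by simp
    moreover have "hslices A {0} \<in> tensor_carrier 1 N2 N3"
      using hslices_carrier[OF A, of "{0}"] N1 by simp
    ultimately have "hslices A {0} = tzero 1 N2 N3"
      using tnorm_eq_0_iff[OF _ n] by fastforce
    then show False using horizontal_nonzero N1 by blast
  qed
  define sA where "sA = (sigma_min_pos (bcirc A))\<^sup>2"
  define F where "F = (mat_fnorm (bcirc A))\<^sup>2"
  have sA: "0 < sA"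
    unfolding sA_def using sigma_min_pos_gt_0[OF bcirc_carrier[OF A n] bcirc_neq_zero[OF A n A0]] by simp
  have F: "0 < F"
    using tnorm_sq_pos[OF A n A0] n by (simp add: F_def mat_fnorm_sq mat_inner_bcirc[OF A n])

  \<comment> \<open>The block constants\<close>
  have rb: "J \<in> row_blocks A \<longleftrightarrow> J \<subseteq> {..<N1} \<and> J \<noteq> {}" for J
    by (simp add: row_blocks_def dA)
  have fin: "finite (row_blocks A)" by (simp add: row_blocks_def)
  have rb_ne: "row_blocks A \<noteq> {}" using N1 rb[of "{0}"] by auto
  have block: "0 < sigma_min_pos (bcirc (hslices A J))"
    "sigma_min_pos (bcirc (hslices A J)) \<le> sigma_max (bcirc (hslices A J))"
    if "J \<in> row_blocks A" for J
  proof -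
    have J: "J \<subseteq> {..<N1}" "J \<noteq> {}" using that by (auto simp: rb)
    note AJ = hslices_carrier[OF A J(1)]
    have "bcirc (hslices A J) \<noteq> 0\<^sub>m (card J * N3) (N2 * N3)"
      using hslices_neq_tzero[OF A n _ J] horizontal_nonzero by (intro bcirc_neq_zero[OF AJ n]) blast
    then show "0 < sigma_min_pos (bcirc (hslices A J))"
      "sigma_min_pos (bcirc (hslices A J)) \<le> sigma_max (bcirc (hslices A J))"
      using sigma_min_pos_gt_0[OF bcirc_carrier[OF AJ n]] sigma_min_pos_le_sigma_max[OF bcirc_carrier[OF AJ n]]
      by auto
  qed
  have "kappa_block A \<in> (\<lambda>J. (sigma_min_pos (bcirc (hslices A J)))\<^sup>2 / (sigma_max (bcirc (hslices A J)))\<^sup>2) ` row_blocks A"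
    unfolding kappa_block_def using fin rb_ne by (intro Min_in) auto
  then obtain J0 where J0: "J0 \<in> row_blocks A"
    "kappa_block A = (sigma_min_pos (bcirc (hslices A J0)))\<^sup>2 / (sigma_max (bcirc (hslices A J0)))\<^sup>2" by auto
  have kappa: "0 < kappa_block A" "kappa_block A \<le> 1"
  proof -
    note b = block[OF J0(1)]
    have "(sigma_min_pos (bcirc (hslices A J0)))\<^sup>2 \<le> (sigma_max (bcirc (hslices A J0)))\<^sup>2"
      using b by (intro power_mono) auto
    then show "0 < kappa_block A" "kappa_block A \<le> 1"
      unfolding J0(2) using b by (auto simp: divide_le_eq_1)
  qed
  have "sigma_min_block A \<in> (\<lambda>J. sigma_min_pos (bcirc (hslices A J))) ` row_blocks A"
    unfolding sigma_min_block_def using fin rb_ne by (intro Min_in) auto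
  then have sb: "0 < sigma_min_block A" using block by auto
  have gamma0: "0 \<le> \<gamma>" by (simp add: gamma)
  have gamma_le: "1 / (sigma_min_pos (bcirc (hslices A J)))\<^sup>2 \<le> \<gamma>" if "J \<in> row_blocks A" for J
  proof -
    have "sigma_min_block A \<le> sigma_min_pos (bcirc (hslices A J))"
      unfolding sigma_min_block_def using fin that by (intro Min_le) auto
    then show ?thesis unfolding gamma using sb by (intro divide_left_mono power_mono) auto
  qed

  \<comment> \<open>The range of \<alpha>\<close>
  have theta1: "\<theta> < 1" using theta_min(2)[of 0] theta_k(2)[of 0] by linarith
  have tk1: "\<theta> * kappa_block A \<le> \<theta>" using mult_left_mono[OF kappa(2), of \<theta>] theta_pos by simp
  have alpha01: "0 < \<alpha>" "\<alpha> < 1"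
    unfolding alpha using tk1 theta1 mult_pos_pos[OF theta_pos kappa(1)] by linarith+

  \<comment> \<open>Contraction of the Z-iterates\<close>
  define Z where "Z = tgdbek_Z \<eta> A B"
  define U where "U k = lslices A (select_U \<eta> A (Z k))" for k
  have Z0: "Z 0 = B" by (simp add: Z_def)
  have ZS: "Z (Suc k) = Z k -\<^sub>t U k *\<^sub>t tpinv (U k) *\<^sub>t Z k" for k
    by (simp add: Z_def U_def Let_def)
  have Zinv: "Z k \<in> tensor_carrier N1 K N3 \<and> (\<exists>Y\<in>tensor_carrier N2 K N3. Z k -\<^sub>t Bperp = A *\<^sub>t Y)" for k
  proof (induction k)
    case 0
    then show ?case using B BBp Xs by (auto simp: Z0)
  next
    case (Suc k)
    then obtain Y where Y: "Y \<in> tensor_carrier N2 K N3" "Z k -\<^sub>t Bperp = A *\<^sub>t Y"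
      and Zk: "Z k \<in> tensor_carrier N1 K N3" by blast
    show ?case
      using z_step(1,2)[OF A n N2 K Zk Bp ABp Y lateral_nonzero eta U_def ZS] by blast
  qed
  have ZT: "Z k \<in> tensor_carrier N1 K N3" for k using Zinv by blast
  have Zstep: "(tnorm (Z (Suc k) -\<^sub>t Bperp))\<^sup>2 \<le> \<beta> * (tnorm (Z k -\<^sub>t Bperp))\<^sup>2" for k
  proof -
    obtain Y where Y: "Y \<in> tensor_carrier N2 K N3" "Z k -\<^sub>t Bperp = A *\<^sub>t Y" using Zinv by blast
    show ?thesis
      unfolding beta by (rule z_step(3)[OF A n N2 K ZT Bp ABp Y lateral_nonzero eta U_def ZS])
  qed

  \<comment> \<open>The X-iterates and their row blocks\<close>
  define J where "J = tgdbek_J \<eta> A B"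
  have J_eq: "J k = select_J \<eta> A B (Z (Suc k)) (X k)" for k
    by (simp only: J_def tgdbek_J_def Z_def X)
  have X0: "X 0 = tzero N2 K N3" by (simp add: X dA dB)
  define R where "R k = hslices B (J k) -\<^sub>t hslices (Z (Suc k)) (J k) -\<^sub>t hslices A (J k) *\<^sub>t X k" for k
  have XS: "X (Suc k) = X k +\<^sub>t tpinv (hslices A (J k)) *\<^sub>t R k" for k
    unfolding R_def J_eq Z_def X by (simp only: tgdbek_X.simps Let_def)
  have J_block: "J k \<in> row_blocks A" for k
  proof -
    define h where "h i = (tnorm (hslices A {i}))\<^sup>2" for i
    define g where "g i = (tnorm (hslices B {i} -\<^sub>t hslices (Z (Suc k)) {i} -\<^sub>t hslices A {i} *\<^sub>t X k))\<^sup>2" for i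
    have "0 < h i" if "i < N1" for i
      unfolding h_def using that horizontal_nonzero hslices_carrier[OF A, of "{i}"]
      by (intro tnorm_sq_pos[of _ 1 N2 N3] n) auto
    moreover have "0 \<le> g i" for i by (simp add: g_def)
    moreover have "eps_x \<eta> A B (Z (Suc k)) (X k) = \<eta> * Max ((\<lambda>i. g i / h i) ` {..<N1})"
      by (simp add: eps_x_def dA g_def h_def)
    moreover have "J k = {i. i < N1 \<and> g i \<ge> eps_x \<eta> A B (Z (Suc k)) (X k) * h i}"
      by (simp add: J_eq select_J_def dA g_def h_def)
    ultimately show ?thesis
      unfolding rb using greedy_selection(1,2)[OF N1 eta, of g h] by metis
  qed
  have Jss: "J k \<subseteq> {..<N1}" "J k \<noteq> {}" for k using J_block[of k] by (auto simp: rb)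
  note AJ = hslices_carrier[OF A Jss(1)]
  have AJ0: "hslices A (J k) \<noteq> tzero (card (J k)) N2 N3" for k
    using hslices_neq_tzero[OF A n _ Jss] horizontal_nonzero by blast

  \<comment> \<open>Errors in the row space of A\<close>
  define M where "M = bcirc A"
  have M: "M \<in> carrier_mat (N1 * N3) (N2 * N3)" unfolding M_def by (rule bcirc_carrier[OF A n])
  let ?Q = "mat_pinv M * M"
  have Q: "?Q \<in> carrier_mat (N2 * N3) (N2 * N3)" by (rule row_projection(1)[OF M])
  have QPJ: "?Q * (mat_pinv (bcirc (hslices A (J k))) * V) = mat_pinv (bcirc (hslices A (J k))) * V"
    if "V \<in> carrier_mat (card (J k) * N3) K" for V k
  proof -
    have "?Q * (mat_pinv (bcirc (hslices A (J k))) * V) = ?Q * mat_pinv (bcirc (hslices A (J k))) * V"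
      using that M bcirc_carrier[OF AJ n, of k] by (simp add: assoc_mult_mat_dim)
    then show ?thesis by (simp only: M_def row_space_pinv_hslices[OF A n Jss(1)])
  qed
  have uXs: "unfold Xstar \<in> carrier_mat (N2 * N3) K" by (rule unfold_carrier[OF Xs n])
  have QXs: "?Q * unfold Xstar = unfold Xstar"
  proof -
    have u: "unfold Xstar = mat_pinv M * unfold B"
      unfolding Xstar unfold_tprod[OF tpinv_carrier[OF A n] B n] bcirc_tpinv[OF A n] M_def ..
    have "?Q * (mat_pinv M * unfold B) = mat_pinv M * M * mat_pinv M * unfold B"
      using M unfold_carrier[OF B n] by (simp add: assoc_mult_mat_dim)
    then show ?thesis unfolding u by (simp only: penrose)
  qed
  \<comment> \<open>The zero start lies in the row space of \<open>A\<close> and each correction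
    does by \<open>QPJ\<close>. Since \<open>Xstar\<close> does as well, so do all errors.\<close>
  have Xinv: "X k \<in> tensor_carrier N2 K N3 \<and> ?Q * unfold (X k) = unfold (X k)" for k
  proof (induction k)
    case 0
    then show ?case unfolding X0 using right_mult_zero_mat[OF Q] by (simp only: tzero_carrier unfold_tzero[OF n] simp_thms)
  next
    case (Suc k)
    then have Xk: "X k \<in> tensor_carrier N2 K N3" and QX: "?Q * unfold (X k) = unfold (X k)" by auto
    have RT: "R k \<in> tensor_carrier (card (J k)) K N3"
      unfolding R_def
      by (rule tminus_carrier[OF tminus_carrier[OF hslices_carrier[OF B Jss(1)] hslices_carrier[OF ZT Jss(1)]]
            tprod_carrier[OF AJ Xk n]])
    note PR = tprod_carrier[OF tpinv_carrier[OF AJ n] RT n]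
    have uPR: "unfold (tpinv (hslices A (J k)) *\<^sub>t R k) = mat_pinv (bcirc (hslices A (J k))) * unfold (R k)"
      unfolding unfold_tprod[OF tpinv_carrier[OF AJ n] RT n] bcirc_tpinv[OF AJ n] ..
    have "?Q * unfold (X (Suc k)) = unfold (X (Suc k))"
      unfolding XS unfold_tadd[OF Xk PR n]
        mult_add_distrib_mat[OF Q unfold_carrier[OF Xk n] unfold_carrier[OF PR n]] QX
      unfolding uPR QPJ[OF unfold_carrier[OF RT n]] ..
    then show ?case unfolding XS using tadd_carrier[OF Xk PR] by blast
  qed
  have XT: "X k \<in> tensor_carrier N2 K N3" for k using Xinv by blast
  note E = tminus_carrier[OF XT Xs]
  define PE where "PE k = tpinv (hslices A (J k)) *\<^sub>t hslices A (J k) *\<^sub>t (X k -\<^sub>t Xstar)" for k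
  have PE: "PE k \<in> tensor_carrier N2 K N3" for k
    unfolding PE_def by (rule tprod_carrier[OF tprod_carrier[OF tpinv_carrier[OF AJ n] AJ n] E n])
  have E_pos: "0 < (tnorm (X k -\<^sub>t Xstar))\<^sup>2" for k
  proof (rule tnorm_sq_pos[OF E n], rule notI)
    assume "X k -\<^sub>t Xstar = tzero N2 K N3"
    then have "unfold (X k) - unfold Xstar = 0\<^sub>m (N2 * N3) K"
      using unfold_tminus[OF XT Xs n, of k] unfold_tzero[OF n] by metis
    then have "unfold (X k) = unfold Xstar"
      by (simp only: minus_eq_zero_mat_iff[OF unfold_carrier[OF XT n] uXs])
    then show False using X_ne_Xstar unfold_inj[OF XT Xs] by blast
  qed
  have theta_eq: "theta_seq \<eta> A B k = (tnorm (PE k))\<^sup>2 / (tnorm (X k -\<^sub>t Xstar))\<^sup>2" for k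
    unfolding theta_seq_def Let_def J_def[symmetric] X[symmetric] Xstar[symmetric] dB PE_def
    using orth_proj_trange_ttranspose[OF AJ n E] by simp

  \<comment> \<open>The range of \<beta>\<close>
  have "sA < F"
  proof -
    define e where "e = unfold (X 0 -\<^sub>t Xstar)"
    have e: "e \<in> carrier_mat (N2 * N3) K" unfolding e_def by (rule unfold_carrier[OF E n])
    define N where "N = bcirc (hslices A (J 0))"
    have N: "N \<in> carrier_mat (card (J 0) * N3) (N2 * N3)" unfolding N_def by (rule bcirc_carrier[OF AJ n])
    let ?P = "mat_pinv N * N"
    note rp = row_projection(1,2,3)[OF N]
    \<comment> \<open>The component of the initial error outside the row space of the first block:
      nonzero because the first \<theta>-quotient is below 1, annihilated by that block, and still
      in the row space of \<open>A\<close>.\<close>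
    define D where "D = X 0 -\<^sub>t Xstar -\<^sub>t PE 0"
    have D: "D \<in> tensor_carrier N2 K N3" unfolding D_def by (rule tminus_carrier[OF E PE])
    have uPE: "unfold (PE 0) = ?P * e" unfolding PE_def unfold_tpinv_proj[OF AJ n E] N_def e_def ..
    have uD: "unfold D = e - ?P * e" unfolding D_def unfold_tminus[OF E PE n] uPE e_def ..
    have "(tnorm (PE 0))\<^sup>2 < (tnorm (X 0 -\<^sub>t Xstar))\<^sup>2"
      using theta_k(2)[of 0] E_pos[of 0] by (simp add: theta_eq)
    then have "0 < (tnorm D)\<^sup>2"
      using projection_norm[OF rp e]
      unfolding tnorm_sq_unfold[OF D n] tnorm_sq_unfold[OF PE n] tnorm_sq_unfold[OF E n] uD uPE e_def[symmetric]
      by linarith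
    then have D0: "D \<noteq> tzero N2 K N3" using tnorm_eq_0_iff[OF D n] by auto
    have Qe: "?Q * e = e"
      unfolding e_def unfold_tminus[OF XT Xs n] mult_minus_distrib_mat[OF Q unfold_carrier[OF XT n] uXs] QXs
      using Xinv[of 0] by simp
    have "?P * e = mat_pinv N * (N * e)" using N e by (simp add: assoc_mult_mat_dim)
    then have QPe: "?Q * (?P * e) = ?P * e"
      using QPJ[of "N * e" 0] N e unfolding N_def[symmetric] by simp
    have row: "mat_pinv (bcirc A) * bcirc A * unfold D = unfold D"
      unfolding uD M_def[symmetric] mult_minus_distrib_mat[OF Q e mult_carrier_mat[OF rp(1) e]] Qe QPe ..
    have "N * (e - ?P * e) = N * e - N * mat_pinv N * N * e"
      using N e by (simp add: mult_minus_distrib_dim assoc_mult_mat_dim)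
    also have "\<dots> = N * e - N * e" by (simp only: penrose)
    also have "\<dots> = 0\<^sub>m (card (J 0) * N3) K" using N e by auto
    finally have ker: "hslices A (J 0) *\<^sub>t D = tzero (card (J 0)) K N3"
      by (intro tprod_eqI[OF AJ D n tzero_carrier]) (simp add: uD unfold_tzero[OF n] flip: N_def)
    show ?thesis
      unfolding sA_def F_def by (rule sigma_min_pos_less_fnorm[OF A n K Jss(1) AJ0 D D0 row ker])
  qed
  then have ratio: "0 < sA / F" "sA / F < 1" using sA F by simp_all
  have beta_eq: "\<beta> = 1 - \<eta> * (sA / F)" by (simp add: beta sA_def F_def)
  have beta01: "0 < \<beta>" "\<beta> < 1"
  proof -
    have "\<eta> * (sA / F) \<le> sA / F" using mult_right_mono[OF eta(2), of "sA / F"] ratio by simp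
    then show "0 < \<beta>" "\<beta> < 1"
      unfolding beta_eq using ratio mult_pos_pos[OF eta(1) ratio(1)] by linarith+
  qed

  \<comment> \<open>The recursion for the squared errors\<close>
  define c where "c = \<gamma> * (tnorm (B -\<^sub>t Bperp))\<^sup>2"
  have c0: "0 \<le> c" using gamma0 by (simp add: c_def)
  have Zbound: "(tnorm (Z k -\<^sub>t Bperp))\<^sup>2 \<le> \<beta> ^ k * (tnorm (B -\<^sub>t Bperp))\<^sup>2" for k
  proof (induction k)
    case (Suc k)
    have "(tnorm (Z (Suc k) -\<^sub>t Bperp))\<^sup>2 \<le> \<beta> * (tnorm (Z k -\<^sub>t Bperp))\<^sup>2" by (rule Zstep)
    also have "\<dots> \<le> \<beta> * (\<beta> ^ k * (tnorm (B -\<^sub>t Bperp))\<^sup>2)"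
      using Suc.IH beta01 by (intro mult_left_mono) auto
    finally show ?case by (simp add: mult.assoc)
  qed (simp add: Z0)
  define e where "e k = (tnorm (X k -\<^sub>t Xstar))\<^sup>2" for k
  have rec: "e (Suc k) \<le> \<alpha> * e k + c * \<beta> ^ Suc k" for k
  proof -
    \<comment> \<open>The inexactness of the X-step: the block residual would be exactly minus the
      block applied to the error if \<open>Z (Suc k)\<close> equalled \<open>Bperp\<close>.\<close>
    define W where "W = hslices (Bperp -\<^sub>t Z (Suc k)) (J k)"
    note BZ = tminus_carrier[OF Bp ZT[of "Suc k"]]
    have W: "W \<in> tensor_carrier (card (J k)) K N3" unfolding W_def by (rule hslices_carrier[OF BZ Jss(1)])
    define s where "s = (sigma_min_pos (bcirc (hslices A (J k))))\<^sup>2"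
    have R_eq: "R k = W -\<^sub>t hslices A (J k) *\<^sub>t (X k -\<^sub>t Xstar)"
    proof -
      note AX = tprod_carrier[OF AJ XT[of k] n, of k] and AXst = tprod_carrier[OF AJ Xs n, of k]
      note bJ = hslices_carrier[OF B Jss(1)[of k]] and pJ = hslices_carrier[OF Bp Jss(1)[of k]]
        and zJ = hslices_carrier[OF ZT[of "Suc k"] Jss(1)[of k]]
      have W_eq: "W = hslices Bperp (J k) -\<^sub>t hslices (Z (Suc k)) (J k)"
        unfolding W_def by (rule hslices_tminus[OF Bp ZT Jss(1)])
      have b_eq: "hslices B (J k) -\<^sub>t hslices Bperp (J k) = hslices A (J k) *\<^sub>t Xstar"
        unfolding hslices_tminus[OF B Bp Jss(1), symmetric] BBp by (rule hslices_tprod[OF A Xs Jss(1) n])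
      show ?thesis
        unfolding R_def W_eq tprod_minus_right[OF AJ XT Xs n]
      proof (rule tensor_eqI[OF tminus_carrier[OF tminus_carrier[OF bJ zJ] AX]
            tminus_carrier[OF tminus_carrier[OF pJ zJ] tminus_carrier[OF AX AXst]]])
        fix q i j assume *: "q < N3" "i < card (J k)" "j < K"
        have "(hslices A (J k) *\<^sub>t Xstar) ! q $$ (i, j) =
            hslices B (J k) ! q $$ (i, j) - hslices Bperp (J k) ! q $$ (i, j)"
          unfolding b_eq[symmetric] by (rule tminus_index[OF bJ pJ *])
        then show "(hslices B (J k) -\<^sub>t hslices (Z (Suc k)) (J k) -\<^sub>t hslices A (J k) *\<^sub>t X k) ! q $$ (i, j) =
            (hslices Bperp (J k) -\<^sub>t hslices (Z (Suc k)) (J k) -\<^sub>t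
              (hslices A (J k) *\<^sub>t X k -\<^sub>t hslices A (J k) *\<^sub>t Xstar)) ! q $$ (i, j)"
          unfolding tminus_index[OF tminus_carrier[OF bJ zJ] AX *] tminus_index[OF bJ zJ *]
            tminus_index[OF tminus_carrier[OF pJ zJ] tminus_carrier[OF AX AXst] *]
            tminus_index[OF pJ zJ *] tminus_index[OF AX AXst *]
          by simp
      qed
    qed
    have "e (Suc k) \<le> e k - (tnorm (PE k))\<^sup>2 + (tnorm W)\<^sup>2 / s"
      using x_step[OF AJ n K AJ0 XT Xs W R_eq] unfolding e_def XS PE_def s_def .
    moreover have "\<theta> * e k \<le> (tnorm (PE k))\<^sup>2"
      using theta_min(2)[of k] E_pos[of k] by (simp add: theta_eq e_def field_simps)
    moreover have "\<theta> * kappa_block A * e k \<le> \<theta> * e k"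
      using tk1 by (intro mult_right_mono) (auto simp: e_def)
    \<comment> \<open>The exponent is \<open>Suc k\<close> because step \<open>k\<close> of X
      already uses the updated \<open>Z (Suc k)\<close>; this is the source of the separate factor
      \<beta> in the first estimate.\<close>
    moreover have "(tnorm W)\<^sup>2 / s \<le> c * \<beta> ^ Suc k"
    proof -
      have "(tnorm W)\<^sup>2 \<le> (tnorm (Z (Suc k) -\<^sub>t Bperp))\<^sup>2"
        using tnorm_hslices_le[OF BZ n Jss(1)] unfolding W_def tnorm_sq_minus_commute[OF Bp ZT n] .
      also have "\<dots> \<le> \<beta> ^ Suc k * (tnorm (B -\<^sub>t Bperp))\<^sup>2" by (rule Zbound)
      finally have w: "(tnorm W)\<^sup>2 \<le> \<beta> ^ Suc k * (tnorm (B -\<^sub>t Bperp))\<^sup>2" .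
      have "(tnorm W)\<^sup>2 / s \<le> \<gamma> * (tnorm W)\<^sup>2"
        using mult_right_mono[OF gamma_le[OF J_block[of k]], of "(tnorm W)\<^sup>2"] by (simp add: s_def)
      also have "\<dots> \<le> \<gamma> * (\<beta> ^ Suc k * (tnorm (B -\<^sub>t Bperp))\<^sup>2)"
        by (rule mult_left_mono[OF w gamma0])
      finally show ?thesis by (simp add: c_def ac_simps)
    qed
    ultimately show ?thesis unfolding alpha by (simp add: left_diff_distrib)
  qed

  \<comment> \<open>Linear convergence and the two estimates\<close>
  have conv: "converges_linearly X Xstar"
  proof -
    have e0: "0 \<le> e 0" by (simp add: e_def)
    obtain C \<rho> where C: "0 \<le> C" "0 < \<rho>" "\<rho> < 1" and bound: "\<And>k. e k \<le> C * \<rho> ^ k"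
      using perturbed_recursion_geometric[where e = e, OF alpha01 beta01 c0 e0 rec] by blast
    \<comment> \<open>The recursion bounds squared norms, so constant and rate pass through a square
      root.\<close>
    have "tnorm (X k -\<^sub>t Xstar) \<le> sqrt C * sqrt \<rho> ^ k" for k
      using real_le_rsqrt[OF bound[of k, unfolded e_def]]
      by (simp add: real_sqrt_mult real_sqrt_power)
    then show ?thesis
      unfolding converges_linearly_def using C
      by (intro exI[of _ "sqrt C"] exI[of _ "sqrt \<rho>"]) simp
  qed
  have ne: "(tnorm (X (k + 1) -\<^sub>t Xstar))\<^sup>2 \<le> \<alpha> ^ (k + 1) * (tnorm (X 0 -\<^sub>t Xstar))\<^sup>2
         + \<gamma> * ((\<alpha> ^ (k + 1) - \<beta> ^ (k + 1)) / (\<alpha> - \<beta>)) * \<beta> * (tnorm (B -\<^sub>t Bperp))\<^sup>2"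
    if "\<alpha> \<noteq> \<beta>" for k
  proof -
    \<comment> \<open>Closed form of the sum of \<alpha>^(k-i) \<beta>^i over 1 \<le> i \<le> k; for
      \<alpha> = \<beta> the same sum is k \<alpha>^k, the instance used in the other case.\<close>
    define T where "T k = \<beta> * ((\<alpha> ^ k - \<beta> ^ k) / (\<alpha> - \<beta>))" for k
    have "T (Suc k) = \<alpha> * T k + \<beta> ^ Suc k" for k
    proof -
      have "\<alpha> - \<beta> \<noteq> 0" using that by simp
      then show ?thesis by (simp add: T_def field_simps)
    qed
    then have "e (Suc k) \<le> \<alpha> ^ Suc k * e 0 + c * T (Suc k)"
      using alpha01 by (intro perturbed_recursion_le[where \<beta> = \<beta>] rec) (auto simp: T_def)
    then show ?thesis by (simp add: e_def c_def T_def ac_simps)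
  qed
  have eq: "(tnorm (X (k + 1) -\<^sub>t Xstar))\<^sup>2 \<le> \<alpha> ^ (k + 1) * (tnorm (X 0 -\<^sub>t Xstar))\<^sup>2
         + \<gamma> * real (k + 1) * \<alpha> ^ (k + 1) * (tnorm (B -\<^sub>t Bperp))\<^sup>2"
    if "\<alpha> = \<beta>" for k
  proof -
    have "e (Suc k) \<le> \<alpha> ^ Suc k * e 0 + c * (real (Suc k) * \<alpha> ^ Suc k)"
      using alpha01 that
      by (intro perturbed_recursion_le[where \<beta> = \<beta> and T = "\<lambda>k. real k * \<alpha> ^ k"] rec) (auto simp: algebra_simps)
    then show ?thesis by (simp add: e_def c_def ac_simps)
  qed
  show ?thesis
    using null alpha01 beta01 min_norm_least_squares_solution_iff[OF A n B] conv ne eq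
    by (simp add: Xstar)
qed

end
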